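(* Let $d\ge3$ and $0<\beta<\infty$, and suppose $m_{{\rm s},\beta}\neq0$. Then the transverse correlation $\rho_0(S_x^{(2)}S_y^{(2)})$ does not decay as $|\rho_0(S_x^{(2)}S_y^{(2)})|=o(|x-y|^{-(d-2)})$, i.e. it is not true that $|x-y|^{d-2}|\rho_0(S_x^{(2)}S_y^{(2)})|\to0$ as $|x-y|\to\infty$.
   Context: Spin-$S$ ($S\in\{1/2,1,\dots\}$) operators $S_x^{(i)}$, $i=1,2,3$, at each $x\in\mathbb{Z}^d$ with the usual commutation relations; quasi-local algebra from $\mathfrak{A}_\Gamma=\bigotimes_{x\in\Gamma}M_{2S+1}(\mathbb{C})$. For a positive integer $L$, $\Lambda_L=\{-L+1,\dots,L\}^d$ with periodic boundary conditions; $H_{0,{\rm p}}^{(\Lambda)}=\sum_{\{x,y\}\subset\Lambda:|x-y|=1}\mathbf{S}_x\cdot\mathbf{S}_y$, $O^{(\Lambda)}=\sum_{x\in\Lambda}(-1)^{x^{(1)}+\cdots+x^{(d)}}S_x^{(3)}$, $H_{\rm p}^{(\Lambda)}(B)=H_{0,{\rm p}}^{(\Lambda)}-BO^{(\Lambda)}$. The Gibbs state is $\langle\cdot\rangle^{(\Lambda)}_{B,\beta}={\rm Tr}[(\cdot)e^{-\beta H_{\rm p}^{(\Lambda)}(B)}]/{\rm Tr}\,e^{-\beta H_{\rm p}^{(\Lambda)}(B)}$; $\rho_B$ is its weak$^\ast$-limit as $L\to\infty$ and $\rho_0={\rm weak}^\ast\text{-}\lim_{B\searrow0}\rho_B$ (along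 suitable subsequences). The spontaneous magnetization is $m_{{\rm s},\beta}=\lim_{B\searrow0}\frac{1}{|\Lambda|}\rho_B(O^{(\Lambda)})$ (independent of $\Lambda$ by period-2 translation invariance). *)

theory Defs
  imports "HOL-Analysis.Analysis"
begin

text \<open>Sites of Z^d are int^'d (d = CARD('d)). A spin-S system with n = 2S: the single-site
 basis is indexed by k in {0..n}, the state with S^(3)-eigenvalue m = S - k.
 A configuration on a finite set Lambda is a function site => nat, bounded by n on Lambda and
 0 outside. Operators on the tensor product over Lambda are matrices (kernels) indexed by
 configurations.\<close>

type_synonym 'd site = "int^'d"
type_synonym 'd cfg = "'d site \<Rightarrow> nat"
type_synonym 'd kernel = "'d cfg \<Rightarrow> 'd cfg \<Rightarrow> complex"

definition conf :: "nat \<Rightarrow> 'd site set \<Rightarrow> 'd cfg set" where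
  "conf n \<Lambda> = {\<sigma>. (\<forall>x\<in>\<Lambda>. \<sigma> x \<le> n) \<and> (\<forall>x. x \<notin> \<Lambda> \<longrightarrow> \<sigma> x = 0)}"

definition spin_plus :: "nat \<Rightarrow> nat \<Rightarrow> nat \<Rightarrow> complex" where
  "spin_plus n a b = (let S = real n / 2; m = S - real b in
     if a + 1 = b \<and> b \<le> n then complex_of_real (sqrt (S * (S + 1) - m * (m + 1))) else 0)"

definition spin_minus :: "nat \<Rightarrow> nat \<Rightarrow> nat \<Rightarrow> complex" where
  "spin_minus n a b = spin_plus n b a"

definition spin1 :: "nat \<Rightarrow> nat \<Rightarrow> nat \<Rightarrow> complex" where
  "spin1 n a b = (spin_plus n a b + spin_minus n a b) / 2"

definition spin2 :: "nat \<Rightarrow> nat \<Rightarrow> nat \<Rightarrow> complex" where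
  "spin2 n a b = (spin_plus n a b - spin_minus n a b) / (2 * \<i>)"

definition spin3 :: "nat \<Rightarrow> nat \<Rightarrow> nat \<Rightarrow> complex" where
  "spin3 n a b = (if a = b \<and> a \<le> n then complex_of_real (real n / 2 - real a) else 0)"

definition spin_comp :: "nat \<Rightarrow> nat \<Rightarrow> nat \<Rightarrow> nat \<Rightarrow> complex" where
  "spin_comp n i = (if i = 1 then spin1 n else if i = 2 then spin2 n else spin3 n)"

definition site_op :: "nat \<Rightarrow> 'd site set \<Rightarrow> 'd site \<Rightarrow> (nat \<Rightarrow> nat \<Rightarrow> complex) \<Rightarrow> 'd kernel" where
  "site_op n \<Lambda> x M \<sigma> \<tau> = M (\<sigma> x) (\<tau> x) * (if \<forall>z\<in>\<Lambda>. z \<noteq> x \<longrightarrow> \<sigma> z = \<tau> z then 1 else 0)"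

definition kmul :: "nat \<Rightarrow> 'd site set \<Rightarrow> 'd kernel \<Rightarrow> 'd kernel \<Rightarrow> 'd kernel" where
  "kmul n \<Lambda> A B \<sigma> \<tau> = (\<Sum>\<rho>\<in>conf n \<Lambda>. A \<sigma> \<rho> * B \<rho> \<tau>)"

definition kid :: "'d kernel" where
  "kid \<sigma> \<tau> = (if \<sigma> = \<tau> then 1 else 0)"

definition kpow :: "nat \<Rightarrow> 'd site set \<Rightarrow> 'd kernel \<Rightarrow> nat \<Rightarrow> 'd kernel" where
  "kpow n \<Lambda> A k = ((kmul n \<Lambda> A) ^^ k) kid"

definition kexp :: "nat \<Rightarrow> 'd site set \<Rightarrow> 'd kernel \<Rightarrow> 'd kernel" where
  "kexp n \<Lambda> A \<sigma> \<tau> = (\<Sum>k. kpow n \<Lambda> A k \<sigma> \<tau> / of_nat (fact k))"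

definition ktr :: "nat \<Rightarrow> 'd site set \<Rightarrow> 'd kernel \<Rightarrow> complex" where
  "ktr n \<Lambda> A = (\<Sum>\<sigma>\<in>conf n \<Lambda>. A \<sigma> \<sigma>)"

definition box :: "nat \<Rightarrow> ('d::finite) site set" where
  "box L = {x. \<forall>i. - int L + 1 \<le> x $ i \<and> x $ i \<le> int L}"

definition pnb :: "nat \<Rightarrow> ('d::finite) site \<Rightarrow> 'd site \<Rightarrow> bool" where
  "pnb L x y = (\<exists>i. (\<forall>j. j \<noteq> i \<longrightarrow> x $ j = y $ j) \<and>
      (x $ i - y $ i) mod (2 * int L) \<in> {1, 2 * int L - 1})"

definition stag :: "('d::finite) site \<Rightarrow> complex" where
  "stag x = (if even (\<Sum>i\<in>UNIV. x $ i) then 1 else -1)"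

definition stag_mag :: "nat \<Rightarrow> ('d::finite) site set \<Rightarrow> 'd kernel" where
  "stag_mag n \<Lambda> \<sigma> \<tau> = (\<Sum>x\<in>\<Lambda>. stag x * site_op n \<Lambda> x (spin3 n) \<sigma> \<tau>)"

text \<open>H_p^(Lambda_L)(B); the sum over unordered nearest-neighbour pairs is half the ordered sum.\<close>
definition ham :: "nat \<Rightarrow> nat \<Rightarrow> real \<Rightarrow> ('d::finite) kernel" where
  "ham n L B \<sigma> \<tau> =
     (1/2) * (\<Sum>x\<in>box L. \<Sum>y\<in>{y\<in>box L. pnb L x y}. \<Sum>i\<in>{1,2,3::nat}.
        kmul n (box L) (site_op n (box L) x (spin_comp n i)) (site_op n (box L) y (spin_comp n i)) \<sigma> \<tau>)
     - complex_of_real B * stag_mag n (box L) \<sigma> \<tau>"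

text \<open>A local observable is a pair (Gamma, A) with Gamma finite and A an operator on the
 tensor product over Gamma; ext embeds it as A \<otimes> 1 into the algebra over Lambda.\<close>
definition restr :: "'d cfg \<Rightarrow> 'd site set \<Rightarrow> 'd cfg" where
  "restr \<sigma> \<Gamma> = (\<lambda>z. if z \<in> \<Gamma> then \<sigma> z else 0)"

definition ext :: "'d site set \<Rightarrow> 'd site set \<Rightarrow> 'd kernel \<Rightarrow> 'd kernel" where
  "ext \<Gamma> \<Lambda> A \<sigma> \<tau> = A (restr \<sigma> \<Gamma>) (restr \<tau> \<Gamma>) * (if \<forall>z\<in>\<Lambda> - \<Gamma>. \<sigma> z = \<tau> z then 1 else 0)"

definition gibbs :: "nat \<Rightarrow> nat \<Rightarrow> real \<Rightarrow> real \<Rightarrow> ('d::finite) site set \<Rightarrow> 'd kernel \<Rightarrow> complex" where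
  "gibbs n L B \<beta> \<Gamma> A =
     (let \<Lambda> = box L; E = kexp n \<Lambda> (\<lambda>\<sigma> \<tau>. - complex_of_real \<beta> * ham n L B \<sigma> \<tau>)
      in ktr n \<Lambda> (kmul n \<Lambda> (ext \<Gamma> \<Lambda> A) E) / ktr n \<Lambda> E)"

definition S2S2 :: "nat \<Rightarrow> ('d::finite) site \<Rightarrow> 'd site \<Rightarrow> 'd kernel" where
  "S2S2 n x y = kmul n {x, y} (site_op n {x, y} x (spin2 n)) (site_op n {x, y} y (spin2 n))"

definition site_dist :: "('d::finite) site \<Rightarrow> 'd site \<Rightarrow> real" where
  "site_dist x y = norm ((\<chi> i. real_of_int (x $ i - y $ i)) :: real^'d)"

end

theory Submission
  imports Defs "HOL-Library.Function_Algebras"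
begin

text \<open>Bogoliubov's inequality is applied in finite volume to \<open>A = \<Sum>\<^bsub>x\<in>V\<^esub> S\<^sub>x\<^sup>2\<close> and
  \<open>C = \<Sum>\<^sub>x f(x) S\<^sub>x\<^sup>1\<close>, where \<open>V\<close> is the part of a cube of side \<open>2k\<close> lying in one class modulo 2
  and \<open>f\<close> is a Lipschitz cutoff equal to 1 on \<open>V\<close> and supported at scale \<open>k\<close>. The commutator
  \<open>[C, A]\<close> is \<open>i\<close> times the magnetization of \<open>V\<close>, of order \<open>k^d\<close> for a suitable class. By
  rotation invariance the double commutator \<open>[[C, H], C]\<close> only involves \<open>(f(x) - f(y))\<^sup>2\<close> on
  nearest-neighbour pairs, so its expectation is \<open>O(k^(d-2))\<close> plus a term that vanishes with the
  field \<open>B\<close>. If the transverse correlations were \<open>o(|x-y|^(2-d))\<close>, then \<open>\<langle>A\<^sup>2\<rangle> = o(k^(d+2))\<close>, and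
  the product of the two factors would be \<open>o(k^(2d))\<close>, a contradiction.\<close>

section \<open>Hermitian kernels on a finite index set\<close>

text \<open>The restriction of A to one class modulo 2 answers the staggering. The field leaves only
  translations by even vectors as symmetries, and the magnetization may alternate in sign, so that
  its sum over a full cube could cancel. On a single class every site carries the same
  magnetization, and a nonzero order parameter forces some class to carry a nonzero one.

  The field also dictates the order of limits. It is not rotation invariant and contributes
  \<open>f(x)^2\<close> instead of a difference, so its share can be of order
  \<open>|B| k^d\<close>, too large beside \<open>k^(d-2)\<close>. Therefore k stays fixed while
  first L tends to infinity and then B to 0; k grows last.

  The exponent d-2 is critical: \<open>|x-y|^(2-d)\<close> summed over pairs in V is of order
  \<open>k^(d+2)\<close>, and times \<open>k^(d-2)\<close> this is exactly \<open>k^(2d)\<close>,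
  the square of the magnetization of V. Decay of precisely this order is compatible with the
  inequality; only the little-o is refuted.\<close>

definition herm :: "'a set \<Rightarrow> ('a \<Rightarrow> 'a \<Rightarrow> complex) \<Rightarrow> bool" where
  "herm I A \<longleftrightarrow> (\<forall>i\<in>I. \<forall>j\<in>I. A j i = cnj (A i j))"

text \<open>The index set is an explicit argument because the configuration space varies with
  \<open>L\<close>. Kernels are total functions; traces and spectral statements look only at their
  values on \<open>I\<close>.\<close>

definition mm :: "'a set \<Rightarrow> ('a \<Rightarrow> 'a \<Rightarrow> complex) \<Rightarrow> ('a \<Rightarrow> 'a \<Rightarrow> complex) \<Rightarrow> 'a \<Rightarrow> 'a \<Rightarrow> complex" where
  "mm I A B = (\<lambda>i j. \<Sum>k\<in>I. A i k * B k j)"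

definition tr :: "'a set \<Rightarrow> ('a \<Rightarrow> 'a \<Rightarrow> complex) \<Rightarrow> complex" where
  "tr I A = (\<Sum>i\<in>I. A i i)"

definition inner_on :: "'a set \<Rightarrow> ('a \<Rightarrow> complex) \<Rightarrow> ('a \<Rightarrow> complex) \<Rightarrow> complex" where
  "inner_on I v w = (\<Sum>i\<in>I. cnj (v i) * w i)"

definition app_on :: "'a set \<Rightarrow> ('a \<Rightarrow> 'a \<Rightarrow> complex) \<Rightarrow> ('a \<Rightarrow> complex) \<Rightarrow> 'a \<Rightarrow> complex" where
  "app_on I A v = (\<lambda>i. \<Sum>j\<in>I. A i j * v j)"

lemma inner_on_cnj: "cnj (inner_on I v w) = inner_on I w v"
  by (simp add: inner_on_def mult.commute)

lemma inner_on_self: "inner_on I v v = of_real (\<Sum>i\<in>I. (cmod (v i))\<^sup>2)"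
  unfolding inner_on_def of_real_sum complex_norm_square by (simp add: mult.commute)

lemma Re_inner_on_self: "Re (inner_on I v v) = (\<Sum>i\<in>I. (cmod (v i))\<^sup>2)"
  by (simp only: inner_on_self Re_complex_of_real)

lemma inner_on_add_right: "inner_on I v (\<lambda>i. w i + z i) = inner_on I v w + inner_on I v z"
  by (simp add: inner_on_def algebra_simps sum.distrib)

lemma inner_on_scale_right: "inner_on I v (\<lambda>i. c * w i) = c * inner_on I v w"
  by (simp add: inner_on_def algebra_simps sum_distrib_left)

lemma inner_on_add_left: "inner_on I (\<lambda>i. w i + z i) v = inner_on I w v + inner_on I z v"
  by (simp add: inner_on_def algebra_simps sum.distrib)

lemma inner_on_scale_left: "inner_on I (\<lambda>i. c * w i) v = cnj c * inner_on I w v"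
  by (simp add: inner_on_def algebra_simps sum_distrib_left)

lemma app_on_add: "app_on I A (\<lambda>i. v i + w i) = (\<lambda>i. app_on I A v i + app_on I A w i)"
  by (simp add: app_on_def algebra_simps sum.distrib)

lemma app_on_scale: "app_on I A (\<lambda>i. c * v i) = (\<lambda>i. c * app_on I A v i)"
  by (simp add: app_on_def algebra_simps sum_distrib_left)

lemma inner_on_app_herm:
  assumes "herm I A"
  shows "inner_on I v (app_on I A w) = inner_on I (app_on I A v) w"
proof -
  have "inner_on I v (app_on I A w) = (\<Sum>i\<in>I. \<Sum>j\<in>I. cnj (v i) * A i j * w j)"
    by (simp add: inner_on_def app_on_def sum_distrib_left mult.assoc)
  also have "\<dots> = (\<Sum>j\<in>I. \<Sum>i\<in>I. cnj (v i) * A i j * w j)"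
    by (rule sum.swap)
  also have "\<dots> = (\<Sum>j\<in>I. \<Sum>i\<in>I. cnj (A j i) * cnj (v i) * w j)"
    by (intro sum.cong refl) (metis assms herm_def mult.commute)
  also have "\<dots> = inner_on I (app_on I A v) w"
    by (simp add: inner_on_def app_on_def sum_distrib_right)
  finally show ?thesis .
qed

text \<open>The Rayleigh quotient is maximized over unit vectors orthogonal to the eigenvectors
  already found. That complement is invariant under \<open>H\<close>, and maximality tested along
  the residual forces the residual to vanish. The vector \<open>r\<close> witnesses that the
  complement is nonzero.\<close>

lemma rayleigh_eigenvector:
  fixes u :: "nat \<Rightarrow> 'a \<Rightarrow> complex"
  assumes fin: "finite I" and H: "herm I H"
    and eig: "\<And>k i. k < m \<Longrightarrow> i \<in> I \<Longrightarrow> app_on I H (u k) i = of_real (e k) * u k i"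
    and r_perp: "\<And>k. k < m \<Longrightarrow> inner_on I (u k) r = 0"
    and r_nz: "\<exists>i\<in>I. r i \<noteq> 0"
  shows "\<exists>v l. inner_on I v v = 1 \<and> (\<forall>k<m. inner_on I (u k) v = 0) \<and>
           (\<forall>i\<in>I. app_on I H v i = of_real l * v i)"
proof -
  \<comment> \<open>Vectors are functions on a possibly infinite type. Fixing the value 0 off
    \<open>I\<close> makes this a product of compact sets, hence compact by Tychonoff.\<close>
  define K where "K = {v :: 'a \<Rightarrow> complex. (\<forall>i. v i \<in> (if i \<in> I then cball 0 1 else {0}))}"
  define V where "V = {v. \<forall>k<m. inner_on I (u k) v = 0}"
  define S where "S = K \<inter> {v. inner_on I v v = 1} \<inter> V"
  have K_eq: "K = PiE UNIV (\<lambda>i. if i \<in> I then cball 0 1 else {0})"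
    by (auto simp: K_def PiE_def Pi_def)
  have "compactin (product_topology (\<lambda>i. euclidean) UNIV) K"
    unfolding K_eq by (subst compactin_PiE) auto
  hence K: "compact K"
    by (simp add: euclidean_product_topology)
  have coord: "continuous_on UNIV (\<lambda>v :: 'a \<Rightarrow> complex. v i)" for i
    by (simp add: continuous_on_product_coordinates)
  have cont1: "continuous_on UNIV (\<lambda>v. inner_on I v v)"
    unfolding inner_on_def by (intro continuous_intros coord)
  have cont2: "continuous_on UNIV (\<lambda>v. inner_on I (u k) v)" for k
    unfolding inner_on_def by (intro continuous_intros coord)
  define q where "q v = Re (inner_on I v (app_on I H v))" for v
  have cont3: "continuous_on S q"
    unfolding q_def inner_on_def app_on_def
    by (intro continuous_intros continuous_on_subset[OF coord]) auto
  have "closed {v. inner_on I v v = 1}"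
    by (rule closed_Collect_eq[OF cont1]) simp
  moreover have "closed V"
  proof -
    have "V = (\<Inter>k<m. {v. inner_on I (u k) v = 0})" by (auto simp: V_def)
    also have "closed \<dots>" by (intro closed_INT ballI closed_Collect_eq[OF cont2]) simp
    finally show ?thesis .
  qed
  ultimately have S: "compact S"
    unfolding S_def by (intro compact_Int_closed K)
  \<comment> \<open>Truncation to \<open>I\<close> is what puts the rescaled vector into
    \<open>K\<close>; inner products over \<open>I\<close> do not notice it.\<close>
  have normalize: "\<exists>c>0. (\<lambda>i. of_real c * (if i \<in> I then v i else 0)) \<in> S \<and> c\<^sup>2 * Re (inner_on I v v) = 1"
    if v: "v \<in> V" and nz: "\<exists>i\<in>I. v i \<noteq> 0" for v
  proof -
    define t where "t = (\<Sum>i\<in>I. (cmod (v i))\<^sup>2)"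
    have t: "t > 0"
      unfolding t_def using nz fin by (auto intro!: sum_pos2)
    define c where "c = 1 / sqrt t"
    have c: "c > 0" "c\<^sup>2 * t = 1" using t by (auto simp: c_def power_divide)
    let ?w = "\<lambda>i. of_real c * (if i \<in> I then v i else 0)"
    have n1: "inner_on I ?w ?w = 1"
    proof -
      have "inner_on I ?w ?w = of_real (c\<^sup>2) * inner_on I v v"
        unfolding inner_on_def sum_distrib_left
        by (intro sum.cong refl) (simp add: power2_eq_square)
      also have "\<dots> = of_real (c\<^sup>2 * t)" by (simp add: inner_on_self t_def)
      finally show ?thesis using c by simp
    qed
    have "cmod (?w i) \<le> 1" if "i \<in> I" for i
    proof -
      have "(cmod (?w i))\<^sup>2 \<le> (\<Sum>i\<in>I. (cmod (?w i))\<^sup>2)"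
        by (rule member_le_sum) (use that fin in auto)
      also have "\<dots> = 1" using n1 unfolding inner_on_self
        by (metis of_real_eq_1_iff)
      finally show ?thesis by (metis abs_norm_cancel power2_le_imp_le one_power2 zero_le_one)
    qed
    moreover have "?w \<in> V"
    proof -
      have "inner_on I (u k) ?w = of_real c * inner_on I (u k) v" for k
        unfolding inner_on_def sum_distrib_left by (intro sum.cong) auto
      thus ?thesis using v by (simp add: V_def)
    qed
    ultimately have "?w \<in> S" using n1 by (auto simp: S_def K_def)
    moreover have "Re (inner_on I v v) = t" by (simp add: inner_on_self t_def)
    ultimately show ?thesis using c by auto
  qed
  have "r \<in> V" using r_perp by (simp add: V_def)
  with normalize r_nz have "S \<noteq> {}" by blast
  from continuous_attains_sup[OF S this cont3] obtain v where
    vS: "v \<in> S" and vmax: "\<And>w. w \<in> S \<Longrightarrow> q w \<le> q v" by auto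
  have vV: "v \<in> V" and v1: "inner_on I v v = 1" using vS by (auto simp: S_def)
  define l where "l = q v"
  \<comment> \<open>The quadratic form of \<open>l - H\<close>: nonnegative on \<open>V\<close>
    because \<open>l\<close> is the maximum, and zero at \<open>v\<close>.\<close>
  define b where "b w = l * Re (inner_on I w w) - q w" for w
  have b_nonneg: "b w \<ge> 0" if w: "w \<in> V" for w
  proof (cases "\<exists>i\<in>I. w i \<noteq> 0")
    case False
    thus ?thesis by (simp add: b_def q_def inner_on_def)
  next
    case True
    from normalize[OF w this] obtain c where c: "c > 0"
      "(\<lambda>i. of_real c * (if i \<in> I then w i else 0)) \<in> S" "c\<^sup>2 * Re (inner_on I w w) = 1" by blast
    have "q (\<lambda>i. of_real c * (if i \<in> I then w i else 0)) = c\<^sup>2 * q w"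
    proof -
      have "inner_on I (\<lambda>i. of_real c * (if i \<in> I then w i else 0))
              (app_on I H (\<lambda>i. of_real c * (if i \<in> I then w i else 0)))
            = of_real (c\<^sup>2) * inner_on I w (app_on I H w)"
        unfolding inner_on_def app_on_def sum_distrib_left
        by (intro sum.cong refl) (simp add: power2_eq_square mult_ac)
      thus ?thesis by (simp add: q_def flip: of_real_power)
    qed
    with vmax[OF c(2)] have "c\<^sup>2 * q w \<le> l" by (simp add: l_def)
    also have "l = c\<^sup>2 * (l * Re (inner_on I w w))" using c(3) by (simp add: algebra_simps)
    finally show ?thesis using c(1) by (simp add: b_def)
  qed
  \<comment> \<open>The residual \<open>(l - H) v\<close>, the direction in which maximality of
    \<open>v\<close> is tested.\<close>
  define w where "w = (\<lambda>i. of_real l * v i + (- 1) * app_on I H v i)"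
  have wV: "w \<in> V"
  proof -
    have "inner_on I (u k) w = 0" if k: "k < m" for k
    proof -
      have "inner_on I (u k) (app_on I H v) = inner_on I (app_on I H (u k)) v"
        by (rule inner_on_app_herm[OF H])
      also have "\<dots> = inner_on I (\<lambda>i. of_real (e k) * u k i) v"
        unfolding inner_on_def using eig[OF k] by (intro sum.cong) auto
      also have "\<dots> = 0" using vV k by (simp add: inner_on_scale_left V_def)
      finally show ?thesis
        using vV k unfolding w_def inner_on_add_right inner_on_scale_right V_def by simp
    qed
    thus ?thesis by (simp add: V_def)
  qed
  \<comment> \<open>As \<open>b v = 0\<close>, the expansion starts with the linear term, which
    would make \<open>b\<close> negative for small negative \<open>t\<close> unless \<open>w\<close>
    vanishes on \<open>I\<close>.\<close>
  have b_expand: "b (\<lambda>i. v i + of_real t * w i) = 2 * t * Re (inner_on I w w) + t\<^sup>2 * b w" for t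
  proof -
    have vw: "inner_on I w v = cnj (inner_on I v w)" by (simp add: inner_on_cnj)
    have Hw: "inner_on I w (app_on I H v) = cnj (inner_on I v (app_on I H w))"
      by (simp add: inner_on_cnj inner_on_app_herm[OF H])
    have n: "inner_on I w w = of_real l * inner_on I w v - inner_on I w (app_on I H v)"
    proof -
      have "inner_on I w (\<lambda>i. of_real l * v i + (- 1) * app_on I H v i)
          = of_real l * inner_on I w v - inner_on I w (app_on I H v)"
        by (simp only: inner_on_add_right inner_on_scale_right) simp
      thus ?thesis by (simp only: w_def[symmetric])
    qed
    have a1: "q (\<lambda>i. v i + of_real t * w i) = q v + 2 * t * Re (inner_on I w (app_on I H v)) + t\<^sup>2 * q w"
      unfolding q_def app_on_add app_on_scale inner_on_add_right inner_on_add_left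
        inner_on_scale_right inner_on_scale_left
      by (simp add: Hw power2_eq_square algebra_simps)
    have a2: "Re (inner_on I (\<lambda>i. v i + of_real t * w i) (\<lambda>i. v i + of_real t * w i))
        = 1 + 2 * t * Re (inner_on I w v) + t\<^sup>2 * Re (inner_on I w w)"
      unfolding inner_on_add_right inner_on_add_left inner_on_scale_right inner_on_scale_left
      by (simp add: vw v1 power2_eq_square algebra_simps)
    have a3: "Re (inner_on I w w) = l * Re (inner_on I w v) - Re (inner_on I w (app_on I H v))"
      using n by simp
    show ?thesis unfolding b_def a1 a2 a3 by (simp add: l_def algebra_simps)
  qed
  have in_V: "(\<lambda>i. v i + of_real t * w i) \<in> V" for t
    using vV wV by (simp add: V_def inner_on_add_right inner_on_scale_right)
  have pos: "2 * t * Re (inner_on I w w) + t\<^sup>2 * b w \<ge> 0" for t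
    using b_nonneg[OF in_V[of t]] by (simp add: b_expand)
  have "Re (inner_on I w w) = 0"
  proof (rule ccontr)
    assume "Re (inner_on I w w) \<noteq> 0"
    hence a: "Re (inner_on I w w) > 0" (is "?a > 0")
      by (simp add: Re_inner_on_self less_le sum_nonneg)
    have bw: "b w \<ge> 0" by (rule b_nonneg[OF wV])
    \<comment> \<open>The summand 1 keeps the denominator positive, and \<open>|t| * b w\<close>
      stays at most \<open>?a\<close>, below the \<open>2 * ?a\<close> of the linear term.\<close>
    define t where "t = - ?a / (b w + 1)"
    have "t < 0" using a bw by (simp add: t_def)
    moreover have "2 * ?a + t * b w > 0"
    proof -
      have "- t * b w = ?a * (b w / (b w + 1))" by (simp add: t_def)
      also have "\<dots> \<le> ?a * 1" using a bw by (intro mult_left_mono) auto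
      finally show ?thesis using a by simp
    qed
    ultimately have "t * (2 * ?a + t * b w) < 0" by (simp add: mult_neg_pos)
    with pos[of t] show False by (simp add: power2_eq_square algebra_simps)
  qed
  hence "(\<Sum>i\<in>I. (cmod (w i))\<^sup>2) = 0" by (simp add: Re_inner_on_self)
  hence "\<forall>i\<in>I. w i = 0" using fin by (simp add: sum_nonneg_eq_0_iff)
  hence "\<forall>i\<in>I. app_on I H v i = of_real l * v i" by (simp add: w_def)
  thus ?thesis using v1 vV unfolding V_def by blast
qed


section \<open>Orthonormal systems and the spectral theorem\<close>

definition orthonormal_on :: "'a set \<Rightarrow> nat \<Rightarrow> (nat \<Rightarrow> 'a \<Rightarrow> complex) \<Rightarrow> bool" where
  "orthonormal_on I N u \<longleftrightarrow> (\<forall>k<N. \<forall>l<N. inner_on I (u k) (u l) = (if k = l then 1 else 0))"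

text \<open>The vector is the coordinate vector at \<open>j\<close> minus its projection onto the
  span of the \<open>u l\<close>. It serves twice: as the remainder in Bessel's inequality, and as
  the witness that an incomplete system can be enlarged.\<close>

lemma projection_remainder_orthogonal:
  assumes on: "orthonormal_on I N u" and fin: "finite I" and j: "j \<in> I" and k: "k < N"
  shows "inner_on I (u k) (\<lambda>i. (if i = j then 1 else 0) - (\<Sum>l<N. u l i * cnj (u l j))) = 0"
proof -
  have "inner_on I (u k) (\<lambda>i. (if i = j then 1 else 0) - (\<Sum>l<N. u l i * cnj (u l j)))
      = (\<Sum>i\<in>I. cnj (u k i) * (if i = j then 1 else 0)) - (\<Sum>i\<in>I. \<Sum>l<N. cnj (u k i) * u l i * cnj (u l j))"
    by (simp add: inner_on_def algebra_simps sum_subtractf sum_distrib_left)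
  also have "(\<Sum>i\<in>I. \<Sum>l<N. cnj (u k i) * u l i * cnj (u l j)) = (\<Sum>l<N. inner_on I (u k) (u l) * cnj (u l j))"
    by (subst sum.swap) (simp add: inner_on_def sum_distrib_right)
  also have "\<dots> = (\<Sum>l<N. if k = l then cnj (u l j) else 0)"
    using on k by (intro sum.cong) (auto simp: orthonormal_on_def)
  also have "\<dots> = cnj (u k j)" using k by simp
  also have "(\<Sum>i\<in>I. cnj (u k i) * (if i = j then 1 else 0)) = cnj (u k j)"
    using fin j by (simp add: if_distrib[of "\<lambda>x. _ * x"] cong: if_cong)
  finally show ?thesis by simp
qed

text \<open>Bessel's inequality for every coordinate vector, summed over the coordinates. The bound
  stops the enlargement of eigenvector systems.\<close>

lemma orthonormal_on_le_card:
  assumes on: "orthonormal_on I N u" and fin: "finite I"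
  shows "N \<le> card I"
proof -
  have bessel: "(\<Sum>l<N. (cmod (u l j))\<^sup>2) \<le> 1" if j: "j \<in> I" for j
  proof -
    define r where "r = (\<lambda>i. (if i = j then 1 else 0) - (\<Sum>l<N. u l i * cnj (u l j)))"
    have "inner_on I r r = (\<Sum>i\<in>I. cnj (if i = j then 1 else 0) * r i) - (\<Sum>i\<in>I. \<Sum>l<N. u l j * (cnj (u l i) * r i))"
      by (subst (1) r_def) (simp add: inner_on_def algebra_simps sum_subtractf sum_distrib_left)
    also have "(\<Sum>i\<in>I. cnj (if i = j then 1 else 0) * r i) = r j"
    proof -
      have "(\<Sum>i\<in>I. cnj (if i = j then 1 else 0) * r i) = (\<Sum>i\<in>I. if i = j then r i else 0)"
        by (intro sum.cong) auto
      thus ?thesis using fin j by simp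
    qed
    also have "(\<Sum>i\<in>I. \<Sum>l<N. u l j * (cnj (u l i) * r i)) = (\<Sum>l<N. u l j * inner_on I (u l) r)"
      by (subst sum.swap) (simp add: inner_on_def sum_distrib_left)
    also have "\<dots> = 0"
      using projection_remainder_orthogonal[OF on fin j] by (simp add: r_def)
    finally have "r j = inner_on I r r" by simp
    hence "Re (r j) \<ge> 0" by (metis Re_inner_on_self sum_nonneg zero_le_power2)
    moreover have "r j = of_real (1 - (\<Sum>l<N. (cmod (u l j))\<^sup>2))"
      unfolding of_real_diff of_real_sum complex_norm_square by (simp add: r_def)
    ultimately show ?thesis by (metis Re_complex_of_real diff_ge_0_iff_ge)
  qed
  have "real N = (\<Sum>l<N. Re (inner_on I (u l) (u l)))"
    using on by (simp add: orthonormal_on_def)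
  also have "\<dots> = (\<Sum>l<N. \<Sum>j\<in>I. (cmod (u l j))\<^sup>2)"
    by (simp add: Re_inner_on_self)
  also have "\<dots> = (\<Sum>j\<in>I. \<Sum>l<N. (cmod (u l j))\<^sup>2)" by (rule sum.swap)
  also have "\<dots> \<le> (\<Sum>j\<in>I. 1)" by (intro sum_mono bessel)
  finally show ?thesis by simp
qed

text \<open>Completeness is stated as a resolution of the identity, the form in which intermediate
  states are inserted. No operator occurs: eigenvalue equations are supplied where a particular
  operator is diagonalized.\<close>

locale eigenbasis =
  fixes I :: "'a set" and N :: nat and u :: "nat \<Rightarrow> 'a \<Rightarrow> complex"
  assumes fin: "finite I" and on: "orthonormal_on I N u"
    and complete: "i \<in> I \<Longrightarrow> j \<in> I \<Longrightarrow> (\<Sum>k<N. u k i * cnj (u k j)) = (if i = j then 1 else 0)"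

text \<open>As long as the resolution of the identity fails at some pair, the remainder of a
  coordinate vector is nonzero and orthogonal to the system, so another eigenvector exists. The
  dimension bound forbids this beyond \<open>card I\<close> steps.\<close>

theorem hermitian_eigenbasis:
  assumes fin: "finite I" and H: "herm I H"
  obtains N u e where "eigenbasis I N u"
    "\<And>k i. k < N \<Longrightarrow> i \<in> I \<Longrightarrow> app_on I H (u k) i = of_real (e k :: real) * u k i"
proof -
  define sys where "sys m u e \<longleftrightarrow> orthonormal_on I m u \<and>
      (\<forall>k<m. \<forall>i\<in>I. app_on I H (u k) i = of_real (e k :: real) * u k i)" for m u e
  have step: "\<exists>u' e'. sys (Suc m) u' e'"
    if s: "sys m u e" and ij: "i0 \<in> I" "j \<in> I" "(\<Sum>k<m. u k i0 * cnj (u k j)) \<noteq> (if i0 = j then 1 else 0)"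
    for m u e i0 j
  proof -
    define r where "r = (\<lambda>i. (if i = j then 1 else 0) - (\<Sum>l<m. u l i * cnj (u l j)))"
    have "\<And>k. k < m \<Longrightarrow> inner_on I (u k) r = 0"
      unfolding r_def using s by (intro projection_remainder_orthogonal fin ij) (auto simp: sys_def)
    moreover have "\<exists>i\<in>I. r i \<noteq> 0" using ij by (intro bexI[of _ i0]) (auto simp: r_def)
    ultimately obtain v l where v: "inner_on I v v = 1" "\<And>k. k < m \<Longrightarrow> inner_on I (u k) v = 0"
      "\<And>i. i \<in> I \<Longrightarrow> app_on I H v i = of_real l * v i"
      using rayleigh_eigenvector[OF fin H, of m u e r] s unfolding sys_def by blast
    have v': "\<And>k. k < m \<Longrightarrow> inner_on I v (u k) = 0"
      using v(2) by (metis inner_on_cnj complex_cnj_zero)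
    have "sys (Suc m) (u(m := v)) (e(m := l))"
      using s v v' by (auto simp: sys_def orthonormal_on_def less_Suc_eq)
    thus ?thesis by blast
  qed
  have "\<exists>m u e. sys m u e \<and> (\<forall>i\<in>I. \<forall>j\<in>I. (\<Sum>k<m. u k i * cnj (u k j)) = (if i = j then 1 else 0))"
  proof (rule ccontr)
    assume none: "\<not> ?thesis"
    have "\<exists>u e. sys m u e" for m
    proof (induction m)
      case 0
      show ?case by (simp add: sys_def orthonormal_on_def)
    next
      case (Suc m)
      then obtain u e where "sys m u e" by blast
      with none obtain i j where "i \<in> I" "j \<in> I" "(\<Sum>k<m. u k i * cnj (u k j)) \<noteq> (if i = j then 1 else 0)"
        by blast
      with step \<open>sys m u e\<close> show ?case by blast
    qed
    then obtain u e where "sys (Suc (card I)) u e" by blast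
    hence "Suc (card I) \<le> card I" by (intro orthonormal_on_le_card fin) (auto simp: sys_def)
    thus False by simp
  qed
  then obtain m u e where "sys m u e" "\<forall>i\<in>I. \<forall>j\<in>I. (\<Sum>k<m. u k i * cnj (u k j)) = (if i = j then 1 else 0)"
    by blast
  thus thesis using that[of m u e] fin by (auto simp: sys_def eigenbasis_def)
qed

section \<open>Matrix elements and functions of an operator in an orthonormal basis\<close>

context eigenbasis
begin

definition coef :: "('a \<Rightarrow> 'a \<Rightarrow> complex) \<Rightarrow> nat \<Rightarrow> nat \<Rightarrow> complex" where
  "coef X k l = inner_on I (u k) (app_on I X (u l))"

text \<open>The operator with eigenvalue \<open>w m\<close> on \<open>u m\<close>. If the
  \<open>u m\<close> diagonalize \<open>H\<close> with eigenvalues \<open>e m\<close>, then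
  \<open>w = g o e\<close> gives \<open>g(H)\<close>, in particular the Boltzmann factor.\<close>

definition spec :: "(nat \<Rightarrow> complex) \<Rightarrow> 'a \<Rightarrow> 'a \<Rightarrow> complex" where
  "spec w i j = (\<Sum>m<N. w m * u m i * cnj (u m j))"

lemma parseval: "inner_on I v w = (\<Sum>m<N. inner_on I v (u m) * inner_on I (u m) w)"
proof -
  have "(\<Sum>m<N. inner_on I v (u m) * inner_on I (u m) w)
      = (\<Sum>m<N. \<Sum>i\<in>I. \<Sum>j\<in>I. cnj (v i) * w j * (u m i * cnj (u m j)))"
    unfolding inner_on_def sum_product by (intro sum.cong refl) (simp add: mult_ac)
  also have "\<dots> = (\<Sum>i\<in>I. \<Sum>m<N. \<Sum>j\<in>I. cnj (v i) * w j * (u m i * cnj (u m j)))"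
    by (rule sum.swap)
  also have "\<dots> = (\<Sum>i\<in>I. \<Sum>j\<in>I. \<Sum>m<N. cnj (v i) * w j * (u m i * cnj (u m j)))"
    by (intro sum.cong refl, rule sum.swap)
  also have "\<dots> = (\<Sum>i\<in>I. \<Sum>j\<in>I. cnj (v i) * w j * (if i = j then 1 else 0))"
    by (intro sum.cong refl) (simp add: complete flip: sum_distrib_left)
  also have "\<dots> = (\<Sum>i\<in>I. \<Sum>j\<in>I. if i = j then cnj (v i) * w j else 0)"
    by (intro sum.cong refl) auto
  also have "\<dots> = inner_on I v w" using fin by (simp add: inner_on_def)
  finally show ?thesis ..
qed

lemma app_on_mm: "app_on I (mm I X Y) v = app_on I X (app_on I Y v)"
proof
  fix i
  have "app_on I (mm I X Y) v i = (\<Sum>j\<in>I. \<Sum>k\<in>I. X i k * Y k j * v j)"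
    by (simp add: app_on_def mm_def sum_distrib_right)
  also have "\<dots> = (\<Sum>k\<in>I. \<Sum>j\<in>I. X i k * Y k j * v j)" by (rule sum.swap)
  finally show "app_on I (mm I X Y) v i = app_on I X (app_on I Y v) i"
    by (simp add: app_on_def sum_distrib_left mult.assoc)
qed

lemma inner_on_adjoint:
  "inner_on I v (app_on I X w) = inner_on I (app_on I (\<lambda>i j. cnj (X j i)) v) w"
proof -
  have "inner_on I v (app_on I X w) = (\<Sum>i\<in>I. \<Sum>j\<in>I. cnj (v i) * X i j * w j)"
    by (simp add: inner_on_def app_on_def sum_distrib_left mult.assoc)
  also have "\<dots> = (\<Sum>j\<in>I. \<Sum>i\<in>I. cnj (v i) * X i j * w j)"
    by (rule sum.swap)
  also have "\<dots> = inner_on I (app_on I (\<lambda>i j. cnj (X j i)) v) w"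
    unfolding inner_on_def app_on_def cnj_sum sum_distrib_right
    by (intro sum.cong refl) (simp add: mult_ac)
  finally show ?thesis .
qed

lemma coef_mm: "coef (mm I X Y) k l = (\<Sum>m<N. coef X k m * coef Y m l)"
proof -
  have "coef (mm I X Y) k l = inner_on I (app_on I (\<lambda>i j. cnj (X j i)) (u k)) (app_on I Y (u l))"
    by (simp add: coef_def app_on_mm inner_on_adjoint)
  also have "\<dots> = (\<Sum>m<N. inner_on I (u k) (app_on I X (u m)) * inner_on I (u m) (app_on I Y (u l)))"
    by (subst parseval) (simp flip: inner_on_adjoint)
  finally show ?thesis by (simp add: coef_def)
qed

text \<open>Basis independence of the trace: summing over \<open>k\<close> first, completeness
  leaves the diagonal.\<close>

lemma tr_coef: "tr I X = (\<Sum>k<N. coef X k k)"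
proof -
  have "(\<Sum>k<N. coef X k k) = (\<Sum>k<N. \<Sum>i\<in>I. \<Sum>j\<in>I. X i j * (u k j * cnj (u k i)))"
    by (simp add: coef_def inner_on_def app_on_def sum_distrib_left algebra_simps)
  also have "\<dots> = (\<Sum>i\<in>I. \<Sum>k<N. \<Sum>j\<in>I. X i j * (u k j * cnj (u k i)))"
    by (rule sum.swap)
  also have "\<dots> = (\<Sum>i\<in>I. \<Sum>j\<in>I. \<Sum>k<N. X i j * (u k j * cnj (u k i)))"
    by (intro sum.cong refl, rule sum.swap)
  also have "\<dots> = (\<Sum>i\<in>I. \<Sum>j\<in>I. X i j * (if j = i then 1 else 0))"
    by (intro sum.cong refl) (simp add: complete flip: sum_distrib_left)
  also have "\<dots> = (\<Sum>i\<in>I. \<Sum>j\<in>I. if i = j then X i j else 0)"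
    by (intro sum.cong refl) auto
  also have "\<dots> = tr I X" using fin by (simp add: tr_def)
  finally show ?thesis ..
qed

lemma coef_herm: "herm I X \<Longrightarrow> coef X l k = cnj (coef X k l)"
  by (simp add: coef_def inner_on_app_herm inner_on_cnj)

lemma app_on_spec:
  assumes "l < N"
  shows "app_on I (spec w) (u l) = (\<lambda>i. w l * u l i)"
proof
  fix i
  have "app_on I (spec w) (u l) i = (\<Sum>j\<in>I. \<Sum>m<N. w m * u m i * (cnj (u m j) * u l j))"
    unfolding app_on_def spec_def sum_distrib_right
    by (intro sum.cong refl) (simp add: mult_ac)
  also have "\<dots> = (\<Sum>m<N. \<Sum>j\<in>I. w m * u m i * (cnj (u m j) * u l j))" by (rule sum.swap)
  also have "\<dots> = (\<Sum>m<N. w m * u m i * inner_on I (u m) (u l))"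
    by (simp add: inner_on_def sum_distrib_left)
  also have "\<dots> = (\<Sum>m<N. if m = l then w m * u m i else 0)"
    using on assms by (intro sum.cong) (auto simp: orthonormal_on_def)
  finally show "app_on I (spec w) (u l) i = w l * u l i" using assms by simp
qed

lemma coef_spec:
  assumes "k < N" "l < N"
  shows "coef (spec w) k l = (if k = l then w l else 0)"
  using on assms by (simp add: coef_def app_on_spec inner_on_scale_right orthonormal_on_def)

lemma tr_mm_spec: "tr I (mm I X (spec w)) = (\<Sum>k<N. w k * coef X k k)"
proof -
  have "tr I (mm I X (spec w)) = (\<Sum>k<N. \<Sum>m<N. coef X k m * (if m = k then w k else 0))"
    unfolding tr_coef coef_mm by (intro sum.cong refl) (simp add: coef_spec)
  also have "\<dots> = (\<Sum>k<N. \<Sum>m<N. if m = k then w k * coef X k m else 0)"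
    by (intro sum.cong refl) auto
  finally show ?thesis by simp
qed

lemma coef_cong: "(\<And>i j. i \<in> I \<Longrightarrow> j \<in> I \<Longrightarrow> X i j = Y i j) \<Longrightarrow> coef X k l = coef Y k l"
  by (simp add: coef_def inner_on_def app_on_def cong: sum.cong)

lemma coef_diff: "coef (X - Y) k l = coef X k l - coef Y k l"
  by (simp add: coef_def inner_on_def app_on_def algebra_simps sum_subtractf)

lemma coef_uminus: "coef (- X) k l = - coef X k l"
  by (simp add: coef_def inner_on_def app_on_def algebra_simps sum_negf)

lemma spec_eigen:
  assumes eig: "\<And>k i. k < N \<Longrightarrow> i \<in> I \<Longrightarrow> app_on I H (u k) i = e k * u k i" and ij: "i \<in> I" "j \<in> I"
  shows "H i j = spec e i j"
proof -
  have "spec e i j = (\<Sum>m<N. app_on I H (u m) i * cnj (u m j))"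
    using eig ij by (simp add: spec_def)
  also have "\<dots> = (\<Sum>m<N. \<Sum>l\<in>I. H i l * (u m l * cnj (u m j)))"
    unfolding app_on_def sum_distrib_right
    by (intro sum.cong refl) (simp add: mult_ac)
  also have "\<dots> = (\<Sum>l\<in>I. \<Sum>m<N. H i l * (u m l * cnj (u m j)))" by (rule sum.swap)
  also have "\<dots> = (\<Sum>l\<in>I. H i l * (if l = j then 1 else 0))"
    by (intro sum.cong refl) (simp add: complete ij flip: sum_distrib_left)
  also have "\<dots> = (\<Sum>l\<in>I. if l = j then H i l else 0)"
    by (intro sum.cong refl) auto
  finally show ?thesis using fin ij by simp
qed

end

section \<open>Bogoliubov's inequality\<close>

definition comm :: "'a set \<Rightarrow> ('a \<Rightarrow> 'a \<Rightarrow> complex) \<Rightarrow> ('a \<Rightarrow> 'a \<Rightarrow> complex) \<Rightarrow> 'a \<Rightarrow> 'a \<Rightarrow> complex" where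
  "comm I A B = mm I A B - mm I B A"

text \<open>With \<open>t = |x - y|\<close>, division by \<open>exp (- x) + exp (- y)\<close> turns
  this into \<open>tanh (t/2) \<le> t/2\<close>. The proof uses monotonicity in \<open>t\<close>;
  the sign of the derivative is \<open>1 + s \<le> exp s\<close>.\<close>

lemma exp_diff_le:
  fixes x y :: real
  shows "\<bar>exp (- x) - exp (- y)\<bar> \<le> (exp (- x) + exp (- y)) / 2 * \<bar>x - y\<bar>"
proof -
  have pos: "1 - exp (- t) \<le> (1 + exp (- t)) / 2 * t" if "t \<ge> 0" for t :: real
  proof -
    let ?f = "\<lambda>t::real. (1 + exp (- t)) / 2 * t - 1 + exp (- t)"
    have "?f 0 \<le> ?f t"
    proof (rule DERIV_nonneg_imp_nondecreasing[OF that])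
      fix s :: real assume "0 \<le> s" "s \<le> t"
      have "(?f has_real_derivative (1 - (1 + s) * exp (- s)) / 2) (at s)"
        by (auto intro!: derivative_eq_intros simp: field_simps)
      moreover have "(1 + s) * exp (- s) \<le> exp s * exp (- s)"
        by (intro mult_right_mono) auto
      hence "(1 - (1 + s) * exp (- s)) / 2 \<ge> 0" by (simp flip: exp_add)
      ultimately show "\<exists>y. (?f has_real_derivative y) (at s) \<and> 0 \<le> y" by blast
    qed
    thus ?thesis by simp
  qed
  have main: "\<bar>exp (- x) - exp (- y)\<bar> \<le> (exp (- x) + exp (- y)) / 2 * \<bar>x - y\<bar>" if "x \<le> y" for x y :: real
  proof -
    have "exp (- x) * (1 - exp (- (y - x))) \<le> exp (- x) * ((1 + exp (- (y - x))) / 2 * (y - x))"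
      using pos[of "y - x"] that by (intro mult_left_mono) auto
    moreover have "exp (- x) * exp (- (y - x)) = exp (- y)" by (simp flip: exp_add)
    ultimately have "exp (- x) - exp (- y) \<le> (exp (- x) + exp (- y)) / 2 * (y - x)"
      by (simp add: algebra_simps)
    moreover have "exp (- y) \<le> exp (- x)" using that by simp
    ultimately show ?thesis using that by simp
  qed
  show ?thesis
  proof (cases "x \<le> y")
    case True
    thus ?thesis by (rule main)
  next
    case False
    hence "\<bar>exp (- y) - exp (- x)\<bar> \<le> (exp (- y) + exp (- x)) / 2 * \<bar>y - x\<bar>" by (intro main) simp
    thus ?thesis by (simp add: abs_minus_commute add.commute)
  qed
qed


context eigenbasis
begin

definition boltz :: "real \<Rightarrow> (nat \<Rightarrow> real) \<Rightarrow> 'a \<Rightarrow> 'a \<Rightarrow> complex" where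
  "boltz \<beta> e = spec (\<lambda>k. of_real (exp (- (\<beta> * e k))))"

lemma tr_square_spec:
  assumes "herm I A"
  shows "tr I (mm I (mm I A A) (spec (\<lambda>k. of_real (w k)))) = of_real (\<Sum>k<N. \<Sum>m<N. w k * (cmod (coef A k m))\<^sup>2)"
  unfolding tr_mm_spec coef_mm sum_distrib_left of_real_sum of_real_mult
proof (intro sum.cong refl arg_cong[where f = "\<lambda>x. _ * x"])
  fix k m
  show "coef A k m * coef A m k = of_real ((cmod (coef A k m))\<^sup>2)"
    unfolding coef_herm[OF assms, of m k] by (simp only: complex_norm_square)
qed

lemma cmod_coef_sym: "herm I A \<Longrightarrow> cmod (coef A k m) = cmod (coef A m k)"
  by (metis coef_herm complex_mod_cnj)

text \<open>\<open>2ab \<le> a^2 + b^2\<close> on each pair of matrix elements. This arithmetic-mean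
  form of Cauchy-Schwarz suffices because both squares are later bounded by the same Casimir
  constant.\<close>

lemma tr_mm_norm_le:
  assumes A: "herm I A" and B: "herm I B" and w: "\<And>k. w k \<ge> 0"
  shows "cmod (tr I (mm I (mm I A B) (spec (\<lambda>k. of_real (w k))))) \<le>
           (Re (tr I (mm I (mm I A A) (spec (\<lambda>k. of_real (w k))))) +
            Re (tr I (mm I (mm I B B) (spec (\<lambda>k. of_real (w k)))))) / 2"
proof -
  have "cmod (tr I (mm I (mm I A B) (spec (\<lambda>k. of_real (w k)))))
      \<le> (\<Sum>k<N. \<Sum>m<N. cmod (of_real (w k) * (coef A k m * coef B m k)))"
    unfolding tr_mm_spec coef_mm sum_distrib_left
    by (rule order_trans[OF norm_sum sum_mono[OF norm_sum]])
  also have "\<dots> = (\<Sum>k<N. \<Sum>m<N. w k * (cmod (coef A k m) * cmod (coef B m k)))"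
    using w by (simp add: norm_mult)
  also have "\<dots> \<le> (\<Sum>k<N. \<Sum>m<N. w k * (((cmod (coef A k m))\<^sup>2 + (cmod (coef B k m))\<^sup>2) / 2))"
  proof (intro sum_mono mult_left_mono w)
    fix k m
    show "cmod (coef A k m) * cmod (coef B m k) \<le> ((cmod (coef A k m))\<^sup>2 + (cmod (coef B k m))\<^sup>2) / 2"
      using sum_squares_bound[of "cmod (coef A k m)" "cmod (coef B k m)"]
      by (simp add: cmod_coef_sym[OF B, of m k])
  qed
  also have "\<dots> = (Re (tr I (mm I (mm I A A) (spec (\<lambda>k. of_real (w k))))) +
            Re (tr I (mm I (mm I B B) (spec (\<lambda>k. of_real (w k)))))) / 2"
    unfolding tr_square_spec[OF A] tr_square_spec[OF B] Re_complex_of_real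
    by (simp add: sum.distrib sum_divide_distrib add_divide_distrib distrib_left)
  finally show ?thesis .
qed

text \<open>Cyclicity of the trace, here an exchange of two summation indices, moves the commutator
  onto the weights.\<close>

lemma tr_comm_spec:
  "tr I (mm I (comm I C A) (spec w)) = (\<Sum>k<N. \<Sum>m<N. coef C k m * coef A m k * (w k - w m))"
proof -
  have "tr I (mm I (comm I C A) (spec w))
      = (\<Sum>k<N. \<Sum>m<N. w k * (coef C k m * coef A m k)) - (\<Sum>k<N. \<Sum>m<N. w k * (coef A k m * coef C m k))"
    by (simp add: tr_mm_spec comm_def coef_diff coef_mm sum_distrib_left right_diff_distrib sum_subtractf)
  also have "(\<Sum>k<N. \<Sum>m<N. w k * (coef A k m * coef C m k)) = (\<Sum>k<N. \<Sum>m<N. w m * (coef A m k * coef C k m))"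
    by (rule sum.swap)
  finally show ?thesis
    by (simp add: algebra_simps sum_subtractf)
qed

lemma coef_eigen_comm:
  assumes H: "\<And>i j. i \<in> I \<Longrightarrow> j \<in> I \<Longrightarrow> H i j = spec (\<lambda>k. of_real (e k)) i j" and kl: "k < N" "l < N"
  shows "coef (comm I C H) k l = coef C k l * of_real (e l - e k)"
proof -
  have H': "coef H k l = (if k = l then of_real (e l) else 0)" if "k < N" "l < N" for k l
    using coef_spec[OF that] coef_cong[of H, OF H] by simp
  have "coef (comm I C H) k l = (\<Sum>m<N. coef C k m * coef H m l) - (\<Sum>m<N. coef H k m * coef C m l)"
    by (simp add: comm_def coef_diff coef_mm)
  also have "(\<Sum>m<N. coef C k m * coef H m l) = (\<Sum>m<N. if m = l then coef C k m * of_real (e l) else 0)"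
    using kl by (intro sum.cong) (auto simp: H')
  also have "(\<Sum>m<N. coef H k m * coef C m l) = (\<Sum>m<N. if m = k then of_real (e k) * coef C m l else 0)"
    using kl by (intro sum.cong) (auto simp: H')
  finally show ?thesis using kl by (simp add: algebra_simps)
qed

text \<open>In an eigenbasis of \<open>H\<close>, Cauchy--Schwarz with the weights of the Duhamel two-point
  function gives the bound; the factor \<open>\<beta>/2\<close> comes from \<open>tanh x \<le> x\<close>.\<close>
theorem bogoliubov_inequality:
  assumes H: "\<And>i j. i \<in> I \<Longrightarrow> j \<in> I \<Longrightarrow> H i j = spec (\<lambda>k. of_real (e k)) i j"
    and A: "herm I A" and C: "herm I C" and \<beta>: "\<beta> \<ge> 0"
  shows "(cmod (tr I (mm I (comm I C A) (boltz \<beta> e))))\<^sup>2 \<le>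
           \<beta> * Re (tr I (mm I (mm I A A) (boltz \<beta> e))) *
           Re (tr I (mm I (- comm I C (comm I C H)) (boltz \<beta> e)))"
proof -
  define w where "w k = exp (- (\<beta> * e k))" for k
  have E: "boltz \<beta> e = spec (\<lambda>k. of_real (w k))" by (simp add: boltz_def w_def)
  have w: "w k > 0" for k by (simp add: w_def)
  define P where "P = {..<N} \<times> {..<N}"
  \<comment> \<open>The weight of \<open>|coef C k m|^2\<close> in the expectation of the negated
    double commutator. It is nonnegative because the Boltzmann weight decreases in energy when
    \<open>\<beta> \<ge> 0\<close>.\<close>
  define D where "D k m = (w k - w m) * (e m - e k)" for k m
  have D: "D k m = \<bar>w k - w m\<bar> * \<bar>e k - e m\<bar>" for k m
  proof (cases "e k \<le> e m")
    case True
    hence "w m \<le> w k" using \<beta> by (simp add: w_def mult_left_mono)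
    thus ?thesis using True by (simp add: D_def)
  next
    case False
    hence "w k \<le> w m" using \<beta> by (simp add: w_def mult_left_mono)
    thus ?thesis using False by (simp add: D_def algebra_simps)
  qed
  have D0: "D k m \<ge> 0" for k m by (simp add: D)
  \<comment> \<open>The weight of \<open>A^2\<close>, multiplied by \<open>\<beta>\<close> and
    symmetrized in the two indices; symmetrization leaves the sum unchanged because \<open>A\<close>
    is Hermitian.\<close>
  define W where "W k m = \<beta> * (w k + w m) / 2" for k m
  have W0: "W k m \<ge> 0" for k m using w[of k] w[of m] \<beta> by (simp add: W_def)
  \<comment> \<open>Only one of the two factors of \<open>|w k - w m|^2\<close> is estimated; the
    other one stays and completes \<open>D k m\<close>.\<close>
  have key: "\<bar>w k - w m\<bar> \<le> sqrt (D k m) * sqrt (W k m)" for k m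
  proof -
    have "\<bar>w k - w m\<bar> \<le> (w k + w m) / 2 * \<bar>\<beta> * e k - \<beta> * e m\<bar>"
      using exp_diff_le[of "\<beta> * e k" "\<beta> * e m"] by (simp add: w_def)
    also have "\<dots> = W k m * \<bar>e k - e m\<bar>"
      using \<beta> by (simp add: W_def abs_mult flip: right_diff_distrib)
    finally have "\<bar>w k - w m\<bar> * \<bar>w k - w m\<bar> \<le> \<bar>w k - w m\<bar> * (W k m * \<bar>e k - e m\<bar>)"
      by (intro mult_left_mono) auto
    hence "\<bar>w k - w m\<bar>\<^sup>2 \<le> D k m * W k m" by (simp add: D power2_eq_square mult_ac)
    hence "sqrt (\<bar>w k - w m\<bar>\<^sup>2) \<le> sqrt (D k m * W k m)" by (rule real_sqrt_le_mono)
    thus ?thesis by (simp add: real_sqrt_mult)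
  qed
  define c where "c p = cmod (coef C (fst p) (snd p)) * sqrt (D (fst p) (snd p))" for p
  define a where "a p = cmod (coef A (fst p) (snd p)) * sqrt (W (fst p) (snd p))" for p
  have "cmod (tr I (mm I (comm I C A) (boltz \<beta> e)))
      \<le> (\<Sum>k<N. \<Sum>m<N. cmod (coef C k m * coef A m k * (of_real (w k) - of_real (w m))))"
    unfolding E tr_comm_spec
    by (rule order_trans[OF norm_sum sum_mono[OF norm_sum]])
  also have "\<dots> \<le> (\<Sum>k<N. \<Sum>m<N. c (k, m) * a (k, m))"
  proof (intro sum_mono)
    fix k m
    have "cmod (coef C k m * coef A m k * (of_real (w k) - of_real (w m)))
        = cmod (coef C k m) * cmod (coef A k m) * \<bar>w k - w m\<bar>"
      by (simp add: norm_mult cmod_coef_sym[OF A, of m k] flip: of_real_diff)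
    also have "\<dots> \<le> cmod (coef C k m) * cmod (coef A k m) * (sqrt (D k m) * sqrt (W k m))"
      by (intro mult_left_mono key) auto
    finally show "cmod (coef C k m * coef A m k * (of_real (w k) - of_real (w m))) \<le> c (k, m) * a (k, m)"
      by (simp add: c_def a_def mult_ac)
  qed
  also have "\<dots> = (\<Sum>p\<in>P. c p * a p)" by (simp add: P_def sum.cartesian_product case_prod_beta)
  finally have "(cmod (tr I (mm I (comm I C A) (boltz \<beta> e))))\<^sup>2 \<le> (\<Sum>p\<in>P. c p * a p)\<^sup>2"
    by (intro power_mono) auto
  also have "\<dots> \<le> (\<Sum>p\<in>P. (c p)\<^sup>2) * (\<Sum>p\<in>P. (a p)\<^sup>2)"
    by (rule Cauchy_Schwarz_ineq_sum)
  also have "(\<Sum>p\<in>P. (a p)\<^sup>2) = \<beta> * Re (tr I (mm I (mm I A A) (boltz \<beta> e)))"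
  proof -
    have "(\<Sum>p\<in>P. (a p)\<^sup>2) = (\<Sum>k<N. \<Sum>m<N. (cmod (coef A k m))\<^sup>2 * W k m)"
      unfolding P_def by (simp add: sum.cartesian_product case_prod_beta a_def power_mult_distrib W0)
    also have "\<dots> = (\<Sum>k<N. \<Sum>m<N. \<beta> / 2 * (w k * (cmod (coef A k m))\<^sup>2))
        + (\<Sum>k<N. \<Sum>m<N. \<beta> / 2 * (w m * (cmod (coef A m k))\<^sup>2))"
      by (simp add: W_def cmod_coef_sym[OF A] algebra_simps add_divide_distrib flip: sum.distrib)
    also have "(\<Sum>k<N. \<Sum>m<N. \<beta> / 2 * (w m * (cmod (coef A m k))\<^sup>2))
        = (\<Sum>k<N. \<Sum>m<N. \<beta> / 2 * (w k * (cmod (coef A k m))\<^sup>2))" by (rule sum.swap)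
    finally show ?thesis
      unfolding E tr_square_spec[OF A] Re_complex_of_real by (simp only: sum_distrib_left[symmetric])
  qed
  also have "(\<Sum>p\<in>P. (c p)\<^sup>2) = Re (tr I (mm I (- comm I C (comm I C H)) (boltz \<beta> e)))"
  proof -
    have "tr I (mm I (- comm I C (comm I C H)) (boltz \<beta> e)) = - tr I (mm I (comm I C (comm I C H)) (boltz \<beta> e))"
      by (simp add: E tr_mm_spec coef_uminus sum_negf)
    also have "\<dots> = - (\<Sum>k<N. \<Sum>m<N. coef C k m * (coef C m k * of_real (e k - e m)) * (of_real (w k) - of_real (w m)))"
      unfolding E tr_comm_spec
      by (intro arg_cong[where f = uminus] sum.cong refl) (simp add: coef_eigen_comm[OF H])
    also have "\<dots> = (\<Sum>k<N. \<Sum>m<N. of_real ((cmod (coef C k m))\<^sup>2 * D k m))"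
      unfolding sum_negf[symmetric] of_real_mult complex_norm_square
      by (intro sum.cong refl) (simp add: coef_herm[OF C, symmetric] D_def algebra_simps)
    finally have "Re (tr I (mm I (- comm I C (comm I C H)) (boltz \<beta> e))) = (\<Sum>k<N. \<Sum>m<N. (cmod (coef C k m))\<^sup>2 * D k m)"
      by (simp only: of_real_sum[symmetric] Re_complex_of_real)
    thus ?thesis
      by (simp add: P_def sum.cartesian_product case_prod_beta c_def power_mult_distrib D0)
  qed
  finally show ?thesis by (simp add: mult_ac)
qed

end

section \<open>Spin operators\<close>

definition scl :: "complex \<Rightarrow> ('a \<Rightarrow> 'a \<Rightarrow> complex) \<Rightarrow> 'a \<Rightarrow> 'a \<Rightarrow> complex" where
  "scl c A = (\<lambda>i j. c * A i j)"

lemma sum_fun2_apply: "(\<Sum>x\<in>F. A x) i j = (\<Sum>x\<in>F. A x i j)" for A :: "'b \<Rightarrow> 'a \<Rightarrow> 'a \<Rightarrow> complex"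
  by (induction F rule: infinite_finite_induct) auto

lemma mm_assoc: "mm I (mm I A B) C = mm I A (mm I B C)"
proof (intro ext)
  fix i j
  have "mm I (mm I A B) C i j = (\<Sum>k\<in>I. \<Sum>l\<in>I. A i l * B l k * C k j)"
    by (simp add: mm_def sum_distrib_right)
  also have "\<dots> = (\<Sum>l\<in>I. \<Sum>k\<in>I. A i l * B l k * C k j)" by (rule sum.swap)
  finally show "mm I (mm I A B) C i j = mm I A (mm I B C) i j"
    by (simp add: mm_def sum_distrib_left mult.assoc)
qed

lemma mm_add_left: "mm I (A + B) C = mm I A C + mm I B C"
  and mm_add_right: "mm I C (A + B) = mm I C A + mm I C B"
  and mm_diff_left: "mm I (A - B) C = mm I A C - mm I B C"
  and mm_diff_right: "mm I C (A - B) = mm I C A - mm I C B"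
  and mm_zero_left: "mm I 0 C = 0"
  and mm_zero_right: "mm I C 0 = 0"
  and mm_scl_left: "mm I (scl c A) C = scl c (mm I A C)"
  and mm_scl_right: "mm I C (scl c A) = scl c (mm I C A)"
  by (auto simp: mm_def scl_def fun_eq_iff algebra_simps sum.distrib sum_subtractf sum_negf sum_distrib_left)

lemma mm_sum_left: "mm I (\<Sum>x\<in>F. A x) C = (\<Sum>x\<in>F. mm I (A x) C)"
  unfolding fun_eq_iff mm_def sum_fun2_apply sum_distrib_right
  by (intro allI, rule sum.swap)

lemma mm_sum_right: "mm I C (\<Sum>x\<in>F. A x) = (\<Sum>x\<in>F. mm I C (A x))"
  unfolding fun_eq_iff mm_def sum_fun2_apply sum_distrib_left
  by (intro allI, rule sum.swap)

lemma comm_mm: "comm I C (mm I A B) = mm I (comm I C A) B + mm I A (comm I C B)"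
  by (simp add: comm_def mm_diff_left mm_diff_right mm_assoc)

lemma comm_add_right: "comm I C (A + B) = comm I C A + comm I C B"
  and comm_diff_right: "comm I C (A - B) = comm I C A - comm I C B"
  and comm_scl_right: "comm I C (scl c A) = scl c (comm I C A)"
  and comm_scl_left: "comm I (scl c A) C = scl c (comm I A C)"
  unfolding comm_def mm_add_left mm_add_right mm_diff_left mm_diff_right mm_scl_left mm_scl_right
  by (simp_all add: fun_eq_iff scl_def algebra_simps)

lemma comm_sum_right: "comm I C (\<Sum>x\<in>F. A x) = (\<Sum>x\<in>F. comm I C (A x))"
  by (simp add: comm_def mm_sum_left mm_sum_right sum_subtractf)

lemma comm_sum_left: "comm I (\<Sum>x\<in>F. A x) C = (\<Sum>x\<in>F. comm I (A x) C)"
  by (simp add: comm_def mm_sum_left mm_sum_right sum_subtractf)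

lemma tr_add: "tr I (A + B) = tr I A + tr I B"
  and tr_scl: "tr I (scl c A) = c * tr I A"
  by (simp_all add: tr_def scl_def sum.distrib sum_subtractf sum_negf sum_distrib_left)

lemma tr_sum: "tr I (\<Sum>x\<in>F. A x) = (\<Sum>x\<in>F. tr I (A x))"
proof -
  have "tr I (\<Sum>x\<in>F. A x) = (\<Sum>i\<in>I. \<Sum>x\<in>F. A x i i)"
    by (simp add: tr_def sum_fun2_apply)
  also have "\<dots> = (\<Sum>x\<in>F. tr I (A x))" unfolding tr_def by (rule sum.swap)
  finally show ?thesis .
qed

lemma herm_sum: "(\<And>x. x \<in> F \<Longrightarrow> herm I (A x)) \<Longrightarrow> herm I (\<Sum>x\<in>F. A x)"
  unfolding herm_def sum_fun2_apply cnj_sum by (intro ballI sum.cong refl) blast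

lemma herm_scl: "herm I A \<Longrightarrow> herm I (scl (of_real r) A)"
  unfolding herm_def scl_def by (metis complex_cnj_complex_of_real complex_cnj_mult)

lemma finite_conf: "finite \<Lambda> \<Longrightarrow> finite (conf n \<Lambda>)"
proof -
  assume "finite \<Lambda>"
  moreover have "conf n \<Lambda> = {f. \<forall>x. (x \<in> \<Lambda> \<longrightarrow> f x \<in> {..n}) \<and> (x \<notin> \<Lambda> \<longrightarrow> f x = 0)}"
    by (auto simp: conf_def)
  ultimately show ?thesis using finite_set_of_finite_funs[of \<Lambda> "{..n}" 0] by simp
qed

section \<open>Single-site spin matrices\<close>

definition lmul :: "nat \<Rightarrow> (nat \<Rightarrow> nat \<Rightarrow> complex) \<Rightarrow> (nat \<Rightarrow> nat \<Rightarrow> complex) \<Rightarrow> nat \<Rightarrow> nat \<Rightarrow> complex" where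
  "lmul n M N a c = (\<Sum>b\<le>n. M a b * N b c)"

text \<open>With \<open>S = n/2\<close> and \<open>m = S - b\<close> the radicand factors as
  \<open>b (n + 1 - b)\<close>, so products of two ladder matrices become polynomial in the
  index.\<close>

lemma spin_plus_eq:
  "spin_plus n a b = (if b = Suc a \<and> a < n then of_real (sqrt (real (Suc a) * (real n - real a))) else 0)"
proof -
  have "real n / 2 * (real n / 2 + 1) - (real n / 2 - real b) * (real n / 2 - real b + 1)
      = real b * (real n - (real b - 1))" by (simp add: field_simps)
  thus ?thesis by (auto simp: spin_plus_def Let_def)
qed

text \<open>The edge \<open>a = n\<close> fits the formula: the intermediate index
  \<open>Suc a\<close> leaves the range and the factor \<open>n - a\<close> vanishes. In the
  opposite order the edge is \<open>a = 0\<close>, where the factor \<open>a\<close>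
  vanishes.\<close>

lemma lmul_plus_minus:
  assumes "a \<le> n" "c \<le> n"
  shows "lmul n (spin_plus n) (spin_minus n) a c =
           (if a = c then of_real (real (Suc a) * (real n - real a)) else 0)"
proof -
  have "lmul n (spin_plus n) (spin_minus n) a c
      = (\<Sum>b\<le>n. if b = Suc a then if a = c \<and> a < n then of_real (real (Suc a) * (real n - real a)) else 0 else 0)"
    unfolding lmul_def spin_minus_def spin_plus_eq
    by (intro sum.cong refl) (auto simp flip: of_real_mult)
  thus ?thesis using assms by (auto simp: sum.delta)
qed

lemma lmul_minus_plus:
  assumes "a \<le> n" "c \<le> n"
  shows "lmul n (spin_minus n) (spin_plus n) a c =
           (if a = c then of_real (real a * (real n + 1 - real a)) else 0)"
proof (cases a)
  case 0
  thus ?thesis by (simp add: lmul_def spin_minus_def spin_plus_eq)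
next
  case (Suc a')
  have "lmul n (spin_minus n) (spin_plus n) a c
      = (\<Sum>b\<le>n. if b = a' then if a = c then of_real (real a * (real n - real a')) else 0 else 0)"
    unfolding lmul_def spin_minus_def spin_plus_eq using Suc assms
    by (intro sum.cong refl) (auto simp flip: of_real_mult)
  thus ?thesis using assms Suc by (auto simp: sum.delta)
qed

text \<open>In ladder matrices this is \<open>\<i>/2\<close> times their commutator, whose diagonal
  \<open>(a+1)(n-a) - a(n+1-a) = n - 2a\<close> is twice the third component.\<close>

lemma lmul_spin1_spin2:
  assumes "a \<le> n" "c \<le> n"
  shows "lmul n (spin1 n) (spin2 n) a c - lmul n (spin2 n) (spin1 n) a c = \<i> * spin3 n a c"
proof -
  let ?P = "spin_plus n" and ?M = "spin_minus n"
  have "lmul n (spin1 n) (spin2 n) a c - lmul n (spin2 n) (spin1 n) a c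
      = (\<Sum>b\<le>n. \<i> / 2 * (?P a b * ?M b c - ?M a b * ?P b c))"
    unfolding lmul_def sum_subtractf[symmetric]
    by (intro sum.cong refl) (simp add: spin1_def spin2_def field_simps)
  also have "\<dots> = \<i> / 2 * (lmul n ?P ?M a c - lmul n ?M ?P a c)"
    by (simp only: lmul_def sum_subtractf[symmetric] sum_distrib_left)
  also have "\<dots> = \<i> * spin3 n a c"
    unfolding lmul_plus_minus[OF assms] lmul_minus_plus[OF assms]
    using assms by (simp add: spin3_def field_simps)
  finally show ?thesis .
qed

lemma lmul_spin3_right: "c \<le> n \<Longrightarrow> lmul n M (spin3 n) a c = M a c * of_real (real n / 2 - real c)"
proof -
  assume c: "c \<le> n"
  have "lmul n M (spin3 n) a c = (\<Sum>b\<le>n. if b = c then M a c * of_real (real n / 2 - real c) else 0)"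
    unfolding lmul_def by (intro sum.cong refl) (auto simp: spin3_def)
  thus ?thesis using c by simp
qed

lemma lmul_spin3_left: "a \<le> n \<Longrightarrow> lmul n (spin3 n) M a c = of_real (real n / 2 - real a) * M a c"
proof -
  assume a: "a \<le> n"
  have "lmul n (spin3 n) M a c = (\<Sum>b\<le>n. if b = a then of_real (real n / 2 - real a) * M a c else 0)"
    unfolding lmul_def by (intro sum.cong refl) (auto simp: spin3_def)
  thus ?thesis using a by simp
qed

lemma lmul_spin1_spin3:
  assumes "a \<le> n" "c \<le> n"
  shows "lmul n (spin1 n) (spin3 n) a c - lmul n (spin3 n) (spin1 n) a c = - \<i> * spin2 n a c"
  unfolding lmul_spin3_right[OF assms(2)] lmul_spin3_left[OF assms(1)]
  by (auto simp: spin1_def spin2_def spin_minus_def spin_plus_eq field_simps)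

text \<open>The value \<open>S (S + 1)\<close> is the source of every uniform bound on two-spin
  expectations below; it takes the place of operator norms.\<close>

lemma lmul_casimir:
  assumes "a \<le> n" "c \<le> n"
  shows "lmul n (spin1 n) (spin1 n) a c + lmul n (spin2 n) (spin2 n) a c + lmul n (spin3 n) (spin3 n) a c
           = (if a = c then of_real (real n / 2 * (real n / 2 + 1)) else 0)"
proof -
  let ?P = "spin_plus n" and ?M = "spin_minus n"
  have s: "lmul n (spin1 n) (spin1 n) a c + lmul n (spin2 n) (spin2 n) a c
      = (lmul n ?P ?M a c + lmul n ?M ?P a c) / 2"
  proof -
    have "lmul n (spin1 n) (spin1 n) a c + lmul n (spin2 n) (spin2 n) a c
      = (\<Sum>b\<le>n. (?P a b * ?M b c + ?M a b * ?P b c) / 2)"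
    unfolding lmul_def sum.distrib[symmetric]
    by (intro sum.cong refl) (simp add: spin1_def spin2_def field_simps)
  also have "\<dots> = (lmul n ?P ?M a c + lmul n ?M ?P a c) / 2"
    by (simp only: lmul_def sum.distrib[symmetric] sum_divide_distrib)
    finally show ?thesis .
  qed
  show ?thesis
    unfolding s lmul_plus_minus[OF assms] lmul_minus_plus[OF assms] lmul_spin3_right[OF assms(2)]
    using assms by (simp add: spin3_def field_simps power2_eq_square)
qed

lemma spin_comp_cnj: "spin_comp n i b a = cnj (spin_comp n i a b)"
  by (auto simp: spin_comp_def spin1_def spin2_def spin3_def spin_minus_def spin_plus_eq field_simps)

text \<open>Setting the kernel to 0 off the configuration space turns the operator identities below
  into equations between functions.\<close>
definition lop :: "nat \<Rightarrow> 'd site set \<Rightarrow> 'd site \<Rightarrow> (nat \<Rightarrow> nat \<Rightarrow> complex) \<Rightarrow> 'd kernel" where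
  "lop n \<Lambda> x M \<sigma> \<tau> = (if \<sigma> \<in> conf n \<Lambda> \<and> \<tau> \<in> conf n \<Lambda> then site_op n \<Lambda> x M \<sigma> \<tau> else 0)"

lemma conf_upd: "\<sigma> \<in> conf n \<Lambda> \<Longrightarrow> x \<in> \<Lambda> \<Longrightarrow> b \<le> n \<Longrightarrow> \<sigma>(x := b) \<in> conf n \<Lambda>"
  by (auto simp: conf_def)

lemma conf_eqI: "\<sigma> \<in> conf n \<Lambda> \<Longrightarrow> \<tau> \<in> conf n \<Lambda> \<Longrightarrow> (\<And>z. z \<in> \<Lambda> \<Longrightarrow> \<sigma> z = \<tau> z) \<Longrightarrow> \<sigma> = \<tau>"
  unfolding conf_def by (intro ext) (metis (mono_tags, lifting) mem_Collect_eq)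

lemma conf_le: "\<sigma> \<in> conf n \<Lambda> \<Longrightarrow> \<sigma> x \<le> n"
  by (cases "x \<in> \<Lambda>") (auto simp: conf_def)

text \<open>A nonzero term forces the intermediate configuration to agree with
  \<open>\<sigma>\<close> off \<open>x\<close>, so the sum over configurations collapses to the
  \<open>n + 1\<close> values at \<open>x\<close>.\<close>

lemma kmul_site_op_same:
  assumes fin: "finite \<Lambda>" and x: "x \<in> \<Lambda>" and \<sigma>: "\<sigma> \<in> conf n \<Lambda>" and \<tau>: "\<tau> \<in> conf n \<Lambda>"
  shows "kmul n \<Lambda> (site_op n \<Lambda> x M) (site_op n \<Lambda> x N) \<sigma> \<tau> = site_op n \<Lambda> x (lmul n M N) \<sigma> \<tau>"
proof (cases "\<forall>z\<in>\<Lambda>. z \<noteq> x \<longrightarrow> \<sigma> z = \<tau> z")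
  case False
  have "site_op n \<Lambda> x M \<sigma> \<rho> * site_op n \<Lambda> x N \<rho> \<tau> = 0" for \<rho>
    using False by (auto simp: site_op_def)
  hence "kmul n \<Lambda> (site_op n \<Lambda> x M) (site_op n \<Lambda> x N) \<sigma> \<tau> = 0"
    unfolding kmul_def by (intro sum.neutral) blast
  thus ?thesis using False by (auto simp: site_op_def)
next
  case True
  let ?g = "\<lambda>b. \<sigma>(x := b)"
  have inj: "inj_on ?g {..n}"
    by (rule inj_onI) (metis fun_upd_same)
  have "kmul n \<Lambda> (site_op n \<Lambda> x M) (site_op n \<Lambda> x N) \<sigma> \<tau>
      = (\<Sum>\<rho>\<in>?g ` {..n}. site_op n \<Lambda> x M \<sigma> \<rho> * site_op n \<Lambda> x N \<rho> \<tau>)"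
    unfolding kmul_def
  proof (rule sum.mono_neutral_right)
    show "finite (conf n \<Lambda>)" by (rule finite_conf[OF fin])
    show "?g ` {..n} \<subseteq> conf n \<Lambda>" using conf_upd[OF \<sigma> x] by auto
    show "\<forall>\<rho>\<in>conf n \<Lambda> - ?g ` {..n}. site_op n \<Lambda> x M \<sigma> \<rho> * site_op n \<Lambda> x N \<rho> \<tau> = 0"
    proof
      fix \<rho> assume \<rho>: "\<rho> \<in> conf n \<Lambda> - ?g ` {..n}"
      have "\<not> (\<forall>z\<in>\<Lambda>. z \<noteq> x \<longrightarrow> \<sigma> z = \<rho> z)"
      proof
        assume eq: "\<forall>z\<in>\<Lambda>. z \<noteq> x \<longrightarrow> \<sigma> z = \<rho> z"
        have "\<rho> = ?g (\<rho> x)"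
          using \<rho> eq by (intro conf_eqI[of _ n \<Lambda>] conf_upd \<sigma> x conf_le) auto
        moreover have "\<rho> x \<le> n" using \<rho> by (auto intro: conf_le)
        ultimately show False using \<rho> by blast
      qed
      thus "site_op n \<Lambda> x M \<sigma> \<rho> * site_op n \<Lambda> x N \<rho> \<tau> = 0" by (auto simp: site_op_def)
    qed
  qed
  also have "\<dots> = (\<Sum>b\<le>n. M (\<sigma> x) b * N b (\<tau> x))"
    using True by (simp add: sum.reindex[OF inj] site_op_def)
  finally show ?thesis using True by (simp add: site_op_def lmul_def)
qed

text \<open>Only one intermediate configuration survives: the one that has already changed at
  \<open>x\<close> and not yet at \<open>y\<close>. The result is symmetric under exchange of the
  two factors, which is locality.\<close>

lemma kmul_site_op_diff:
  assumes fin: "finite \<Lambda>" and x: "x \<in> \<Lambda>" and y: "y \<in> \<Lambda>" and xy: "x \<noteq> y"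
    and \<sigma>: "\<sigma> \<in> conf n \<Lambda>" and \<tau>: "\<tau> \<in> conf n \<Lambda>"
  shows "kmul n \<Lambda> (site_op n \<Lambda> x M) (site_op n \<Lambda> y N) \<sigma> \<tau> =
           M (\<sigma> x) (\<tau> x) * N (\<sigma> y) (\<tau> y) * (if \<forall>z\<in>\<Lambda>. z \<noteq> x \<longrightarrow> z \<noteq> y \<longrightarrow> \<sigma> z = \<tau> z then 1 else 0)"
proof -
  let ?r = "\<sigma>(x := \<tau> x)"
  have r: "?r \<in> conf n \<Lambda>" using conf_upd[OF \<sigma> x] conf_le[OF \<tau>] by blast
  have "kmul n \<Lambda> (site_op n \<Lambda> x M) (site_op n \<Lambda> y N) \<sigma> \<tau>
      = (\<Sum>\<rho>\<in>{?r}. site_op n \<Lambda> x M \<sigma> \<rho> * site_op n \<Lambda> y N \<rho> \<tau>)"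
    unfolding kmul_def
  proof (rule sum.mono_neutral_right)
    show "finite (conf n \<Lambda>)" by (rule finite_conf[OF fin])
    show "\<forall>\<rho>\<in>conf n \<Lambda> - {?r}. site_op n \<Lambda> x M \<sigma> \<rho> * site_op n \<Lambda> y N \<rho> \<tau> = 0"
    proof
      fix \<rho> assume \<rho>: "\<rho> \<in> conf n \<Lambda> - {?r}"
      have "\<not> ((\<forall>z\<in>\<Lambda>. z \<noteq> x \<longrightarrow> \<sigma> z = \<rho> z) \<and> (\<forall>z\<in>\<Lambda>. z \<noteq> y \<longrightarrow> \<rho> z = \<tau> z))"
      proof
        assume "(\<forall>z\<in>\<Lambda>. z \<noteq> x \<longrightarrow> \<sigma> z = \<rho> z) \<and> (\<forall>z\<in>\<Lambda>. z \<noteq> y \<longrightarrow> \<rho> z = \<tau> z)"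
        hence "\<rho> = ?r" using \<rho> r x xy by (intro conf_eqI[of _ n \<Lambda>]) auto
        thus False using \<rho> by blast
      qed
      thus "site_op n \<Lambda> x M \<sigma> \<rho> * site_op n \<Lambda> y N \<rho> \<tau> = 0" by (auto simp: site_op_def)
    qed
  qed (use r in auto)
  thus ?thesis using x y xy by (auto simp: site_op_def)
qed

lemma kmul_eq_mm: "kmul n \<Lambda> = mm (conf n \<Lambda>)"
  by (simp add: kmul_def mm_def fun_eq_iff)

lemma mm_lop: "mm (conf n \<Lambda>) (lop n \<Lambda> x M) (lop n \<Lambda> y N) =
    (\<lambda>\<sigma> \<tau>. if \<sigma> \<in> conf n \<Lambda> \<and> \<tau> \<in> conf n \<Lambda> then kmul n \<Lambda> (site_op n \<Lambda> x M) (site_op n \<Lambda> y N) \<sigma> \<tau> else 0)"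
  by (auto simp: mm_def kmul_def lop_def fun_eq_iff intro!: sum.cong)

lemma mm_lop_same:
  assumes "finite \<Lambda>" "x \<in> \<Lambda>"
  shows "mm (conf n \<Lambda>) (lop n \<Lambda> x M) (lop n \<Lambda> x N) = lop n \<Lambda> x (lmul n M N)"
  unfolding mm_lop using assms by (auto simp: fun_eq_iff lop_def kmul_site_op_same)

lemma comm_lop_diff:
  assumes "finite \<Lambda>" "x \<in> \<Lambda>" "y \<in> \<Lambda>" "x \<noteq> y"
  shows "comm (conf n \<Lambda>) (lop n \<Lambda> x M) (lop n \<Lambda> y N) = 0"
  unfolding comm_def mm_lop using assms by (auto simp: fun_eq_iff kmul_site_op_diff)

lemma comm_lop_same:
  assumes "finite \<Lambda>" "x \<in> \<Lambda>"
    and "\<And>a c. a \<le> n \<Longrightarrow> c \<le> n \<Longrightarrow> lmul n M N a c - lmul n N M a c = r * K a c"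
  shows "comm (conf n \<Lambda>) (lop n \<Lambda> x M) (lop n \<Lambda> x N) = scl r (lop n \<Lambda> x K)"
  unfolding comm_def mm_lop_same[OF assms(1,2)] 
  by (auto simp: fun_eq_iff lop_def site_op_def scl_def assms(3) conf_le simp flip: left_diff_distrib)

lemma herm_lop_spin: "herm (conf n \<Lambda>) (lop n (\<Lambda> :: 'd site set) x (spin_comp n i))"
  unfolding herm_def
proof (intro ballI)
  fix \<sigma> \<tau> :: "'d cfg"
  have "(\<forall>z\<in>\<Lambda>. z \<noteq> x \<longrightarrow> \<tau> z = \<sigma> z) \<longleftrightarrow> (\<forall>z\<in>\<Lambda>. z \<noteq> x \<longrightarrow> \<sigma> z = \<tau> z)"
    by metis
  thus "lop n \<Lambda> x (spin_comp n i) \<tau> \<sigma> = cnj (lop n \<Lambda> x (spin_comp n i) \<sigma> \<tau>)"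
    by (simp add: lop_def site_op_def spin_comp_cnj[of n i "\<tau> x" "\<sigma> x"])
qed

section \<open>Finite-volume Gibbs states\<close>

lemma finite_vec_set:
  assumes "\<And>i. finite (A i)"
  shows "finite {x :: int^'d::finite. \<forall>i. x $ i \<in> A i}"
proof -
  have "{x :: int^'d. \<forall>i. x $ i \<in> A i} \<subseteq> vec_lambda ` (PiE UNIV A)"
    by (auto intro!: image_eqI[where x = "vec_nth _"])
  moreover have "finite (vec_lambda ` (PiE (UNIV :: 'd set) A))"
    using assms by (intro finite_imageI finite_PiE) auto
  ultimately show ?thesis by (rule finite_subset)
qed

lemma finite_box: "finite (box L)"
  unfolding Defs.box_def using finite_vec_set[of "\<lambda>_. {- int L + 1..int L}"] by simp

definition T :: "nat \<Rightarrow> nat \<Rightarrow> nat \<Rightarrow> 'd::finite site \<Rightarrow> 'd kernel" where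
  "T n L i x = lop n (box L) x (spin_comp n i)"

lemma herm_T: "herm (conf n (box L)) (T n L i x)"
  unfolding T_def by (rule herm_lop_spin)

lemma comm_T1_T1: "x \<in> box L \<Longrightarrow> comm (conf n (box L)) (T n L 1 x) (T n L 1 x) = 0"
  by (simp add: comm_def)

lemma comm_T1_T2:
  "x \<in> box L \<Longrightarrow> comm (conf n (box L)) (T n L 1 x) (T n L 2 x) = scl \<i> (T n L 3 x)"
  unfolding T_def by (rule comm_lop_same[OF finite_box]) (auto simp: spin_comp_def lmul_spin1_spin2)

lemma comm_T1_T3:
  "x \<in> box L \<Longrightarrow> comm (conf n (box L)) (T n L 1 x) (T n L 3 x) = scl (- \<i>) (T n L 2 x)"
  unfolding T_def by (rule comm_lop_same[OF finite_box]) (auto simp: spin_comp_def lmul_spin1_spin3)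

lemma comm_T_diff:
  "x \<in> box L \<Longrightarrow> y \<in> box L \<Longrightarrow> x \<noteq> y \<Longrightarrow> comm (conf n (box L)) (T n L i x) (T n L j y) = 0"
  unfolding T_def by (rule comm_lop_diff[OF finite_box])

text \<open>The generator of a rotation about the first axis through the site-dependent angle
  \<open>f x\<close>. This axis is chosen because it turns the transverse component 2 into the
  ordered component 3.\<close>

definition Cop :: "nat \<Rightarrow> nat \<Rightarrow> ('d::finite site \<Rightarrow> real) \<Rightarrow> 'd kernel" where
  "Cop n L f = (\<Sum>x\<in>box L. scl (of_real (f x)) (T n L 1 x))"

lemma comm_Cop:
  assumes x: "x \<in> box L"
  shows "comm (conf n (box L)) (Cop n L f) (T n L i x) = scl (of_real (f x)) (comm (conf n (box L)) (T n L 1 x) (T n L i x))"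
proof -
  have "comm (conf n (box L)) (Cop n L f) (T n L i x)
      = (\<Sum>z\<in>box L. scl (of_real (f z)) (comm (conf n (box L)) (T n L 1 z) (T n L i x)))"
    by (simp only: Cop_def comm_sum_left comm_scl_left)
  also have "\<dots> = (\<Sum>z\<in>box L. if z = x then scl (of_real (f x)) (comm (conf n (box L)) (T n L 1 x) (T n L i x)) else 0)"
    using x by (intro sum.cong refl) (auto simp: comm_T_diff scl_def fun_eq_iff)
  also have "\<dots> = scl (of_real (f x)) (comm (conf n (box L)) (T n L 1 x) (T n L i x))"
    by (subst sum.delta[OF finite_box]) (use x in simp)
  finally show ?thesis .
qed

lemma comm_Cop_T:
  assumes "x \<in> box L"
  shows "comm (conf n (box L)) (Cop n L f) (T n L 1 x) = 0"
    and "comm (conf n (box L)) (Cop n L f) (T n L 2 x) = scl (\<i> * of_real (f x)) (T n L 3 x)"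
    and "comm (conf n (box L)) (Cop n L f) (T n L 3 x) = scl (- \<i> * of_real (f x)) (T n L 2 x)"
  unfolding comm_Cop[OF assms] comm_T1_T1[OF assms] comm_T1_T2[OF assms] comm_T1_T3[OF assms]
  by (auto simp: scl_def fun_eq_iff mult_ac)

definition bond :: "nat \<Rightarrow> nat \<Rightarrow> 'd::finite site \<Rightarrow> 'd site \<Rightarrow> 'd kernel" where
  "bond n L x y = (\<Sum>i\<in>{1,2,3}. mm (conf n (box L)) (T n L i x) (T n L i y))"

text \<open>The derivation generated by \<open>\<Sum> f(x) S\<^sub>x\<^sup>1\<close> sees only differences of \<open>f\<close> because the
  Heisenberg interaction is rotation invariant.\<close>
lemma comm_comm_bond:
  fixes f :: "'d::finite site \<Rightarrow> real"
  assumes x: "x \<in> box L" and y: "y \<in> box L"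
  shows "comm (conf n (box L)) (Cop n L f) (comm (conf n (box L)) (Cop n L f) (bond n L x y)) =
     scl (of_real ((f x - f y)\<^sup>2)) (mm (conf n (box L)) (T n L 2 x) (T n L 2 y) + mm (conf n (box L)) (T n L 3 x) (T n L 3 y))"
proof -
  let ?I = "conf n (box L :: 'd site set)"
  let ?C = "comm ?I (Cop n L f)" and ?m = "\<lambda>i j. mm ?I (T n L i x) (T n L j y)"
  have b: "bond n L x y = ?m 1 1 + ?m 2 2 + ?m 3 3"
    by (simp add: bond_def fun_eq_iff)
  have m: "?C (?m 1 1) = 0"
     "?C (?m 2 2) = scl (\<i> * of_real (f x)) (?m 3 2) + scl (\<i> * of_real (f y)) (?m 2 3)"
     "?C (?m 3 3) = scl (- \<i> * of_real (f x)) (?m 2 3) + scl (- \<i> * of_real (f y)) (?m 3 2)"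
     "?C (?m 3 2) = scl (- \<i> * of_real (f x)) (?m 2 2) + scl (\<i> * of_real (f y)) (?m 3 3)"
     "?C (?m 2 3) = scl (\<i> * of_real (f x)) (?m 3 3) + scl (- \<i> * of_real (f y)) (?m 2 2)"
    unfolding comm_mm comm_Cop_T[OF x] comm_Cop_T[OF y] mm_scl_left mm_scl_right mm_zero_left mm_zero_right
    by (simp_all only: add_0)
  \<comment> \<open>The 22 and 33 terms mix only through 32 and 23, and their coefficients combine
    into \<open>f x - f y\<close>. The second application reproduces this factor, whence the
    square.\<close>
  have "?C (bond n L x y) = scl (\<i> * of_real (f x - f y)) (?m 3 2) + scl (- \<i> * of_real (f x - f y)) (?m 2 3)"
    unfolding b comm_add_right m by (simp add: fun_eq_iff scl_def algebra_simps)
  hence "?C (?C (bond n L x y)) = scl (\<i> * of_real (f x - f y)) (?C (?m 3 2)) + scl (- \<i> * of_real (f x - f y)) (?C (?m 2 3))"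
    by (simp only: comm_add_right comm_scl_right)
  thus ?thesis
    unfolding m by (simp add: fun_eq_iff scl_def algebra_simps power2_eq_square)
qed

text \<open>The field direction is not invariant under the rotation, so \<open>f\<close> itself
  enters rather than its differences. This term can be discarded only in the limit
  \<open>B \<rightarrow> 0\<close>.\<close>

lemma comm_comm_T3:
  assumes x: "x \<in> box L"
  shows "comm (conf n (box L)) (Cop n L f) (comm (conf n (box L)) (Cop n L f) (T n L 3 x)) = scl (of_real ((f x)\<^sup>2)) (T n L 3 x)"
  unfolding comm_Cop_T[OF x] comm_scl_right by (simp add: scl_def fun_eq_iff power2_eq_square algebra_simps)

text \<open>The Hamiltonian rebuilt from the operators \<open>T\<close>, to which the commutator
  identities apply as equations between functions. It is compared with \<open>ham\<close> only on
  configurations of the box.\<close>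

definition Hop :: "nat \<Rightarrow> nat \<Rightarrow> real \<Rightarrow> 'd::finite kernel" where
  "Hop n L B = scl (1/2) (\<Sum>x\<in>box L. \<Sum>y\<in>{y\<in>box L. pnb L x y}. bond n L x y)
     - scl (of_real B) (\<Sum>x\<in>box L. scl (stag x) (T n L 3 x))"

lemma Hop_eq_ham:
  assumes "\<sigma> \<in> conf n (box L)" "\<tau> \<in> conf n (box L)"
  shows "Hop n L B \<sigma> \<tau> = ham n L B \<sigma> \<tau>"
proof -
  have 1: "bond n L x y \<sigma> \<tau> = (\<Sum>i\<in>{1,2,3::nat}.
        kmul n (box L) (site_op n (box L) x (spin_comp n i)) (site_op n (box L) y (spin_comp n i)) \<sigma> \<tau>)" for x y
    unfolding bond_def sum_fun2_apply T_def mm_lop using assms by simp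
  have 2: "T n L 3 x \<sigma> \<tau> = site_op n (box L) x (spin3 n) \<sigma> \<tau>" for x
    using assms by (simp add: T_def lop_def spin_comp_def)
  have "Hop n L B \<sigma> \<tau> = 1/2 * (\<Sum>x\<in>box L. \<Sum>y\<in>{y\<in>box L. pnb L x y}. bond n L x y \<sigma> \<tau>)
     - of_real B * (\<Sum>x\<in>box L. stag x * T n L 3 x \<sigma> \<tau>)"
    unfolding Hop_def by (simp add: scl_def sum_fun2_apply)
  thus ?thesis unfolding 1 2 by (simp only: ham_def stag_mag_def)
qed

lemma double_comm_Hop:
  "- comm (conf n (box L)) (Cop n L f) (comm (conf n (box L)) (Cop n L f) (Hop n L B)) =
     scl (- 1/2) (\<Sum>x\<in>box L. \<Sum>y\<in>{y\<in>box L. pnb L x y}. scl (of_real ((f x - f y)\<^sup>2))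
        (mm (conf n (box L)) (T n L 2 x) (T n L 2 y) + mm (conf n (box L)) (T n L 3 x) (T n L 3 y)))
     + scl (of_real B) (\<Sum>x\<in>box L. scl (stag x) (scl (of_real ((f x)\<^sup>2)) (T n L 3 x)))"
proof -
  have "comm (conf n (box L)) (Cop n L f) (comm (conf n (box L)) (Cop n L f) (Hop n L B)) =
     scl (1/2) (\<Sum>x\<in>box L. \<Sum>y\<in>{y\<in>box L. pnb L x y}. comm (conf n (box L)) (Cop n L f) (comm (conf n (box L)) (Cop n L f) (bond n L x y)))
     - scl (of_real B) (\<Sum>x\<in>box L. scl (stag x) (comm (conf n (box L)) (Cop n L f) (comm (conf n (box L)) (Cop n L f) (T n L 3 x))))"
    by (simp only: Hop_def comm_diff_right comm_scl_right comm_sum_right)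
  also have "(\<Sum>x\<in>box L. \<Sum>y\<in>{y\<in>box L. pnb L x y}. comm (conf n (box L)) (Cop n L f) (comm (conf n (box L)) (Cop n L f) (bond n L x y)))
    = (\<Sum>x\<in>box L. \<Sum>y\<in>{y\<in>box L. pnb L x y}. scl (of_real ((f x - f y)\<^sup>2))
        (mm (conf n (box L)) (T n L 2 x) (T n L 2 y) + mm (conf n (box L)) (T n L 3 x) (T n L 3 y)))"
    by (intro sum.cong refl comm_comm_bond) auto
  also have "(\<Sum>x\<in>box L. scl (stag x) (comm (conf n (box L)) (Cop n L f) (comm (conf n (box L)) (Cop n L f) (T n L 3 x))))
     = (\<Sum>x\<in>box L. scl (stag x) (scl (of_real ((f x)\<^sup>2)) (T n L 3 x)))"
    by (intro sum.cong refl arg_cong[where f = "scl _"] comm_comm_T3)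
  finally show ?thesis by (simp add: fun_eq_iff scl_def)
qed


section \<open>The Gibbs weight in an eigenbasis of the Hamiltonian\<close>

lemma (in eigenbasis) mm_spec_right:
  "mm I X (spec w) i j = (\<Sum>m<N. w m * app_on I X (u m) i * cnj (u m j))"
proof -
  have "mm I X (spec w) i j = (\<Sum>k\<in>I. \<Sum>m<N. w m * (X i k * u m k) * cnj (u m j))"
    unfolding mm_def spec_def sum_distrib_left by (intro sum.cong refl) (simp add: mult_ac)
  also have "\<dots> = (\<Sum>m<N. \<Sum>k\<in>I. w m * (X i k * u m k) * cnj (u m j))" by (rule sum.swap)
  finally show ?thesis by (simp add: app_on_def sum_distrib_left sum_distrib_right)
qed

text \<open>In an eigenbasis the k-th power has eigenvalues \<open>a m ^ k\<close>; the case
  \<open>k = 0\<close> is completeness. What remains is a finite sum of scalar exponential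
  series.\<close>

lemma kexp_spec:
  assumes "eigenbasis (conf n \<Lambda>) N u"
    and eig: "\<And>m \<sigma>. m < N \<Longrightarrow> \<sigma> \<in> conf n \<Lambda> \<Longrightarrow> app_on (conf n \<Lambda>) A (u m) \<sigma> = of_real (a m) * u m \<sigma>"
    and \<sigma>: "\<sigma> \<in> conf n \<Lambda>" and \<tau>: "\<tau> \<in> conf n \<Lambda>"
  shows "kexp n \<Lambda> A \<sigma> \<tau> = eigenbasis.spec N u (\<lambda>m. of_real (exp (a m))) \<sigma> \<tau>"
proof -
  interpret eigenbasis "conf n \<Lambda>" N u by fact
  have pow: "kpow n \<Lambda> A k \<sigma> \<tau> = spec (\<lambda>m. of_real (a m ^ k)) \<sigma> \<tau>" if "\<sigma> \<in> conf n \<Lambda>" for k \<sigma>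
    using that
  proof (induction k arbitrary: \<sigma>)
    case 0
    thus ?case using complete[of \<sigma> \<tau>] \<tau> by (simp add: kpow_def kid_def spec_def)
  next
    case (Suc k)
    have "kpow n \<Lambda> A (Suc k) \<sigma> \<tau> = (\<Sum>\<rho>\<in>conf n \<Lambda>. A \<sigma> \<rho> * kpow n \<Lambda> A k \<rho> \<tau>)"
      by (simp add: kpow_def kmul_def)
    also have "\<dots> = mm (conf n \<Lambda>) A (spec (\<lambda>m. of_real (a m ^ k))) \<sigma> \<tau>"
      unfolding mm_def by (intro sum.cong refl) (simp add: Suc.IH)
    also have "\<dots> = spec (\<lambda>m. of_real (a m ^ Suc k)) \<sigma> \<tau>"
      unfolding mm_spec_right spec_def using Suc.prems
      by (intro sum.cong refl) (simp add: eig)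
    finally show ?case .
  qed
  have "(\<lambda>k. kpow n \<Lambda> A k \<sigma> \<tau> / of_nat (fact k)) sums spec (\<lambda>m. of_real (exp (a m))) \<sigma> \<tau>"
  proof -
    have "(\<lambda>k. \<Sum>m<N. of_real (a m ^ k /\<^sub>R fact k) * (u m \<sigma> * cnj (u m \<tau>))) sums
          (\<Sum>m<N. of_real (exp (a m)) * (u m \<sigma> * cnj (u m \<tau>)))"
      by (intro sums_sum sums_mult2 sums_of_real exp_converges)
    also have "(\<lambda>k. \<Sum>m<N. of_real (a m ^ k /\<^sub>R fact k) * (u m \<sigma> * cnj (u m \<tau>)))
        = (\<lambda>k. kpow n \<Lambda> A k \<sigma> \<tau> / of_nat (fact k))"
      unfolding pow[OF \<sigma>] spec_def sum_divide_distrib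
      by (intro ext sum.cong refl) (simp add: field_simps)
    finally show ?thesis by (simp add: spec_def mult.assoc)
  qed
  thus ?thesis unfolding kexp_def by (rule sums_unique[symmetric])
qed

lemma tr_cong: "(\<And>i. i \<in> I \<Longrightarrow> A i i = B i i) \<Longrightarrow> tr I A = tr I B"
  by (simp add: tr_def)

lemma mm_cong: "(\<And>k. k \<in> I \<Longrightarrow> A i k = A' i k) \<Longrightarrow> (\<And>k. k \<in> I \<Longrightarrow> B k j = B' k j) \<Longrightarrow> mm I A B i j = mm I A' B' i j"
  by (simp add: mm_def)

text \<open>The Gibbs expectation of a kernel that already lives on the whole box, such as a
  commutator with \<open>Cop\<close>; \<open>gibbs\<close> first embeds a local observable.\<close>

definition gexp :: "nat \<Rightarrow> nat \<Rightarrow> real \<Rightarrow> real \<Rightarrow> 'd::finite kernel \<Rightarrow> complex" where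
  "gexp n L B \<beta> X = (let I = conf n (box L); E = kexp n (box L) (\<lambda>\<sigma> \<tau>. - complex_of_real \<beta> * ham n L B \<sigma> \<tau>)
     in tr I (mm I X E) / tr I E)"

lemma gibbs_eq_gexp:
  assumes "\<And>\<sigma> \<tau>. \<sigma> \<in> conf n (box L) \<Longrightarrow> \<tau> \<in> conf n (box L) \<Longrightarrow> ext \<Gamma> (box L) A \<sigma> \<tau> = X \<sigma> \<tau>"
  shows "gibbs n L B \<beta> \<Gamma> A = gexp n L B \<beta> X"
  unfolding gibbs_def gexp_def Let_def ktr_def kmul_eq_mm tr_def
  by (intro arg_cong2[where f = "(/)"] sum.cong refl mm_cong) (simp_all add: assms)

lemma gexp_add: "gexp n L B \<beta> (X + Y) = gexp n L B \<beta> X + gexp n L B \<beta> Y"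
  unfolding gexp_def Let_def mm_add_left tr_add by (rule add_divide_distrib)

lemma gexp_scl: "gexp n L B \<beta> (scl c X) = c * gexp n L B \<beta> X"
  unfolding gexp_def Let_def mm_scl_left tr_scl by simp

lemma gexp_sum: "gexp n L B \<beta> (\<Sum>x\<in>F. X x) = (\<Sum>x\<in>F. gexp n L B \<beta> (X x))"
  unfolding gexp_def Let_def mm_sum_left tr_sum by (rule sum_divide_distrib)

lemma herm_diff: "herm I A \<Longrightarrow> herm I B \<Longrightarrow> herm I (A - B)"
  unfolding herm_def fun_diff_def complex_cnj_diff by metis

lemma herm_mm:
  assumes A: "herm I A" and B: "herm I B" and AB: "comm I A B = 0"
  shows "herm I (mm I A B)"
  unfolding herm_def
proof (intro ballI)
  fix i j assume ij: "i \<in> I" "j \<in> I"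
  have "mm I A B j i = mm I B A j i"
    using AB by (simp add: comm_def fun_eq_iff)
  also have "\<dots> = (\<Sum>k\<in>I. cnj (A i k * B k j))"
    unfolding mm_def complex_cnj_mult
  proof (intro sum.cong refl)
    fix k assume k: "k \<in> I"
    have "B j k = cnj (B k j)" "A k i = cnj (A i k)" using A B ij k unfolding herm_def by blast+
    thus "B j k * A k i = cnj (A i k) * cnj (B k j)" by (simp only: mult.commute)
  qed
  finally show "mm I A B j i = cnj (mm I A B i j)" by (simp add: mm_def)
qed

lemma herm_Hop: "herm (conf n (box L)) (Hop n L B :: 'd::finite kernel)"
proof -
  have b: "herm (conf n (box L)) (bond n L x y)" if "x \<in> box L" "y \<in> box L" for x y :: "'d site"
    unfolding bond_def
  proof (intro herm_sum herm_mm herm_T)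
    fix i show "comm (conf n (box L)) (T n L i x) (T n L i y) = 0"
      using comm_T_diff[OF that] by (cases "x = y") (auto simp: comm_def)
  qed
  have h: "herm (conf n (box L)) (scl (1/2) X)" if "herm (conf n (box L)) X" for X :: "'d kernel"
    using herm_scl[OF that, of "1/2"] by simp
  have s: "herm (conf n (box L)) (scl (stag x) (T n L 3 x))" for x :: "'d site"
    using herm_scl[OF herm_T, of n L "if even (\<Sum>i\<in>UNIV. x $ i) then 1 else -1" 3 x] by (simp add: stag_def split: if_splits)
  show ?thesis
    unfolding Hop_def by (intro herm_diff h herm_scl herm_sum b s) auto
qed

lemma (in eigenbasis) tr_spec: "tr I (spec w) = (\<Sum>k<N. w k)"
  by (simp add: tr_coef coef_spec)

text \<open>The four statements share one diagonalization of \<open>Hop\<close>, in which the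
  Boltzmann factor and the partition function are explicit.\<close>

lemma gexp_facts:
  fixes X Y :: "'d::finite kernel"
  assumes \<beta>: "\<beta> \<ge> 0" and X: "herm (conf n (box L)) X" and Y: "herm (conf n (box L)) Y"
  shows gexp_bogoliubov: "(cmod (gexp n L B \<beta> (comm (conf n (box L)) X Y)))\<^sup>2 \<le>
           \<beta> * Re (gexp n L B \<beta> (mm (conf n (box L)) Y Y)) *
           Re (gexp n L B \<beta> (- comm (conf n (box L)) X (comm (conf n (box L)) X (Hop n L B))))"
    and gexp_square_nonneg: "Re (gexp n L B \<beta> (mm (conf n (box L)) X X)) \<ge> 0"
    and gexp_product_norm_le: "cmod (gexp n L B \<beta> (mm (conf n (box L)) X Y)) \<le>
           (Re (gexp n L B \<beta> (mm (conf n (box L)) X X)) + Re (gexp n L B \<beta> (mm (conf n (box L)) Y Y))) / 2"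
    and gexp_one: "gexp n L B \<beta> (\<lambda>\<sigma> \<tau>. if \<sigma> \<in> conf n (box L :: 'd site set) \<and> \<tau> \<in> conf n (box L) \<and> \<sigma> = \<tau> then 1 else 0) = 1"
proof -
  let ?I = "conf n (box L :: 'd site set)"
  have finI: "finite ?I" by (intro finite_conf finite_box)
  obtain N u e where eb: "eigenbasis ?I N u"
    and eig: "\<And>k i. k < N \<Longrightarrow> i \<in> ?I \<Longrightarrow> app_on ?I (Hop n L B) (u k) i = of_real (e k :: real) * u k i"
    using hermitian_eigenbasis[OF finI herm_Hop[of n L B]] by blast
  interpret eigenbasis ?I N u by fact
  let ?E = "kexp n (box L) (\<lambda>\<sigma> \<tau>. - complex_of_real \<beta> * ham n L B \<sigma> \<tau>)"
  have E: "?E \<sigma> \<tau> = boltz \<beta> e \<sigma> \<tau>" if "\<sigma> \<in> ?I" "\<tau> \<in> ?I" for \<sigma> \<tau>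
  proof -
    have "app_on ?I (\<lambda>\<sigma> \<tau>. - complex_of_real \<beta> * ham n L B \<sigma> \<tau>) (u m) \<sigma> = of_real (- (\<beta> * e m)) * u m \<sigma>"
      if m: "m < N" and \<sigma>: "\<sigma> \<in> ?I" for m \<sigma>
    proof -
      have "app_on ?I (\<lambda>\<sigma> \<tau>. - complex_of_real \<beta> * ham n L B \<sigma> \<tau>) (u m) \<sigma>
          = - of_real \<beta> * app_on ?I (Hop n L B) (u m) \<sigma>"
        unfolding app_on_def sum_distrib_left using \<sigma>
        by (intro sum.cong refl) (simp add: Hop_eq_ham)
      thus ?thesis by (simp add: eig[OF m \<sigma>])
    qed
    from kexp_spec[OF eb this that] show ?thesis by (simp add: boltz_def)
  qed
  define Z where "Z = (\<Sum>k<N. exp (- (\<beta> * e k)))"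
  have trE: "tr ?I ?E = of_real Z"
  proof -
    have "tr ?I ?E = tr ?I (boltz \<beta> e)" by (intro tr_cong E)
    thus ?thesis by (simp add: boltz_def tr_spec Z_def)
  qed
  have gexp_eq: "gexp n L B \<beta> X = tr ?I (mm ?I X (boltz \<beta> e)) / of_real Z" for X
  proof -
    have "tr ?I (mm ?I X ?E) = tr ?I (mm ?I X (boltz \<beta> e))"
      by (intro tr_cong mm_cong E) auto
    thus ?thesis by (simp only: gexp_def Let_def trE)
  qed
  \<comment> \<open>The zero configuration exists, so completeness at this point excludes an empty
    basis.\<close>
  have Zpos: "Z > 0"
  proof -
    have "(\<lambda>_. 0) \<in> ?I" by (simp add: conf_def)
    from complete[OF this this] have "N \<noteq> 0" by (auto intro: ccontr)
    thus ?thesis unfolding Z_def by (intro sum_pos) auto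
  qed
  have Re_gexp: "Re (gexp n L B \<beta> X) = Re (tr ?I (mm ?I X (boltz \<beta> e))) / Z" for X
    by (simp add: gexp_eq)
  have sq: "Re (tr ?I (mm ?I (mm ?I X X) (boltz \<beta> e))) \<ge> 0" if "herm ?I X" for X
    unfolding boltz_def tr_square_spec[OF that] Re_complex_of_real by (intro sum_nonneg) auto
  show "Re (gexp n L B \<beta> (mm ?I X X)) \<ge> 0"
    using sq[OF X] Zpos by (simp add: Re_gexp)
  show "cmod (gexp n L B \<beta> (mm ?I X Y)) \<le> (Re (gexp n L B \<beta> (mm ?I X X)) + Re (gexp n L B \<beta> (mm ?I Y Y))) / 2"
  proof -
    have "cmod (tr ?I (mm ?I (mm ?I X Y) (boltz \<beta> e))) \<le>
       (Re (tr ?I (mm ?I (mm ?I X X) (boltz \<beta> e))) + Re (tr ?I (mm ?I (mm ?I Y Y) (boltz \<beta> e)))) / 2"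
      unfolding boltz_def by (rule tr_mm_norm_le[OF X Y]) simp
    thus ?thesis using Zpos unfolding Re_gexp gexp_eq by (simp add: norm_divide field_simps)
  qed
  show "gexp n L B \<beta> (\<lambda>\<sigma> \<tau>. if \<sigma> \<in> ?I \<and> \<tau> \<in> ?I \<and> \<sigma> = \<tau> then 1 else 0) = 1"
  proof -
    \<comment> \<open>The identity is cut off outside the configurations because the kernels
      \<open>lop\<close> vanish there and the Casimir identity is to hold as an equation between
      functions.\<close>
    let ?K = "\<lambda>\<sigma> \<tau>. if \<sigma> \<in> ?I \<and> \<tau> \<in> ?I \<and> \<sigma> = \<tau> then 1 else 0 :: complex"
    have "tr ?I (mm ?I ?K (boltz \<beta> e)) = tr ?I (boltz \<beta> e)"
    proof (rule tr_cong)
      fix \<sigma> assume "\<sigma> \<in> ?I"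
      have "mm ?I ?K (boltz \<beta> e) \<sigma> \<sigma> = (\<Sum>\<rho>\<in>?I. if \<rho> = \<sigma> then boltz \<beta> e \<rho> \<sigma> else 0)"
        unfolding mm_def using \<open>\<sigma> \<in> ?I\<close> by (intro sum.cong refl) auto
      thus "mm ?I ?K (boltz \<beta> e) \<sigma> \<sigma> = boltz \<beta> e \<sigma> \<sigma>" using \<open>\<sigma> \<in> ?I\<close> finI by simp
    qed
    also have "\<dots> = of_real Z" by (simp add: boltz_def tr_spec Z_def)
    finally show ?thesis using Zpos unfolding gexp_eq by simp
  qed
  show "(cmod (gexp n L B \<beta> (comm ?I X Y)))\<^sup>2 \<le> \<beta> * Re (gexp n L B \<beta> (mm ?I Y Y)) *
           Re (gexp n L B \<beta> (- comm ?I X (comm ?I X (Hop n L B))))"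
  proof -
    have "(cmod (tr ?I (mm ?I (comm ?I X Y) (boltz \<beta> e))))\<^sup>2 \<le>
           \<beta> * Re (tr ?I (mm ?I (mm ?I Y Y) (boltz \<beta> e))) *
           Re (tr ?I (mm ?I (- comm ?I X (comm ?I X (Hop n L B))) (boltz \<beta> e)))"
      by (rule bogoliubov_inequality[OF spec_eigen Y X \<beta>]) (use eig in auto)
    thus ?thesis using Zpos unfolding Re_gexp gexp_eq
      by (simp add: norm_divide power_divide field_simps power2_eq_square)
  qed
qed

definition casimir :: "nat \<Rightarrow> real" where
  "casimir n = real n / 2 * (real n / 2 + 1)"

text \<open>The three squares add up to the Casimir multiple of the identity, and the expectation of
  the square of component 1 is nonnegative. Bounding the sum, not each term, saves a factor 2
  later.\<close>

lemma gexp_T_square_bound: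
  fixes x :: "'d::finite site"
  assumes "\<beta> \<ge> 0" "x \<in> box L"
  shows "Re (gexp n L B \<beta> (mm (conf n (box L)) (T n L 2 x) (T n L 2 x)))
     + Re (gexp n L B \<beta> (mm (conf n (box L)) (T n L 3 x) (T n L 3 x))) \<le> casimir n"
proof -
  let ?I = "conf n (box L :: 'd site set)"
  let ?one = "\<lambda>\<sigma> \<tau>. if \<sigma> \<in> ?I \<and> \<tau> \<in> ?I \<and> \<sigma> = \<tau> then 1 else 0 :: complex"
  let ?m = "\<lambda>i. mm ?I (T n L i x) (T n L i x)"
  have "?m 1 + ?m 2 + ?m 3 = scl (of_real (casimir n)) ?one"
  proof (intro ext)
    fix \<sigma> \<tau> :: "'d cfg"
    have m: "?m i \<sigma> \<tau> = lop n (box L) x (lmul n (spin_comp n i) (spin_comp n i)) \<sigma> \<tau>" for i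
      unfolding T_def mm_lop_same[OF finite_box assms(2)] ..
    show "(?m 1 + ?m 2 + ?m 3) \<sigma> \<tau> = scl (of_real (casimir n)) ?one \<sigma> \<tau>"
    proof (cases "\<sigma> \<in> ?I \<and> \<tau> \<in> ?I")
      case False
      thus ?thesis by (auto simp: m lop_def scl_def)
    next
      case True
      have le: "\<sigma> x \<le> n" "\<tau> x \<le> n" using True by (auto intro: conf_le)
      have eq: "(\<forall>z\<in>box L. z \<noteq> x \<longrightarrow> \<sigma> z = \<tau> z) \<and> \<sigma> x = \<tau> x \<longleftrightarrow> \<sigma> = \<tau>"
        using True conf_eqI[of \<sigma> n "box L" \<tau>] by metis
      have "(?m 1 + ?m 2 + ?m 3) \<sigma> \<tau> = (lmul n (spin1 n) (spin1 n) (\<sigma> x) (\<tau> x)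
          + lmul n (spin2 n) (spin2 n) (\<sigma> x) (\<tau> x) + lmul n (spin3 n) (spin3 n) (\<sigma> x) (\<tau> x))
          * (if \<forall>z\<in>box L. z \<noteq> x \<longrightarrow> \<sigma> z = \<tau> z then 1 else 0)"
        using True by (simp add: m lop_def site_op_def spin_comp_def)
      also have "\<dots> = (if \<sigma> x = \<tau> x then of_real (casimir n) else 0) * (if \<forall>z\<in>box L. z \<noteq> x \<longrightarrow> \<sigma> z = \<tau> z then 1 else 0)"
        unfolding lmul_casimir[OF le] casimir_def ..
      also have "\<dots> = (if \<sigma> = \<tau> then of_real (casimir n) else 0)"
        using eq by auto
      finally show ?thesis using True by (simp add: scl_def)
    qed
  qed
  hence "gexp n L B \<beta> (?m 1 + ?m 2 + ?m 3) = of_real (casimir n)"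
    using gexp_one[OF assms(1) herm_T[of n L 1 x] herm_T[of n L 1 x], of B] by (simp add: gexp_scl)
  hence "Re (gexp n L B \<beta> (?m 1)) + Re (gexp n L B \<beta> (?m 2)) + Re (gexp n L B \<beta> (?m 3)) = casimir n"
    unfolding gexp_add by (metis Re_complex_of_real plus_complex.sel(1))
  thus ?thesis using gexp_square_nonneg[OF assms(1) herm_T herm_T] by (smt (verit))
qed


section \<open>Local observables, one- and two-point functions\<close>

lemma ext_site_op:
  assumes "x \<in> \<Gamma>" "\<Gamma> \<subseteq> \<Lambda>"
  shows "ext \<Gamma> \<Lambda> (site_op n \<Gamma> x M) \<sigma> \<tau> = site_op n \<Lambda> x M \<sigma> \<tau>"
  using assms by (auto simp: ext_def site_op_def restr_def)

lemma restr_conf: "\<sigma> \<in> conf n \<Lambda> \<Longrightarrow> restr \<sigma> \<Gamma> \<in> conf n \<Gamma>"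
  by (auto simp: conf_def restr_def)

text \<open>The diagonal \<open>x = y\<close> is included because the double sum over the block
  contains it; there \<open>{x, y}\<close> is a singleton and the product is taken at a single
  site.\<close>

lemma ext_S2S2:
  assumes x: "x \<in> \<Lambda>" and y: "y \<in> \<Lambda>" and fin: "finite \<Lambda>" and \<sigma>: "\<sigma> \<in> conf n \<Lambda>" and \<tau>: "\<tau> \<in> conf n \<Lambda>"
  shows "ext {x, y} \<Lambda> (S2S2 n x y) \<sigma> \<tau> = kmul n \<Lambda> (site_op n \<Lambda> x (spin2 n)) (site_op n \<Lambda> y (spin2 n)) \<sigma> \<tau>"
proof -
  let ?\<Gamma> = "{x, y}"
  have r: "restr \<sigma> ?\<Gamma> \<in> conf n ?\<Gamma>" "restr \<tau> ?\<Gamma> \<in> conf n ?\<Gamma>" using restr_conf \<sigma> \<tau> by auto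
  show ?thesis
  proof (cases "x = y")
    case True
    have "ext ?\<Gamma> \<Lambda> (S2S2 n x y) \<sigma> \<tau> = ext ?\<Gamma> \<Lambda> (site_op n ?\<Gamma> x (lmul n (spin2 n) (spin2 n))) \<sigma> \<tau>"
      using True r kmul_site_op_same[OF _ _ r, of x "spin2 n" "spin2 n"] by (simp add: ext_def S2S2_def)
    also have "\<dots> = site_op n \<Lambda> x (lmul n (spin2 n) (spin2 n)) \<sigma> \<tau>"
      using x y by (intro ext_site_op) auto
    finally show ?thesis using kmul_site_op_same[OF fin x \<sigma> \<tau>] True by simp
  next
    case False
    show ?thesis
      using kmul_site_op_diff[OF _ _ _ False r, of "spin2 n" "spin2 n"] kmul_site_op_diff[OF fin x y False \<sigma> \<tau>, of "spin2 n" "spin2 n"]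
      by (auto simp: ext_def S2S2_def restr_def)
  qed
qed

definition gS :: "nat \<Rightarrow> nat \<Rightarrow> real \<Rightarrow> real \<Rightarrow> 'd::finite site \<Rightarrow> complex" where
  "gS n L B \<beta> x = gibbs n L B \<beta> {x} (site_op n {x} x (spin3 n))"

definition gC :: "nat \<Rightarrow> nat \<Rightarrow> real \<Rightarrow> real \<Rightarrow> 'd::finite site \<Rightarrow> 'd site \<Rightarrow> complex" where
  "gC n L B \<beta> x y = gibbs n L B \<beta> {x, y} (S2S2 n x y)"

lemma gS_gexp: "x \<in> box L \<Longrightarrow> gS n L B \<beta> x = gexp n L B \<beta> (T n L 3 x)"
  unfolding gS_def by (rule gibbs_eq_gexp) (simp add: ext_site_op T_def lop_def spin_comp_def)

lemma gC_gexp: "x \<in> box L \<Longrightarrow> y \<in> box L \<Longrightarrow>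
    gC n L B \<beta> x y = gexp n L B \<beta> (mm (conf n (box L)) (T n L 2 x) (T n L 2 y))"
  unfolding gC_def by (rule gibbs_eq_gexp) (simp add: ext_S2S2 finite_box T_def mm_lop spin_comp_def)

lemma gibbs_stag_mag:
  assumes "box 1 \<subseteq> (box L :: 'd::finite site set)"
  shows "gibbs n L B \<beta> (box 1 :: 'd site set) (stag_mag n (box 1)) = (\<Sum>x\<in>(box 1 :: 'd site set). stag x * gS n L B \<beta> x)"
proof -
  have "gibbs n L B \<beta> (box 1 :: 'd site set) (stag_mag n (box 1)) = gexp n L B \<beta> (\<Sum>x\<in>(box 1 :: 'd site set). scl (stag x) (T n L 3 x))"
  proof (rule gibbs_eq_gexp)
    fix \<sigma> \<tau> assume st: "\<sigma> \<in> conf n (box L :: 'd site set)" "\<tau> \<in> conf n (box L :: 'd site set)"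
    have "ext (box 1) (box L) (stag_mag n (box 1)) \<sigma> \<tau>
        = (\<Sum>x\<in>box 1. stag x * ext (box 1) (box L) (site_op n (box 1) x (spin3 n)) \<sigma> \<tau>)"
      by (simp add: ext_def stag_mag_def sum_distrib_right)
    also have "\<dots> = (\<Sum>x\<in>box 1. stag x * site_op n (box L) x (spin3 n) \<sigma> \<tau>)"
      by (intro sum.cong refl) (use assms in \<open>simp only: ext_site_op\<close>)
    finally show "ext (box 1) (box L) (stag_mag n (box 1)) \<sigma> \<tau> = (\<Sum>x\<in>box 1. scl (stag x) (T n L 3 x)) \<sigma> \<tau>"
      using st by (simp add: sum_fun2_apply scl_def T_def lop_def spin_comp_def)
  qed
  thus ?thesis unfolding gexp_sum gexp_scl using assms by (auto simp: gS_gexp intro!: sum.cong)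
qed

text \<open>The bound depends neither on \<open>L\<close> nor on \<open>B\<close>, so it survives
  both limits.\<close>

lemma norm_gC_le:
  fixes x y :: "'d::finite site"
  assumes \<beta>: "\<beta> \<ge> 0" and x: "x \<in> box L" and y: "y \<in> box L"
  shows "cmod (gC n L B \<beta> x y) \<le> casimir n"
  using gexp_product_norm_le[OF \<beta> herm_T herm_T, of n L B 2 x 2 y]
    gexp_T_square_bound[OF \<beta> x, of n B] gexp_T_square_bound[OF \<beta> y, of n B]
    gexp_square_nonneg[OF \<beta> herm_T[of n L 3 x] herm_T[of n L 3 x], of B]
    gexp_square_nonneg[OF \<beta> herm_T[of n L 3 y] herm_T[of n L 3 y], of B]
  unfolding gC_gexp[OF x y] by argo

text \<open>A bond expectation is bounded by the Casimir value, which leaves the Dirichlet sum of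
  \<open>f\<close> for the exchange part. The field part is carried along as an expectation, to be
  removed in the limit \<open>B \<rightarrow> 0\<close>. Only one- and two-site observables remain,
  so the terms can be followed into the limits.\<close>

theorem finite_volume_bound:
  fixes V :: "'d::finite site set" and f :: "'d site \<Rightarrow> real"
  assumes \<beta>: "\<beta> \<ge> 0" and V: "V \<subseteq> box L" and f1: "\<And>x. x \<in> V \<Longrightarrow> f x = 1"
  shows "(cmod (\<Sum>x\<in>V. gS n L B \<beta> x))\<^sup>2 \<le> \<beta> * cmod (\<Sum>x\<in>V. \<Sum>y\<in>V. gC n L B \<beta> x y) *
     (casimir n / 2 * (\<Sum>x\<in>box L. \<Sum>y\<in>{y\<in>box L. pnb L x y}. (f x - f y)\<^sup>2)
       + \<bar>B\<bar> * cmod (\<Sum>x\<in>box L. stag x * of_real ((f x)\<^sup>2) * gS n L B \<beta> x))"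
proof -
  let ?I = "conf n (box L :: 'd site set)"
  let ?g = "gexp n L B \<beta> :: 'd kernel \<Rightarrow> complex"
  define C where "C = Cop n L f"
  define A where "A = (\<Sum>x\<in>V. T n L 2 x)"
  have hC: "herm ?I C" unfolding C_def Cop_def by (intro herm_sum herm_scl herm_T)
  have hA: "herm ?I A" unfolding A_def by (intro herm_sum herm_T)
  \<comment> \<open>Spins at different sites commute, and \<open>f = 1\<close> on \<open>V\<close>
    makes the cutoff invisible here.\<close>
  have "comm ?I C A = (\<Sum>x\<in>V. scl \<i> (T n L 3 x))"
    unfolding A_def comm_sum_right C_def
    by (intro sum.cong refl, subst comm_Cop_T(2)) (use V f1 in auto)
  hence "?g (comm ?I C A) = \<i> * (\<Sum>x\<in>V. gS n L B \<beta> x)"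
    unfolding sum_distrib_left using V by (auto simp: gexp_sum gexp_scl gS_gexp intro!: sum.cong)
  hence lhs: "cmod (?g (comm ?I C A)) = cmod (\<Sum>x\<in>V. gS n L B \<beta> x)" by (simp add: norm_mult)
  have "?g (mm ?I A A) = (\<Sum>x\<in>V. \<Sum>y\<in>V. gC n L B \<beta> y x)"
    unfolding A_def mm_sum_left mm_sum_right gexp_sum
    by (intro sum.cong refl) (use V in \<open>auto simp: gC_gexp subset_iff\<close>)
  hence AA: "?g (mm ?I A A) = (\<Sum>x\<in>V. \<Sum>y\<in>V. gC n L B \<beta> x y)"
    by (subst sum.swap)
  have AA0: "Re (?g (mm ?I A A)) \<ge> 0" by (rule gexp_square_nonneg[OF \<beta> hA hA])
  have AAle: "Re (?g (mm ?I A A)) \<le> cmod (\<Sum>x\<in>V. \<Sum>y\<in>V. gC n L B \<beta> x y)"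
    unfolding AA[symmetric] by (rule complex_Re_le_cmod)
  let ?h = "\<lambda>x y. mm ?I (T n L 2 x) (T n L 2 y) + mm ?I (T n L 3 x) (T n L 3 y)"
  \<comment> \<open>The two products are added before the Casimir bound is applied at
    \<open>x\<close> and at \<open>y\<close>, each with weight 1/2; this gives
    \<open>casimir n\<close> instead of twice that.\<close>
  have h: "- Re (?g (?h x y)) \<le> casimir n" if "x \<in> box L" "y \<in> box L" for x y
    using gexp_product_norm_le[OF \<beta> herm_T herm_T, of n L B 2 x 2 y] gexp_product_norm_le[OF \<beta> herm_T herm_T, of n L B 3 x 3 y]
      abs_le_D2[OF abs_Re_le_cmod, of "?g (mm ?I (T n L 2 x) (T n L 2 y))"]
      abs_le_D2[OF abs_Re_le_cmod, of "?g (mm ?I (T n L 3 x) (T n L 3 y))"]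
      gexp_T_square_bound[OF \<beta> that(1), of n B] gexp_T_square_bound[OF \<beta> that(2), of n B]
    unfolding gexp_add plus_complex.sel by argo
  define D where "D = - comm ?I C (comm ?I C (Hop n L B))"
  have "?g D = - 1/2 * (\<Sum>x\<in>box L. \<Sum>y\<in>{y\<in>box L. pnb L x y}. of_real ((f x - f y)\<^sup>2) * ?g (?h x y))
     + of_real B * (\<Sum>x\<in>box L. stag x * of_real ((f x)\<^sup>2) * gS n L B \<beta> x)"
    unfolding D_def C_def double_comm_Hop gexp_add[of _ _ _ _ "scl _ _"] gexp_scl gexp_sum
    by (simp add: gS_gexp mult.assoc)
  hence "Re (?g D) = 1/2 * (\<Sum>x\<in>box L. \<Sum>y\<in>{y\<in>box L. pnb L x y}. (f x - f y)\<^sup>2 * - Re (?g (?h x y)))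
     + B * Re (\<Sum>x\<in>box L. stag x * of_real ((f x)\<^sup>2) * gS n L B \<beta> x)"
    by (simp add: sum_negf sum_divide_distrib)
  also have "\<dots> \<le> 1/2 * (\<Sum>x\<in>box L. \<Sum>y\<in>{y\<in>box L. pnb L x y}. (f x - f y)\<^sup>2 * casimir n)
     + B * Re (\<Sum>x\<in>box L. stag x * of_real ((f x)\<^sup>2) * gS n L B \<beta> x)"
    by (intro add_mono mult_left_mono sum_mono h order_refl) auto
  also have "\<dots> = casimir n / 2 * (\<Sum>x\<in>box L. \<Sum>y\<in>{y\<in>box L. pnb L x y}. (f x - f y)\<^sup>2)
       + B * Re (\<Sum>x\<in>box L. stag x * of_real ((f x)\<^sup>2) * gS n L B \<beta> x)"
    by (simp add: sum_distrib_left mult_ac)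
  also have "\<dots> \<le> casimir n / 2 * (\<Sum>x\<in>box L. \<Sum>y\<in>{y\<in>box L. pnb L x y}. (f x - f y)\<^sup>2)
       + \<bar>B\<bar> * cmod (\<Sum>x\<in>box L. stag x * of_real ((f x)\<^sup>2) * gS n L B \<beta> x)" (is "_ \<le> ?R")
  proof (intro add_left_mono)
    show "B * Re z \<le> \<bar>B\<bar> * cmod z" for z
      by (rule order_trans[OF abs_ge_self]) (simp add: abs_mult mult_left_mono abs_Re_le_cmod)
  qed
  finally have DR: "Re (?g D) \<le> ?R" .
  have bog: "(cmod (\<Sum>x\<in>V. gS n L B \<beta> x))\<^sup>2 \<le> \<beta> * Re (?g (mm ?I A A)) * Re (?g D)"
    unfolding lhs[symmetric] D_def by (rule gexp_bogoliubov[OF \<beta> hC hA])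
  have "?R \<ge> 0"
    by (intro add_nonneg_nonneg mult_nonneg_nonneg sum_nonneg) (auto simp: casimir_def)
  have "\<beta> * Re (?g (mm ?I A A)) * Re (?g D) \<le> \<beta> * Re (?g (mm ?I A A)) * ?R"
    using \<beta> AA0 DR by (intro mult_left_mono) auto
  also have "\<dots> \<le> \<beta> * cmod (\<Sum>x\<in>V. \<Sum>y\<in>V. gC n L B \<beta> x y) * ?R"
    using \<beta> AAle \<open>?R \<ge> 0\<close> by (intro mult_right_mono mult_left_mono) auto
  finally show ?thesis using bog by linarith
qed

section \<open>Translation invariance\<close>

text \<open>A permutation of the torus that preserves bonds and the sublattice sign leaves the
  Hamiltonian invariant, and with it the Gibbs state. The instances used are translations by even
  vectors.\<close>

locale box_symmetry =
  fixes L :: nat and \<pi> \<pi>' :: "'d::finite site \<Rightarrow> 'd site"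
  assumes \<pi>: "x \<in> box L \<Longrightarrow> \<pi> x \<in> box L" and \<pi>': "x \<in> box L \<Longrightarrow> \<pi>' x \<in> box L"
    and \<pi>\<pi>': "x \<in> box L \<Longrightarrow> \<pi> (\<pi>' x) = x" and \<pi>'\<pi>: "x \<in> box L \<Longrightarrow> \<pi>' (\<pi> x) = x"
    and pnb_\<pi>: "x \<in> box L \<Longrightarrow> y \<in> box L \<Longrightarrow> pnb L (\<pi> x) (\<pi> y) = pnb L x y"
    and stag_\<pi>: "x \<in> box L \<Longrightarrow> stag (\<pi> x) = stag x"
begin

text \<open>The inverse acts on the argument, so the value of \<open>\<sigma>\<close> at
  \<open>x\<close> is found at \<open>\<pi> x\<close>. The value 0 off the box keeps the result a
  configuration.\<close>

definition P :: "'d cfg \<Rightarrow> 'd cfg" where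
  "P \<sigma> = (\<lambda>z. if z \<in> box L then \<sigma> (\<pi>' z) else 0)"

lemma bij_P: "bij_betw P (conf n (box L)) (conf n (box L))"
proof (rule bij_betw_byWitness[where f' = "\<lambda>\<sigma> z. if z \<in> box L then \<sigma> (\<pi> z) else 0"])
  show "\<forall>\<sigma>\<in>conf n (box L). (\<lambda>z. if z \<in> box L then P \<sigma> (\<pi> z) else 0) = \<sigma>"
    by (auto simp: conf_def P_def fun_eq_iff \<pi> \<pi>'\<pi>)
  show "\<forall>\<sigma>\<in>conf n (box L). P (\<lambda>z. if z \<in> box L then \<sigma> (\<pi> z) else 0) = \<sigma>"
    by (auto simp: conf_def P_def fun_eq_iff \<pi>' \<pi>\<pi>')
qed (auto simp: conf_def P_def \<pi> \<pi>')

lemma bij_\<pi>: "bij_betw \<pi> (box L) (box L)"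
  by (rule bij_betw_byWitness[where f' = \<pi>']) (auto simp: \<pi> \<pi>' \<pi>\<pi>' \<pi>'\<pi>)

lemma bij_\<pi>_nbr: 
  assumes x: "x \<in> box L"
  shows "bij_betw \<pi> {y \<in> box L. pnb L x y} {y \<in> box L. pnb L (\<pi> x) y}"
proof (rule bij_betw_byWitness[where f' = \<pi>'])
  show "\<pi>' ` {y \<in> box L. pnb L (\<pi> x) y} \<subseteq> {y \<in> box L. pnb L x y}"
  proof
    fix z assume "z \<in> \<pi>' ` {y \<in> box L. pnb L (\<pi> x) y}"
    then obtain y where y: "z = \<pi>' y" "y \<in> box L" "pnb L (\<pi> x) y" by auto
    have "pnb L x z" using pnb_\<pi>[OF x, of z] y by (simp add: \<pi>' \<pi>\<pi>')
    thus "z \<in> {y \<in> box L. pnb L x y}" using y by (simp add: \<pi>')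
  qed
qed (auto simp: \<pi> \<pi>' \<pi>\<pi>' \<pi>'\<pi> pnb_\<pi>[OF x])

lemma site_op_P:
  assumes x: "x \<in> box L"
  shows "site_op n (box L) (\<pi> x) M (P \<sigma>) (P \<tau>) = site_op n (box L) x M \<sigma> \<tau>"
proof -
  have "(\<forall>z\<in>box L. z \<noteq> \<pi> x \<longrightarrow> \<sigma> (\<pi>' z) = \<tau> (\<pi>' z)) \<longleftrightarrow> (\<forall>z\<in>box L. z \<noteq> x \<longrightarrow> \<sigma> z = \<tau> z)"
    using x by (metis \<pi> \<pi>' \<pi>\<pi>' \<pi>'\<pi>)
  thus ?thesis using x by (simp add: site_op_def P_def \<pi> \<pi>'\<pi>)
qed

lemma kmul_P:
  "kmul n (box L) A B (P \<sigma>) (P \<tau>) = kmul n (box L) (\<lambda>\<sigma> \<tau>. A (P \<sigma>) (P \<tau>)) (\<lambda>\<sigma> \<tau>. B (P \<sigma>) (P \<tau>)) \<sigma> \<tau>"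
  unfolding kmul_def by (rule sum.reindex_bij_betw[OF bij_P, symmetric])

lemma ham_P: "ham n L B (P \<sigma>) (P \<tau>) = ham n L B \<sigma> \<tau>"
proof -
  define h where "h x y \<sigma> \<tau> = (\<Sum>i\<in>{1,2,3::nat}.
        kmul n (box L) (site_op n (box L) x (spin_comp n i)) (site_op n (box L) y (spin_comp n i)) \<sigma> \<tau>)" for x y :: "'d site" and \<sigma> \<tau>
  have h: "h (\<pi> x) (\<pi> y) (P \<sigma>) (P \<tau>) = h x y \<sigma> \<tau>" if "x \<in> box L" "y \<in> box L" for x y
    unfolding h_def kmul_P site_op_P[OF that(1)] site_op_P[OF that(2)] ..
  have "(\<Sum>x\<in>box L. \<Sum>y\<in>{y\<in>box L. pnb L x y}. h x y (P \<sigma>) (P \<tau>))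
      = (\<Sum>x\<in>box L. \<Sum>y\<in>{y\<in>box L. pnb L (\<pi> x) y}. h (\<pi> x) y (P \<sigma>) (P \<tau>))"
    by (rule sum.reindex_bij_betw[OF bij_\<pi>, symmetric])
  also have "\<dots> = (\<Sum>x\<in>box L. \<Sum>y\<in>{y\<in>box L. pnb L x y}. h (\<pi> x) (\<pi> y) (P \<sigma>) (P \<tau>))"
    by (intro sum.cong refl sum.reindex_bij_betw[OF bij_\<pi>_nbr, symmetric])
  also have "\<dots> = (\<Sum>x\<in>box L. \<Sum>y\<in>{y\<in>box L. pnb L x y}. h x y \<sigma> \<tau>)"
    by (intro sum.cong refl h) auto
  finally have 1: "(\<Sum>x\<in>box L. \<Sum>y\<in>{y\<in>box L. pnb L x y}. h x y (P \<sigma>) (P \<tau>))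
      = (\<Sum>x\<in>box L. \<Sum>y\<in>{y\<in>box L. pnb L x y}. h x y \<sigma> \<tau>)" .
  have "stag_mag n (box L) (P \<sigma>) (P \<tau>) = (\<Sum>x\<in>box L. stag (\<pi> x) * site_op n (box L) (\<pi> x) (spin3 n) (P \<sigma>) (P \<tau>))"
    unfolding stag_mag_def by (rule sum.reindex_bij_betw[OF bij_\<pi>, symmetric])
  also have "\<dots> = stag_mag n (box L) \<sigma> \<tau>"
    unfolding stag_mag_def by (intro sum.cong refl) (simp add: stag_\<pi> site_op_P)
  finally show ?thesis
    using 1 unfolding ham_def h_def by simp
qed

lemma P_inj: "\<sigma> \<in> conf n (box L) \<Longrightarrow> \<tau> \<in> conf n (box L) \<Longrightarrow> P \<sigma> = P \<tau> \<longleftrightarrow> \<sigma> = \<tau>"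
  using bij_P[of n] by (auto simp: bij_betw_def inj_on_eq_iff)

text \<open>Powers are invariant by induction. The case \<open>k = 0\<close> compares configurations
  for equality and uses that \<open>P\<close> is injective on them.\<close>

lemma kexp_P:
  assumes A: "\<And>\<sigma> \<tau>. A (P \<sigma>) (P \<tau>) = A \<sigma> \<tau>" and "\<sigma> \<in> conf n (box L)" "\<tau> \<in> conf n (box L)"
  shows "kexp n (box L) A (P \<sigma>) (P \<tau>) = kexp n (box L) A \<sigma> \<tau>"
proof -
  have "kpow n (box L) A k (P \<sigma>) (P \<tau>) = kpow n (box L) A k \<sigma> \<tau>" if "\<sigma> \<in> conf n (box L)" for k \<sigma>
    using that
  proof (induction k arbitrary: \<sigma>)
    case 0
    thus ?case using assms by (simp add: kpow_def kid_def P_inj)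
  next
    case (Suc k)
    have "kpow n (box L) A (Suc k) (P \<sigma>) (P \<tau>) = kmul n (box L) A (kpow n (box L) A k) (P \<sigma>) (P \<tau>)"
      by (simp add: kpow_def)
    also have "\<dots> = kmul n (box L) A (kpow n (box L) A k) \<sigma> \<tau>"
      unfolding kmul_P A by (simp add: kmul_def Suc.IH)
    finally show ?case by (simp add: kpow_def)
  qed
  thus ?thesis using assms by (simp add: kexp_def)
qed

lemma gexp_P: "gexp n L B \<beta> X = gexp n L B \<beta> (\<lambda>\<sigma> \<tau>. X (P \<sigma>) (P \<tau>))"
proof -
  let ?I = "conf n (box L)"
  let ?E = "kexp n (box L) (\<lambda>\<sigma> \<tau>. - complex_of_real \<beta> * ham n L B \<sigma> \<tau>)"
  have E: "?E (P \<sigma>) (P \<tau>) = ?E \<sigma> \<tau>" if "\<sigma> \<in> ?I" "\<tau> \<in> ?I" for \<sigma> \<tau>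
    by (rule kexp_P[OF _ that]) (simp add: ham_P)
  have "tr ?I (mm ?I X ?E) = (\<Sum>\<sigma>\<in>?I. mm ?I X ?E (P \<sigma>) (P \<sigma>))"
    unfolding tr_def by (rule sum.reindex_bij_betw[OF bij_P, symmetric])
  also have "\<dots> = tr ?I (mm ?I (\<lambda>\<sigma> \<tau>. X (P \<sigma>) (P \<tau>)) ?E)"
    unfolding tr_def kmul_eq_mm[symmetric] kmul_P
    unfolding kmul_def by (intro sum.cong refl arg_cong2[where f = "(*)"] E)
  finally show ?thesis unfolding gexp_def Let_def by simp
qed

lemma gS_\<pi>:
  assumes x: "x \<in> box L"
  shows "gS n L B \<beta> (\<pi> x) = gS n L B \<beta> x"
proof -
  have "gS n L B \<beta> (\<pi> x) = gexp n L B \<beta> (\<lambda>\<sigma> \<tau>. T n L 3 (\<pi> x) (P \<sigma>) (P \<tau>))"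
    using gS_gexp[OF \<pi>[OF x]] gexp_P by simp
  also have "\<dots> = gexp n L B \<beta> (T n L 3 x)"
    unfolding gexp_def Let_def
  proof (intro arg_cong2[where f = "(/)"] tr_cong mm_cong refl)
 fix \<sigma> \<tau> :: "'d cfg" assume st: "\<sigma> \<in> conf n (box L)" "\<tau> \<in> conf n (box L)"
    hence "P \<sigma> \<in> conf n (box L)" "P \<tau> \<in> conf n (box L)" using bij_P[of n] by (auto simp: bij_betw_def)
    thus "T n L 3 (\<pi> x) (P \<sigma>) (P \<tau>) = T n L 3 x \<sigma> \<tau>"
      using st by (simp add: T_def lop_def site_op_P[OF x])
  qed
  finally show ?thesis by (simp add: gS_gexp x)
qed

end

text \<open>The representative of \<open>a\<close> modulo \<open>2L\<close> in the range of the box: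
  the offset \<open>L - 1\<close> aligns the residues \<open>0..2L-1\<close> with
  \<open>-L+1..L\<close>.\<close>

definition wrap :: "nat \<Rightarrow> int \<Rightarrow> int" where
  "wrap L a = (a + int L - 1) mod (2 * int L) - int L + 1"

definition shift :: "nat \<Rightarrow> 'd::finite site \<Rightarrow> 'd site \<Rightarrow> 'd site" where
  "shift L v x = (\<chi> i. wrap L (x $ i + v $ i))"

lemma wrap_range: "L \<ge> 1 \<Longrightarrow> - int L + 1 \<le> wrap L a \<and> wrap L a \<le> int L"
proof -
  assume "L \<ge> 1"
  hence "0 < 2 * int L" by simp
  from pos_mod_bound[OF this, of "a + int L - 1"] pos_mod_sign[OF this, of "a + int L - 1"]
  show ?thesis unfolding wrap_def by linarith
qed

lemma wrap_mod: "\<exists>k. wrap L a = a + k * (2 * int L)"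
proof -
  have "wrap L a = a + (- ((a + int L - 1) div (2 * int L))) * (2 * int L)"
    unfolding wrap_def using mult_div_mod_eq[of "2 * int L" "a + int L - 1"] by (simp add: algebra_simps)
  thus ?thesis by blast
qed

lemma wrap_periodic: "wrap L (a + k * (2 * int L)) = wrap L a"
proof -
  have "a + k * (2 * int L) + int L - 1 = (a + int L - 1) + k * (2 * int L)" by simp
  thus ?thesis unfolding wrap_def by (simp only: mod_mult_self1)
qed

lemma wrap_id: "- int L + 1 \<le> a \<Longrightarrow> a \<le> int L \<Longrightarrow> wrap L a = a"
  by (simp add: wrap_def)

lemma shift_box: "L \<ge> 1 \<Longrightarrow> shift L v x \<in> box L"
  unfolding shift_def Defs.box_def mem_Collect_eq vec_lambda_beta using wrap_range by blast

lemma shift_shift: "x \<in> box L \<Longrightarrow> shift L (- v) (shift L v x) = x"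
proof -
  assume x: "x \<in> box L"
  have "wrap L (wrap L (x $ i + v $ i) - v $ i) = x $ i" for i
  proof -
    obtain k where k: "wrap L (x $ i + v $ i) = x $ i + v $ i + k * (2 * int L)" using wrap_mod by blast
    have "wrap L (wrap L (x $ i + v $ i) - v $ i) = wrap L (x $ i + k * (2 * int L))" by (simp add: k)
    also have "\<dots> = x $ i" unfolding wrap_periodic using x by (intro wrap_id) (auto simp: Defs.box_def)
    finally show ?thesis .
  qed
  thus ?thesis by (simp add: shift_def vec_eq_iff)
qed

lemma shift_component_eq:
  assumes "x \<in> box L" "y \<in> box L"
  shows "shift L v x $ j = shift L v y $ j \<longleftrightarrow> x $ j = y $ j"
proof
  assume "shift L v x $ j = shift L v y $ j"
  hence "shift L (- v) (shift L v x) $ j = shift L (- v) (shift L v y) $ j"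
    by (simp add: shift_def)
  thus "x $ j = y $ j" using assms by (simp add: shift_shift)
qed (simp add: shift_def)

lemma shift_diff_mod: "(shift L v x $ i - shift L v y $ i) mod (2 * int L) = (x $ i - y $ i) mod (2 * int L)"
proof -
  obtain k l where "wrap L (x $ i + v $ i) = x $ i + v $ i + k * (2 * int L)"
    "wrap L (y $ i + v $ i) = y $ i + v $ i + l * (2 * int L)" using wrap_mod by metis
  hence "shift L v x $ i - shift L v y $ i = (x $ i - y $ i) + (k - l) * (2 * int L)"
    by (simp add: shift_def algebra_simps)
  thus ?thesis by (simp only: mod_mult_self1)
qed

lemma pnb_shift:
  assumes "x \<in> box L" "y \<in> box L"
  shows "pnb L (shift L v x) (shift L v y) = pnb L x y"
  unfolding pnb_def shift_component_eq[OF assms] shift_diff_mod ..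

text \<open>Wrapping changes a coordinate by a multiple of the even side length \<open>2L\<close>,
  so the sublattice sign is compatible with the periodic boundary.\<close>

lemma stag_shift:
  assumes "\<And>i. even (v $ i)"
  shows "stag (shift L v x) = stag x"
proof -
  have "even ((\<Sum>i\<in>UNIV. shift L v x $ i) - (\<Sum>i\<in>UNIV. x $ i))"
    unfolding sum_subtractf[symmetric]
  proof (rule dvd_sum)
    fix i
    obtain k where "wrap L (x $ i + v $ i) = x $ i + v $ i + k * (2 * int L)" using wrap_mod by blast
    thus "even (shift L v x $ i - x $ i)" using assms[of i] by (simp add: shift_def)
  qed
  thus ?thesis by (auto simp: stag_def)
qed

text \<open>Periodic boundary conditions make this an exact identity at finite \<open>L\<close>. The
  shift by \<open>y - x\<close> sends \<open>x\<close> to \<open>y\<close> with no wrapping.\<close>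

theorem gS_even_translate:
  fixes x y :: "'d::finite site"
  assumes L: "L \<ge> 1" and x: "x \<in> box L" and y: "y \<in> box L" and ev: "\<And>i. even (y $ i - x $ i)"
  shows "gS n L B \<beta> y = gS n L B \<beta> x"
proof -
  have *: "shift L v (shift L (- v) z) = z" if "z \<in> box L" for v z :: "'d site"
    using shift_shift[OF that, of "- v"] by simp
  interpret box_symmetry L "shift L (y - x)" "shift L (- (y - x))"
    by unfold_locales (use L ev in \<open>auto simp: shift_box * shift_shift pnb_shift stag_shift simp del: minus_diff_eq\<close>)
  have "shift L (y - x) x = y"
    using y by (auto simp: shift_def vec_eq_iff Defs.box_def intro!: wrap_id)
  thus ?thesis using gS_\<pi>[OF x] by metis
qed

section \<open>Lattice sums and the cutoff function\<close>

lemma sum_prod_vec: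
  fixes g :: "'d::finite \<Rightarrow> int \<Rightarrow> real"
  assumes "\<And>i. finite (A i)"
  shows "(\<Sum>x\<in>{x :: int^'d. \<forall>i. x $ i \<in> A i}. \<Prod>i\<in>UNIV. g i (x $ i)) = (\<Prod>i\<in>UNIV. \<Sum>a\<in>A i. g i a)"
proof -
  have "(\<Prod>i\<in>UNIV. \<Sum>a\<in>A i. g i a) = (\<Sum>h\<in>PiE UNIV A. \<Prod>i\<in>UNIV. g i (h i))"
    by (rule prod_sum_PiE) (use assms in auto)
  also have "\<dots> = (\<Sum>x\<in>{x :: int^'d. \<forall>i. x $ i \<in> A i}. \<Prod>i\<in>UNIV. g i (x $ i))"
    by (rule sum.reindex_bij_witness[where i = vec_nth and j = vec_lambda]) auto
  finally show ?thesis ..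
qed

lemma card_vec_set:
  assumes "\<And>i. finite (A i)"
  shows "card {x :: int^'d::finite. \<forall>i. x $ i \<in> A i} = (\<Prod>i\<in>UNIV. card (A i))"
proof -
  have "real (card {x :: int^'d. \<forall>i. x $ i \<in> A i}) = real (\<Prod>i\<in>UNIV. card (A i))"
    using sum_prod_vec[OF assms, of "\<lambda>_ _. 1"] by simp
  thus ?thesis by (simp only: of_nat_eq_iff)
qed

lemma site_dist_eq: "site_dist x y = norm ((\<chi> i. real_of_int (x $ i)) - (\<chi> i. real_of_int (y $ i)))"
  unfolding site_dist_def by (rule arg_cong[where f = norm]) (simp add: vec_eq_iff)

lemma abs_component_le_site_dist: "\<bar>real_of_int (x $ i - y $ i)\<bar> \<le> site_dist x y"
  unfolding site_dist_def using component_le_norm_cart[of "\<chi> i. real_of_int (x $ i - y $ i)" i] by simp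

lemma site_dist_le_l1: "site_dist x y \<le> (\<Sum>i\<in>UNIV. \<bar>real_of_int (x $ i - y $ i)\<bar>)"
  unfolding site_dist_def using norm_le_l1_cart[of "\<chi> i. real_of_int (x $ i - y $ i)"] by simp

lemma site_dist_nonneg: "site_dist x y \<ge> 0"
  by (simp add: site_dist_def)

text \<open>Comparison with the integral of \<open>t powr (s - 1)\<close>: by the mean value theorem
  each term is at most an increment of \<open>t powr s / s\<close>, since the integrand is
  nonincreasing for \<open>s \<le> 1\<close>.\<close>

lemma sum_powr_le:
  fixes s :: real
  assumes s: "0 < s" "s \<le> 1"
  shows "(\<Sum>j<N. (1 + real j) powr (s - 1)) \<le> real N powr s / s"
proof (induction N)
  case 0
  show ?case using s by simp
next
  case (Suc N)
  have "real N powr s / s + (1 + real N) powr (s - 1) \<le> (1 + real N) powr s / s"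
  proof (cases "N = 0")
    case True
    thus ?thesis using s by simp
  next
    case False
    have "\<exists>z. real N < z \<and> z < 1 + real N \<and> (1 + real N) powr s - real N powr s = (1 + real N - real N) * (s * z powr (s - 1))"
      by (rule MVT2) (use False in \<open>auto intro!: derivative_eq_intros\<close>)
    then obtain z where z: "real N < z" "z < 1 + real N"
      "(1 + real N) powr s - real N powr s = s * z powr (s - 1)" by auto
    have "z powr (s - 1) \<ge> (1 + real N) powr (s - 1)"
      using z s False by (intro powr_mono2') auto
    hence "s * z powr (s - 1) \<ge> s * (1 + real N) powr (s - 1)" using s by (intro mult_left_mono) auto
    hence "real N powr s + s * (1 + real N) powr (s - 1) \<le> (1 + real N) powr s" using z(3) by linarith
    hence "(real N powr s + s * (1 + real N) powr (s - 1)) / s \<le> (1 + real N) powr s / s"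
      using s by (intro divide_right_mono) auto
    thus ?thesis using s by (simp add: add_divide_distrib)
  qed
  with Suc show ?case by (simp add: add.commute)
qed

text \<open>Each distance from \<open>x\<close> occurs at most once to the left of \<open>x\<close>
  and at most once to the right.\<close>

lemma sum_abs_diff_le:
  fixes h :: "nat \<Rightarrow> real"
  assumes h: "\<And>j. h j \<ge> 0" and x: "x \<in> {0..<int N}"
  shows "(\<Sum>b\<in>{0..<int N}. h (nat \<bar>x - b\<bar>)) \<le> 2 * (\<Sum>j<N. h j)"
proof -
  have half: "(\<Sum>b\<in>S. h (nat \<bar>x - b\<bar>)) \<le> (\<Sum>j<N. h j)"
    if "S \<subseteq> {0..<int N}" "inj_on (\<lambda>b. nat \<bar>x - b\<bar>) S" for S
  proof -
    have "(\<Sum>b\<in>S. h (nat \<bar>x - b\<bar>)) = (\<Sum>j\<in>(\<lambda>b. nat \<bar>x - b\<bar>) ` S. h j)"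
      by (simp add: sum.reindex[OF that(2)])
    also have "\<dots> \<le> (\<Sum>j<N. h j)"
      using that(1) x h by (intro sum_mono2) (auto simp: subset_iff nat_less_iff)
    finally show ?thesis .
  qed
  have "{0..<int N} = {0..<x} \<union> {x..<int N}" using x by auto
  hence "(\<Sum>b\<in>{0..<int N}. h (nat \<bar>x - b\<bar>)) = (\<Sum>b\<in>{0..<x}. h (nat \<bar>x - b\<bar>)) + (\<Sum>b\<in>{x..<int N}. h (nat \<bar>x - b\<bar>))"
    by (simp add: sum.union_disjoint)
  also have "\<dots> \<le> (\<Sum>j<N. h j) + (\<Sum>j<N. h j)"
    using x by (intro add_mono half) (auto simp: inj_on_def)
  finally show ?thesis by simp
qed

text \<open>By AM--GM in the crude form \<open>(1 + |z|)^d \<ge> \<Prod> (1 + |z\<^sub>i|)\<close> the sum over the cube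
  factorizes into one-dimensional sums.\<close>
lemma lattice_sum_le:
  fixes x :: "int^'d::finite"
  assumes d: "CARD('d) \<ge> 3" and N: "N \<ge> 1" and x: "\<forall>i. x $ i \<in> {0..<int N}"
  shows "(\<Sum>y\<in>{y. \<forall>i. y $ i \<in> {0..<int N}}. 1 / (1 + site_dist x y) ^ (CARD('d) - 2))
            \<le> real CARD('d) ^ CARD('d) * (real N)\<^sup>2"
proof -
  let ?d = "CARD('d)"
  \<comment> \<open>Chosen so that the exponent \<open>d - 2\<close> splits evenly over the d
    coordinates, \<open>(1 - s) d = d - 2\<close>. Each one-dimensional sum is then of order
    \<open>N powr (2/d)\<close>, and their product of order \<open>N^2\<close>.\<close>
  define s where "s = 2 / real ?d"
  have s: "0 < s" "s \<le> 1" using d by (auto simp: s_def)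
  have sd: "(1 - s) * real ?d = real (?d - 2)" using d by (simp add: s_def field_simps of_nat_diff)
  have factor: "1 / (1 + site_dist x y) ^ (?d - 2) \<le> (\<Prod>i\<in>UNIV. (1 + real (nat \<bar>x $ i - y $ i\<bar>)) powr (s - 1))" for y
  proof -
    have pos: "1 + site_dist x y > 0" using site_dist_nonneg[of x y] by linarith
    have "1 / (1 + site_dist x y) ^ (?d - 2) = (1 + site_dist x y) powr (- real (?d - 2))"
      using pos by (simp add: powr_minus powr_realpow divide_inverse)
    also have "\<dots> = ((1 + site_dist x y) powr (s - 1)) powr real ?d"
      by (simp add: powr_powr sd[symmetric] algebra_simps)
    also have "\<dots> = (\<Prod>i\<in>(UNIV :: 'd set). (1 + site_dist x y) powr (s - 1))"
      using pos by (simp add: powr_realpow)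
    also have "\<dots> \<le> (\<Prod>i\<in>UNIV. (1 + real (nat \<bar>x $ i - y $ i\<bar>)) powr (s - 1))"
      using s abs_component_le_site_dist[of x _ y] by (intro prod_mono conjI powr_mono2') auto
    finally show ?thesis .
  qed
  have "(\<Sum>y\<in>{y. \<forall>i. y $ i \<in> {0..<int N}}. 1 / (1 + site_dist x y) ^ (?d - 2))
     \<le> (\<Sum>y\<in>{y. \<forall>i. y $ i \<in> {0..<int N}}. \<Prod>i\<in>UNIV. (1 + real (nat \<bar>x $ i - y $ i\<bar>)) powr (s - 1))"
    by (intro sum_mono factor)
  also have "\<dots> = (\<Prod>i\<in>UNIV. \<Sum>b\<in>{0..<int N}. (1 + real (nat \<bar>x $ i - b\<bar>)) powr (s - 1))"
    by (rule sum_prod_vec) simp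
  also have "\<dots> \<le> (\<Prod>i\<in>(UNIV :: 'd set). real ?d * real N powr s)"
  proof (intro prod_mono conjI sum_nonneg)
    fix i
    have "(\<Sum>b\<in>{0..<int N}. (1 + real (nat \<bar>x $ i - b\<bar>)) powr (s - 1)) \<le> 2 * (\<Sum>j<N. (1 + real j) powr (s - 1))"
      using x by (intro sum_abs_diff_le) auto
    also have "\<dots> \<le> 2 * (real N powr s / s)" by (intro mult_left_mono sum_powr_le s) auto
    also have "\<dots> = real ?d * real N powr s" by (simp add: s_def)
    finally show "(\<Sum>b\<in>{0..<int N}. (1 + real (nat \<bar>x $ i - b\<bar>)) powr (s - 1)) \<le> real ?d * real N powr s" .
  qed auto
  also have "\<dots> = real ?d ^ ?d * (real N powr s) powr real ?d"
    using N by (simp add: power_mult_distrib powr_realpow)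
  also have "(real N powr s) powr real ?d = (real N)\<^sup>2"
    using N d by (simp add: powr_powr s_def powr_numeral)
  finally show ?thesis .
qed

section \<open>The cutoff and its Dirichlet sum\<close>

definition cutoff :: "real \<Rightarrow> 'd::finite site \<Rightarrow> real" where
  "cutoff R x = max 0 (min 1 (2 - site_dist x 0 / R))"

lemma cutoff_eq_1: "R > 0 \<Longrightarrow> site_dist x 0 \<le> R \<Longrightarrow> cutoff R x = 1"
  by (simp add: cutoff_def field_simps)

lemma cutoff_nonzeroD: "R > 0 \<Longrightarrow> cutoff R x \<noteq> 0 \<Longrightarrow> site_dist x 0 < 2 * R"
proof (rule ccontr)
  assume "R > 0" "cutoff R x \<noteq> 0" "\<not> site_dist x 0 < 2 * R"
  moreover from this have "2 \<le> site_dist x 0 / R" by (simp add: field_simps)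
  ultimately show False by (simp add: cutoff_def)
qed

lemma cutoff_lipschitz:
  assumes "R > 0"
  shows "\<bar>cutoff R x - cutoff R y\<bar> \<le> site_dist x y / R"
proof -
  have "\<bar>site_dist x 0 - site_dist y 0\<bar> \<le> site_dist x y"
    unfolding site_dist_eq by (metis (no_types, lifting) diff_diff_eq2 diff_add_cancel norm_triangle_ineq3 add_diff_cancel_right diff_diff_add add_diff_eq)
  hence "\<bar>site_dist x 0 / R - site_dist y 0 / R\<bar> \<le> site_dist x y / R"
    using assms by (simp add: abs_divide divide_right_mono flip: diff_divide_distrib)
  thus ?thesis unfolding cutoff_def by linarith
qed

text \<open>The cutoff is built from the distance in \<open>Z^d\<close>, which is not periodic, so
  bonds across the boundary of the box must be excluded. If one endpoint has coordinates at most
  \<open>2r\<close>, the coordinate difference is below \<open>2L - 1\<close>, and such a bond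
  cannot occur.\<close>

lemma pnb_no_wrap:
  fixes x y :: "'d::finite site"
  assumes x: "x \<in> box L" and y: "y \<in> box L" and nb: "pnb L x y" and r: "4 * r + 4 \<le> int L" "r \<ge> 0"
    and near: "(\<forall>i. \<bar>x $ i\<bar> \<le> 2 * r) \<or> (\<forall>i. \<bar>y $ i\<bar> \<le> 2 * r)"
  shows "(\<forall>i. \<bar>y $ i - x $ i\<bar> \<le> 1) \<and> site_dist x y \<le> 1"
proof -
  from nb obtain i where i: "\<forall>j. j \<noteq> i \<longrightarrow> x $ j = y $ j"
    and m: "(x $ i - y $ i) mod (2 * int L) \<in> {1, 2 * int L - 1}" unfolding pnb_def by blast
  define a where "a = x $ i - y $ i"
  have range: "- int L + 1 \<le> x $ i" "x $ i \<le> int L" "- int L + 1 \<le> y $ i" "y $ i \<le> int L"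
    using x y by (auto simp: Defs.box_def)
  have "\<bar>x $ i\<bar> \<le> 2 * r \<or> \<bar>y $ i\<bar> \<le> 2 * r" using near by blast
  hence a: "\<bar>a\<bar> < 2 * int L - 1" using range r unfolding a_def by linarith
  have "\<bar>a\<bar> = 1"
  proof (cases "a \<ge> 0")
    case True
    hence "a mod (2 * int L) = a" using a by (intro mod_pos_pos_trivial) auto
    thus ?thesis using m a True unfolding a_def[symmetric] by auto
  next
    case False
    \<comment> \<open>For negative \<open>a\<close> the residue is \<open>a + 2L\<close>: the value
      \<open>2L - 1\<close> means \<open>a = -1\<close>, and the value 1 is excluded by the range of
      \<open>a\<close>.\<close>
    have "a mod (2 * int L) = (a + 2 * int L) mod (2 * int L)" by simp
    also have "\<dots> = a + 2 * int L" using a False by (intro mod_pos_pos_trivial) auto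
    finally show ?thesis using m a False unfolding a_def[symmetric] by auto
  qed
  hence 1: "\<bar>x $ j - y $ j\<bar> = (if j = i then 1 else 0)" for j
    using i by (auto simp: a_def)
  have "site_dist x y \<le> (\<Sum>j\<in>UNIV. real_of_int \<bar>x $ j - y $ j\<bar>)"
    using site_dist_le_l1[of x y] by simp
  also have "\<dots> = (\<Sum>j\<in>UNIV. if j = i then 1 else 0)" by (intro sum.cong refl) (simp add: 1)
  also have "\<dots> = 1" by simp
  finally have "site_dist x y \<le> 1" .
  moreover have "\<bar>y $ j - x $ j\<bar> \<le> 1" for j using 1[of j] by (auto simp: abs_minus_commute split: if_splits)
  ultimately show ?thesis by blast
qed

text \<open>Only bonds along which the cutoff changes contribute, each at most \<open>1/r^2\<close>.
  Their first endpoints lie in a cube of \<open>(4r+3)^d\<close> sites, with at most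
  \<open>3^d\<close> partners each; 21 comes from \<open>3 (4r + 3) \<le> 21 r\<close>. The bound is
  uniform in \<open>L\<close>.\<close>

lemma gradient_sum_le:
  fixes r L :: nat
  assumes r: "r \<ge> 1" and L: "4 * r + 4 \<le> L"
  shows "(\<Sum>x\<in>(box L :: 'd::finite site set). \<Sum>y\<in>{y\<in>box L. pnb L x y}. (cutoff (real r) x - cutoff (real r) y)\<^sup>2)
     \<le> 21 ^ CARD('d) * real r ^ CARD('d) / (real r)\<^sup>2"
proof -
  let ?f = "cutoff (real r) :: 'd site \<Rightarrow> real"
  \<comment> \<open>The extra 1 admits bonds whose first endpoint lies just outside the support of
    the cutoff.\<close>
  define F where "F = {x :: 'd site. \<forall>i. x $ i \<in> {- (2 * int r + 1)..2 * int r + 1}}"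
  define Nb where "Nb x = {y :: 'd site. \<forall>i. y $ i \<in> {x $ i - 1..x $ i + 1}}" for x
  have supp: "\<forall>i. \<bar>x $ i\<bar> \<le> 2 * int r" if "?f x \<noteq> 0" for x
  proof
    fix i
    have "site_dist x 0 < 2 * real r" using cutoff_nonzeroD[OF _ that] r by simp
    hence "\<bar>real_of_int (x $ i)\<bar> < 2 * real r" using abs_component_le_site_dist[of x i 0] by simp
    thus "\<bar>x $ i\<bar> \<le> 2 * int r" by linarith
  qed
  have key: "x \<in> F \<and> y \<in> Nb x \<and> (?f x - ?f y)\<^sup>2 \<le> 1 / (real r)\<^sup>2"
    if xy: "x \<in> box L" "y \<in> box L" "pnb L x y" "?f x \<noteq> ?f y" for x y
  proof -
    have near: "(\<forall>i. \<bar>x $ i\<bar> \<le> 2 * int r) \<or> (\<forall>i. \<bar>y $ i\<bar> \<le> 2 * int r)"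
    proof (cases "?f x = 0")
      case True
      hence "?f y \<noteq> 0" using xy by simp
      thus ?thesis using supp by blast
    qed (use supp in blast)
    from pnb_no_wrap[OF xy(1-3) _ _ near] L have n: "\<forall>i. \<bar>y $ i - x $ i\<bar> \<le> 1" "site_dist x y \<le> 1" by auto
    have "x \<in> F"
      unfolding F_def mem_Collect_eq
    proof
      fix i
      have "\<bar>x $ i\<bar> \<le> 2 * int r \<or> \<bar>y $ i\<bar> \<le> 2 * int r" "\<bar>y $ i - x $ i\<bar> \<le> 1" using near n by auto
      thus "x $ i \<in> {- (2 * int r + 1)..2 * int r + 1}" by auto
    qed
    moreover have "y \<in> Nb x"
      unfolding Nb_def mem_Collect_eq
    proof
      fix i
      have "\<bar>y $ i - x $ i\<bar> \<le> 1" using n by auto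
      thus "y $ i \<in> {x $ i - 1..x $ i + 1}" by auto
    qed
    moreover have "\<bar>?f x - ?f y\<bar> \<le> 1 / real r"
      using cutoff_lipschitz[of "real r" x y] r divide_right_mono[OF n(2), of "real r"] by simp
    hence "\<bar>?f x - ?f y\<bar>\<^sup>2 \<le> (1 / real r)\<^sup>2" by (intro power_mono) auto
    ultimately show ?thesis by (simp add: power_divide)
  qed
  have finF: "finite F" unfolding F_def by (rule finite_vec_set) simp
  have finN: "finite (Nb x)" for x unfolding Nb_def by (rule finite_vec_set) simp
  have "(\<Sum>x\<in>box L. \<Sum>y\<in>{y\<in>box L. pnb L x y}. (?f x - ?f y)\<^sup>2)
      = (\<Sum>p\<in>(SIGMA x:box L. {y\<in>box L. pnb L x y}). (?f (fst p) - ?f (snd p))\<^sup>2)"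
    by (subst sum.Sigma) (auto simp: finite_box case_prod_beta)
  also have "\<dots> = (\<Sum>p\<in>{p\<in>(SIGMA x:box L. {y\<in>box L. pnb L x y}). ?f (fst p) \<noteq> ?f (snd p)}. (?f (fst p) - ?f (snd p))\<^sup>2)"
    by (rule sum.mono_neutral_right) (auto intro!: finite_SigmaI simp: finite_box)
  also have "\<dots> \<le> (\<Sum>p\<in>{p\<in>(SIGMA x:box L. {y\<in>box L. pnb L x y}). ?f (fst p) \<noteq> ?f (snd p)}. 1 / (real r)\<^sup>2)"
    by (rule sum_mono) (use key in auto)
  also have "\<dots> \<le> (\<Sum>p\<in>(SIGMA x:F. Nb x). 1 / (real r)\<^sup>2)"
    by (rule sum_mono2) (use key finF finN in \<open>auto intro!: finite_SigmaI\<close>)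
  also have "\<dots> = real (card (SIGMA x:F. Nb x)) / (real r)\<^sup>2" by simp
  also have "card (SIGMA x:F. Nb x) = (4 * r + 3) ^ CARD('d) * 3 ^ CARD('d)"
  proof -
    have "card (Nb x) = 3 ^ CARD('d)" for x
      unfolding Nb_def by (subst card_vec_set) auto
    moreover have "card F = (4 * r + 3) ^ CARD('d)"
    proof -
      have "nat (2 * int r + 1 - (- (2 * int r + 1)) + 1) = 4 * r + 3" by simp
      thus ?thesis unfolding F_def by (subst card_vec_set) auto
    qed
    ultimately show ?thesis using finF finN by (simp add: card_SigmaI)
  qed
  also have "real ((4 * r + 3) ^ CARD('d) * 3 ^ CARD('d)) / (real r)\<^sup>2 \<le> 21 ^ CARD('d) * real r ^ CARD('d) / (real r)\<^sup>2"
  proof (rule divide_right_mono)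
    have "real ((4 * r + 3) ^ CARD('d) * 3 ^ CARD('d)) = (3 * (4 * real r + 3)) ^ CARD('d)"
      by (simp add: algebra_simps flip: power_mult_distrib)
    also have "\<dots> \<le> (21 * real r) ^ CARD('d)" using r by (intro power_mono) auto
    finally show "real ((4 * r + 3) ^ CARD('d) * 3 ^ CARD('d)) \<le> 21 ^ CARD('d) * real r ^ CARD('d)"
      by (simp add: power_mult_distrib)
  qed simp
  finally show ?thesis .
qed

section \<open>The infinite-volume and zero-field limits\<close>

lemma eventually_subset_box:
  fixes F :: "'d::finite site set"
  assumes "finite F"
  shows "eventually (\<lambda>L. F \<subseteq> box L) sequentially"
proof -
  have "eventually (\<lambda>L. x \<in> box L) sequentially" for x :: "'d site"
  proof -
    have "x \<in> box L" if "L \<ge> nat (\<Sum>i\<in>UNIV. \<bar>x $ i\<bar>) + 1" for L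
    proof -
      have "\<bar>x $ i\<bar> \<le> (\<Sum>i\<in>UNIV. \<bar>x $ i\<bar>)" for i by (rule member_le_sum) auto
      moreover have "(\<Sum>i\<in>UNIV. \<bar>x $ i\<bar>) + 1 \<le> int L" using that by linarith
      ultimately have "\<bar>x $ i\<bar> + 1 \<le> int L" for i by (metis add_le_cancel_right order_trans)
      hence "- int L + 1 \<le> x $ i \<and> x $ i \<le> int L" for i by (smt (verit))
      thus ?thesis by (simp add: Defs.box_def)
    qed
    thus ?thesis unfolding eventually_sequentially by blast
  qed
  hence "eventually (\<lambda>L. \<forall>x\<in>F. x \<in> box L) sequentially"
    using assms by (intro eventually_ball_finite) auto
  thus ?thesis by (simp add: subset_iff Ball_def)
qed

text \<open>In finite volume the field term runs over the whole box, but \<open>f\<close> vanishes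
  off the fixed set \<open>F\<close>. For large \<open>L\<close> it is therefore a finite sum of
  local expectations and converges; the Dirichlet sum is replaced by its uniform bound.\<close>

lemma thermodynamic_limit_bound:
  fixes rhoB :: "('d::finite) site set \<Rightarrow> 'd kernel \<Rightarrow> complex" and f :: "'d site \<Rightarrow> real"
  assumes \<beta>: "\<beta> \<ge> 0" and Ls: "strict_mono Ls"
    and lim: "\<And>\<Gamma> A. finite \<Gamma> \<Longrightarrow> (\<lambda>k. gibbs n (Ls k) B \<beta> \<Gamma> A) \<longlonglongrightarrow> rhoB \<Gamma> A"
    and V: "finite V" "\<And>x. x \<in> V \<Longrightarrow> f x = 1"
    and F: "finite F" "\<And>x. f x \<noteq> 0 \<Longrightarrow> x \<in> F"
    and K: "eventually (\<lambda>L. (\<Sum>x\<in>box L. \<Sum>y\<in>{y\<in>box L. pnb L x y}. (f x - f y)\<^sup>2) \<le> K) sequentially"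
  shows "(cmod (\<Sum>x\<in>V. rhoB {x} (site_op n {x} x (spin3 n))))\<^sup>2 \<le>
     \<beta> * cmod (\<Sum>x\<in>V. \<Sum>y\<in>V. rhoB {x, y} (S2S2 n x y)) *
     (casimir n / 2 * K + \<bar>B\<bar> * cmod (\<Sum>x\<in>F. stag x * of_real ((f x)\<^sup>2) * rhoB {x} (site_op n {x} x (spin3 n))))"
proof -
  have S: "(\<lambda>k. gS n (Ls k) B \<beta> x) \<longlonglongrightarrow> rhoB {x} (site_op n {x} x (spin3 n))" for x
    unfolding gS_def by (rule lim) simp
  have C: "(\<lambda>k. gC n (Ls k) B \<beta> x y) \<longlonglongrightarrow> rhoB {x, y} (S2S2 n x y)" for x y
    unfolding gC_def by (rule lim) simp
  have "eventually (\<lambda>L. (cmod (\<Sum>x\<in>V. gS n L B \<beta> x))\<^sup>2 \<le> \<beta> * cmod (\<Sum>x\<in>V. \<Sum>y\<in>V. gC n L B \<beta> x y) *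
     (casimir n / 2 * K + \<bar>B\<bar> * cmod (\<Sum>x\<in>F. stag x * of_real ((f x)\<^sup>2) * gS n L B \<beta> x))) sequentially"
    using K eventually_subset_box[OF V(1)] eventually_subset_box[OF F(1)]
  proof eventually_elim
    case (elim L)
    have eq: "(\<Sum>x\<in>box L. stag x * of_real ((f x)\<^sup>2) * gS n L B \<beta> x) = (\<Sum>x\<in>F. stag x * of_real ((f x)\<^sup>2) * gS n L B \<beta> x)"
      by (rule sum.mono_neutral_right[OF finite_box]) (use elim F in auto)
    have mono: "\<beta> * cmod (\<Sum>x\<in>V. \<Sum>y\<in>V. gC n L B \<beta> x y) *
     (casimir n / 2 * (\<Sum>x\<in>box L. \<Sum>y\<in>{y\<in>box L. pnb L x y}. (f x - f y)\<^sup>2) + X)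
       \<le> \<beta> * cmod (\<Sum>x\<in>V. \<Sum>y\<in>V. gC n L B \<beta> x y) * (casimir n / 2 * K + X)" for X
      using \<beta> elim(1) by (intro mult_left_mono add_right_mono mult_nonneg_nonneg) (auto simp: casimir_def)
    show ?case
      using finite_volume_bound[where f = f and n = n and B = B, OF \<beta> elim(2) V(2)] unfolding eq
      by (rule order_trans[OF _ mono])
  qed
  hence ev: "eventually (\<lambda>k. (cmod (\<Sum>x\<in>V. gS n (Ls k) B \<beta> x))\<^sup>2 \<le> \<beta> * cmod (\<Sum>x\<in>V. \<Sum>y\<in>V. gC n (Ls k) B \<beta> x y) *
     (casimir n / 2 * K + \<bar>B\<bar> * cmod (\<Sum>x\<in>F. stag x * of_real ((f x)\<^sup>2) * gS n (Ls k) B \<beta> x))) sequentially"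
    using eventually_compose_filterlim filterlim_subseq[OF Ls] by blast
  show ?thesis
    by (rule tendsto_le[OF sequentially_bot _ _ ev]) (intro tendsto_intros S C)+
qed

text \<open>The field sum over the fixed finite set \<open>F\<close> converges along
  \<open>Bs\<close>, so its product with the vanishing field tends to 0. For this \<open>V\<close>
  and \<open>f\<close> must stay fixed while the field is switched off.\<close>

lemma limit_bound:
  fixes rhoB :: "real \<Rightarrow> ('d::finite) site set \<Rightarrow> 'd kernel \<Rightarrow> complex"
    and rho0 :: "'d site set \<Rightarrow> 'd kernel \<Rightarrow> complex" and f :: "'d site \<Rightarrow> real"
  assumes \<beta>: "\<beta> \<ge> 0"
    and rhoB_lim: "\<forall>B>0. \<exists>Ls :: nat \<Rightarrow> nat. strict_mono Ls \<and>
        (\<forall>\<Gamma> A. finite \<Gamma> \<longrightarrow> (\<lambda>k. gibbs n (Ls k) B \<beta> \<Gamma> A) \<longlonglongrightarrow> rhoB B \<Gamma> A)"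
    and Bs_pos: "\<forall>k. Bs k > 0" and Bs_lim: "Bs \<longlonglongrightarrow> 0"
    and rho0_lim: "\<forall>\<Gamma> A. finite \<Gamma> \<longrightarrow> (\<lambda>k. rhoB (Bs k) \<Gamma> A) \<longlonglongrightarrow> rho0 \<Gamma> A"
    and V: "finite V" "\<And>x. x \<in> V \<Longrightarrow> f x = 1"
    and F: "finite F" "\<And>x. f x \<noteq> 0 \<Longrightarrow> x \<in> F"
    and K: "eventually (\<lambda>L. (\<Sum>x\<in>box L. \<Sum>y\<in>{y\<in>box L. pnb L x y}. (f x - f y)\<^sup>2) \<le> K) sequentially"
  shows "(cmod (\<Sum>x\<in>V. rho0 {x} (site_op n {x} x (spin3 n))))\<^sup>2 \<le>
     \<beta> * cmod (\<Sum>x\<in>V. \<Sum>y\<in>V. rho0 {x, y} (S2S2 n x y)) * (casimir n / 2 * K)"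
proof -
  have "(cmod (\<Sum>x\<in>V. rhoB (Bs k) {x} (site_op n {x} x (spin3 n))))\<^sup>2 \<le>
     \<beta> * cmod (\<Sum>x\<in>V. \<Sum>y\<in>V. rhoB (Bs k) {x, y} (S2S2 n x y)) *
     (casimir n / 2 * K + \<bar>Bs k\<bar> * cmod (\<Sum>x\<in>F. stag x * of_real ((f x)\<^sup>2) * rhoB (Bs k) {x} (site_op n {x} x (spin3 n))))" for k
  proof -
    obtain Ls where Ls: "strict_mono Ls"
      "\<And>\<Gamma> A. finite \<Gamma> \<Longrightarrow> (\<lambda>j. gibbs n (Ls j) (Bs k) \<beta> \<Gamma> A) \<longlonglongrightarrow> rhoB (Bs k) \<Gamma> A"
      using rhoB_lim Bs_pos by blast
    show ?thesis by (rule thermodynamic_limit_bound[OF \<beta> Ls V F K])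
  qed
  hence ev: "eventually (\<lambda>k. (cmod (\<Sum>x\<in>V. rhoB (Bs k) {x} (site_op n {x} x (spin3 n))))\<^sup>2 \<le>
     \<beta> * cmod (\<Sum>x\<in>V. \<Sum>y\<in>V. rhoB (Bs k) {x, y} (S2S2 n x y)) *
     (casimir n / 2 * K + \<bar>Bs k\<bar> * cmod (\<Sum>x\<in>F. stag x * of_real ((f x)\<^sup>2) * rhoB (Bs k) {x} (site_op n {x} x (spin3 n))))) sequentially"
    by simp
  have r: "(\<lambda>k. rhoB (Bs k) {x} A) \<longlonglongrightarrow> rho0 {x} A" "(\<lambda>k. rhoB (Bs k) {x, y} A) \<longlonglongrightarrow> rho0 {x, y} A" for x y A
    using rho0_lim by auto
  have "(cmod (\<Sum>x\<in>V. rho0 {x} (site_op n {x} x (spin3 n))))\<^sup>2 \<le>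
     \<beta> * cmod (\<Sum>x\<in>V. \<Sum>y\<in>V. rho0 {x, y} (S2S2 n x y)) *
     (casimir n / 2 * K + \<bar>0\<bar> * cmod (\<Sum>x\<in>F. stag x * of_real ((f x)\<^sup>2) * rho0 {x} (site_op n {x} x (spin3 n))))"
    by (rule tendsto_le[OF sequentially_bot _ _ ev]) (intro tendsto_intros r Bs_lim)+
  thus ?thesis by simp
qed

lemma limit_norm_S2S2_le:
  fixes rhoB :: "real \<Rightarrow> ('d::finite) site set \<Rightarrow> 'd kernel \<Rightarrow> complex"
  assumes \<beta>: "\<beta> \<ge> 0"
    and rhoB_lim: "\<forall>B>0. \<exists>Ls :: nat \<Rightarrow> nat. strict_mono Ls \<and>
        (\<forall>\<Gamma> A. finite \<Gamma> \<longrightarrow> (\<lambda>k. gibbs n (Ls k) B \<beta> \<Gamma> A) \<longlonglongrightarrow> rhoB B \<Gamma> A)"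
    and B: "B > 0"
  shows "cmod (rhoB B {x, y} (S2S2 n x y)) \<le> casimir n"
proof -
  obtain Ls where Ls: "strict_mono Ls"
    "\<And>\<Gamma> A. finite \<Gamma> \<Longrightarrow> (\<lambda>j. gibbs n (Ls j) B \<beta> \<Gamma> A) \<longlonglongrightarrow> rhoB B \<Gamma> A"
    using rhoB_lim B by blast
  have "eventually (\<lambda>L. cmod (gC n L B \<beta> x y) \<le> casimir n) sequentially"
    by (rule eventually_mono[OF eventually_subset_box[of "{x, y}"]]) (auto intro!: norm_gC_le \<beta>)
  hence "eventually (\<lambda>k. cmod (gC n (Ls k) B \<beta> x y) \<le> casimir n) sequentially"
    using eventually_compose_filterlim filterlim_subseq[OF Ls(1)] by blast
  moreover have "(\<lambda>k. cmod (gC n (Ls k) B \<beta> x y)) \<longlonglongrightarrow> cmod (rhoB B {x, y} (S2S2 n x y))"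
    unfolding gC_def by (intro tendsto_norm Ls(2)) simp
  ultimately show ?thesis by (intro tendsto_upperbound[where F = sequentially]) auto
qed

text \<open>The finite-volume identity is exact for all large \<open>L\<close>, so it passes to the
  limit along whichever subsequence defines \<open>rhoB B\<close>.\<close>

lemma limit_even_translate:
  fixes rhoB :: "real \<Rightarrow> ('d::finite) site set \<Rightarrow> 'd kernel \<Rightarrow> complex"
  assumes rhoB_lim: "\<forall>B>0. \<exists>Ls :: nat \<Rightarrow> nat. strict_mono Ls \<and>
        (\<forall>\<Gamma> A. finite \<Gamma> \<longrightarrow> (\<lambda>k. gibbs n (Ls k) B \<beta> \<Gamma> A) \<longlonglongrightarrow> rhoB B \<Gamma> A)"
    and B: "B > 0" and ev: "\<And>i. even (y $ i - x $ i)"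
  shows "rhoB B {y} (site_op n {y} y (spin3 n)) = rhoB B {x} (site_op n {x} x (spin3 n))"
proof -
  obtain Ls where Ls: "strict_mono Ls"
    "\<And>\<Gamma> A. finite \<Gamma> \<Longrightarrow> (\<lambda>j. gibbs n (Ls j) B \<beta> \<Gamma> A) \<longlonglongrightarrow> rhoB B \<Gamma> A"
    using rhoB_lim B by blast
  have xy: "finite {x, y}" by simp
  have "eventually (\<lambda>L. gS n L B \<beta> y = gS n L B \<beta> x) sequentially"
    using eventually_subset_box[OF xy] eventually_ge_at_top[of 1]
    by eventually_elim (auto intro!: gS_even_translate ev)
  hence eq: "eventually (\<lambda>k. gS n (Ls k) B \<beta> y = gS n (Ls k) B \<beta> x) sequentially"
    using eventually_compose_filterlim filterlim_subseq[OF Ls(1)] by blast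
  have lim: "(\<lambda>k. gS n (Ls k) B \<beta> z) \<longlonglongrightarrow> rhoB B {z} (site_op n {z} z (spin3 n))" for z
    unfolding gS_def by (intro Ls(2)) simp
  show ?thesis
    by (rule LIMSEQ_unique[OF Lim_transform_eventually[OF lim eq] lim])
qed

lemma limit_stag_mag:
  fixes rhoB :: "real \<Rightarrow> ('d::finite) site set \<Rightarrow> 'd kernel \<Rightarrow> complex"
  assumes rhoB_lim: "\<forall>B>0. \<exists>Ls :: nat \<Rightarrow> nat. strict_mono Ls \<and>
        (\<forall>\<Gamma> A. finite \<Gamma> \<longrightarrow> (\<lambda>k. gibbs n (Ls k) B \<beta> \<Gamma> A) \<longlonglongrightarrow> rhoB B \<Gamma> A)"
    and B: "B > 0"
  shows "rhoB B (box 1) (stag_mag n (box 1)) = (\<Sum>x\<in>box 1. stag x * rhoB B {x} (site_op n {x} x (spin3 n)))"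
proof -
  obtain Ls where Ls: "strict_mono Ls"
    "\<And>\<Gamma> A. finite \<Gamma> \<Longrightarrow> (\<lambda>j. gibbs n (Ls j) B \<beta> \<Gamma> A) \<longlonglongrightarrow> rhoB B \<Gamma> A"
    using rhoB_lim B by blast
  have "eventually (\<lambda>L. gibbs n L B \<beta> (box 1 :: 'd site set) (stag_mag n (box 1)) = (\<Sum>x\<in>(box 1 :: 'd site set). stag x * gS n L B \<beta> x)) sequentially"
    using eventually_subset_box[OF finite_box[of 1]] by eventually_elim (rule gibbs_stag_mag)
  hence "eventually (\<lambda>k. gibbs n (Ls k) B \<beta> (box 1 :: 'd site set) (stag_mag n (box 1)) = (\<Sum>x\<in>(box 1 :: 'd site set). stag x * gS n (Ls k) B \<beta> x)) sequentially"
    using eventually_compose_filterlim filterlim_subseq[OF Ls(1)] by blast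
  moreover have "(\<lambda>k. gibbs n (Ls k) B \<beta> (box 1 :: 'd site set) (stag_mag n (box 1))) \<longlonglongrightarrow> rhoB B (box 1) (stag_mag n (box 1))"
    by (intro Ls(2) finite_box)
  ultimately have "(\<lambda>k. \<Sum>x\<in>(box 1 :: 'd site set). stag x * gS n (Ls k) B \<beta> x) \<longlonglongrightarrow> rhoB B (box 1) (stag_mag n (box 1))"
    by (rule Lim_transform_eventually[rotated])
  moreover have "(\<lambda>k. \<Sum>x\<in>(box 1 :: 'd site set). stag x * gS n (Ls k) B \<beta> x) \<longlonglongrightarrow>
      (\<Sum>x\<in>box 1. stag x * rhoB B {x} (site_op n {x} x (spin3 n)))"
    unfolding gS_def by (intro tendsto_intros Ls(2)) simp
  ultimately show ?thesis by (rule LIMSEQ_unique)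
qed

section \<open>Comparison of powers of the block size\<close>

theorem theorem2p5:
  fixes n :: nat and \<beta> :: real and m :: real
    and rhoB :: "real \<Rightarrow> ('d::finite) site set \<Rightarrow> 'd kernel \<Rightarrow> complex"
    and rho0 :: "'d site set \<Rightarrow> 'd kernel \<Rightarrow> complex"
    and Bs :: "nat \<Rightarrow> real"
  assumes d3: "CARD('d) \<ge> 3"
    and n_pos: "n \<ge> 1"
    and beta_pos: "\<beta> > 0"
    and rhoB_lim: "\<forall>B>0. \<exists>Ls :: nat \<Rightarrow> nat. strict_mono Ls \<and>
        (\<forall>\<Gamma> A. finite \<Gamma> \<longrightarrow> (\<lambda>k. gibbs n (Ls k) B \<beta> \<Gamma> A) \<longlonglongrightarrow> rhoB B \<Gamma> A)"
    and Bs_pos: "\<forall>k. Bs k > 0" and Bs_dec: "decseq Bs" and Bs_lim: "Bs \<longlonglongrightarrow> 0"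
    and rho0_lim: "\<forall>\<Gamma> A. finite \<Gamma> \<longrightarrow> (\<lambda>k. rhoB (Bs k) \<Gamma> A) \<longlonglongrightarrow> rho0 \<Gamma> A"
    and ms: "((\<lambda>B. rhoB B (box 1) (stag_mag n (box 1)) / of_nat (card (box 1 :: 'd site set)))
               \<longlongrightarrow> complex_of_real m) (at_right 0)"
    and ms_nz: "m \<noteq> 0"
  shows "\<not> (\<forall>\<epsilon>>0. \<exists>R. \<forall>x y :: 'd site. site_dist x y \<ge> R \<longrightarrow>
             site_dist x y ^ (CARD('d) - 2) * cmod (rho0 {x, y} (S2S2 n x y)) < \<epsilon>)"
proof
  assume decay: "\<forall>\<epsilon>>0. \<exists>R. \<forall>x y :: 'd site. site_dist x y \<ge> R \<longrightarrow>
             site_dist x y ^ (CARD('d) - 2) * cmod (rho0 {x, y} (S2S2 n x y)) < \<epsilon>"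
  let ?d = "CARD('d)"
  have \<beta>: "\<beta> \<ge> 0" using beta_pos by simp
  define S0 where "S0 x = rho0 {x} (site_op n {x} x (spin3 n))" for x
  define C0 where "C0 x y = rho0 {x, y} (S2S2 n x y)" for x y
  have C0_le: "cmod (C0 x y) \<le> casimir n" for x y
  proof -
    have "(\<lambda>k. cmod (rhoB (Bs k) {x, y} (S2S2 n x y))) \<longlonglongrightarrow> cmod (C0 x y)"
      unfolding C0_def using rho0_lim by (intro tendsto_norm) auto
    thus ?thesis
      by (rule tendsto_upperbound) (use limit_norm_S2S2_le[OF \<beta> rhoB_lim] Bs_pos in auto)
  qed
  have S_lim: "(\<lambda>k. rhoB (Bs k) {x} (site_op n {x} x (spin3 n))) \<longlonglongrightarrow> S0 x" for x
    unfolding S0_def using rho0_lim by auto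
  have S0_even: "S0 y = S0 x" if "\<And>i. even (y $ i - x $ i)" for x y
  proof (rule LIMSEQ_unique[OF S_lim])
    have "rhoB (Bs k) {y} (site_op n {y} y (spin3 n)) = rhoB (Bs k) {x} (site_op n {x} x (spin3 n))" for k
      by (rule limit_even_translate[OF rhoB_lim _ that]) (use Bs_pos in auto)
    thus "(\<lambda>k. rhoB (Bs k) {y} (site_op n {y} y (spin3 n))) \<longlonglongrightarrow> S0 x" using S_lim[of x] by simp
  qed
  \<comment> \<open>\<open>box 1\<close> is \<open>{0,1}^d\<close>, one representative of each class
    modulo 2. If the one-point function vanished on all of them, the order parameter would be
    zero.\<close>
  obtain c where c: "c \<in> box 1" "S0 c \<noteq> 0"
  proof (rule ccontr)
    assume "\<not> thesis"
    hence z: "S0 x = 0" if "x \<in> box 1" for x using that \<open>\<And>c. c \<in> box 1 \<Longrightarrow> S0 c \<noteq> 0 \<Longrightarrow> thesis\<close> by blast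
    have "filterlim Bs (at_right 0) sequentially"
      using Bs_lim Bs_pos by (intro filterlim_at_withinI) (auto intro: always_eventually)
    from filterlim_compose[OF ms this]
    have "(\<lambda>k. (\<Sum>x\<in>box 1. stag x * rhoB (Bs k) {x} (site_op n {x} x (spin3 n))) / of_nat (card (box 1 :: 'd site set)))
        \<longlonglongrightarrow> complex_of_real m"
      using limit_stag_mag[OF rhoB_lim] Bs_pos by simp
    moreover have "(\<lambda>k. (\<Sum>x\<in>box 1. stag x * rhoB (Bs k) {x} (site_op n {x} x (spin3 n))) / of_nat (card (box 1 :: 'd site set)))
        \<longlonglongrightarrow> (\<Sum>x\<in>box 1. stag x * S0 x) / of_nat (card (box 1 :: 'd site set))"
      by (cases "card (box 1 :: 'd site set) = 0") (auto intro!: tendsto_intros S_lim)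
    ultimately have "complex_of_real m = (\<Sum>x\<in>box 1. stag x * S0 x) / of_nat (card (box 1 :: 'd site set))"
      by (rule LIMSEQ_unique)
    thus False using z ms_nz by simp
  qed
  have cb: "c $ i = 0 \<or> c $ i = 1" for i
  proof -
    have "0 \<le> c $ i" "c $ i \<le> 1" using c(1) by (auto simp: Defs.box_def)
    thus ?thesis by linarith
  qed
  define a where "a = (cmod (S0 c))\<^sup>2"
  have a: "a > 0" using c by (simp add: a_def)
  \<comment> \<open>The sites congruent to \<open>c\<close> modulo 2 in the cube of side
    \<open>2k\<close>. By even translations the one-point function is constant on them, so
    \<open>k^d\<close> equal terms add up.\<close>
  define V where "V k = (\<lambda>v. \<chi> i. c $ i + 2 * v $ i) ` {v :: 'd site. \<forall>i. v $ i \<in> {0..<int k}}" for k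
  have inj: "inj (\<lambda>v :: 'd site. \<chi> i. c $ i + 2 * v $ i)"
    by (rule injI) (simp add: vec_eq_iff)
  have finV: "finite (V k)" for k unfolding V_def by (intro finite_imageI finite_vec_set) simp
  have cardV: "card (V k) = k ^ ?d" for k
    unfolding V_def card_image[OF inj_on_subset[OF inj subset_UNIV]] by (subst card_vec_set) auto
  have V_range: "\<forall>i. x $ i \<in> {0..<int (2 * k)}" if "x \<in> V k" for x k
  proof
    fix i
    from that obtain v where "x $ i = c $ i + 2 * v $ i" "v $ i \<in> {0..<int k}" unfolding V_def by auto
    thus "x $ i \<in> {0..<int (2 * k)}" using cb[of i] by auto
  qed
  have S0_V: "S0 x = S0 c" if "x \<in> V k" for x k
    by (rule S0_even) (use that in \<open>auto simp: V_def\<close>)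
  \<comment> \<open>Points of \<open>V k\<close> have coordinates in \<open>[0, 2k)\<close>, so
    their l1 norm is at most \<open>2dk\<close> and the cutoff at this radius is 1 on
    \<open>V k\<close>. With this radius the gradient bound becomes
    \<open>K * k^d / k^2\<close>.\<close>
  define r where "r k = 2 * ?d * k" for k
  define K where "K = 21 ^ ?d * (2 * real ?d) ^ (?d - 2)"
  have main: "real k ^ ?d * a \<le> \<beta> * (casimir n / 2 * K) * cmod (\<Sum>x\<in>V k. \<Sum>y\<in>V k. C0 x y) / (real k)\<^sup>2"
    if k: "k \<ge> 1" for k
  proof -
    have rk: "r k \<ge> 1" using k by (simp add: r_def Suc_le_eq)
    have "(cmod (\<Sum>x\<in>V k. S0 x))\<^sup>2 \<le> \<beta> * cmod (\<Sum>x\<in>V k. \<Sum>y\<in>V k. C0 x y) *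
        (casimir n / 2 * (21 ^ ?d * real (r k) ^ ?d / (real (r k))\<^sup>2))"
      unfolding S0_def C0_def
    proof (rule limit_bound[OF \<beta> rhoB_lim Bs_pos Bs_lim rho0_lim finV, where f = "cutoff (real (r k))"])
      fix x assume x: "x \<in> V k"
      have "site_dist x 0 \<le> (\<Sum>i\<in>UNIV. \<bar>real_of_int (x $ i - 0 $ i)\<bar>)" by (rule site_dist_le_l1)
      also have "\<dots> \<le> (\<Sum>i\<in>(UNIV :: 'd set). real (2 * k))"
      proof (rule sum_mono)
        fix i show "\<bar>real_of_int (x $ i - 0 $ i)\<bar> \<le> real (2 * k)"
          using V_range[OF x, rule_format, of i] by auto
      qed
      also have "\<dots> = real (r k)" by (simp add: r_def)
      finally show "cutoff (real (r k)) x = 1" using rk by (intro cutoff_eq_1) auto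
    next
      show "finite {x :: 'd site. \<forall>i. x $ i \<in> {- int (2 * r k)..int (2 * r k)}}" by (rule finite_vec_set) simp
      fix x :: "'d site" assume "cutoff (real (r k)) x \<noteq> 0"
      hence "site_dist x 0 < 2 * real (r k)" using rk by (intro cutoff_nonzeroD) auto
      hence "\<bar>real_of_int (x $ i)\<bar> \<le> real (2 * r k)" for i
        using abs_component_le_site_dist[of x i 0] by simp
      hence "\<bar>x $ i\<bar> \<le> int (2 * r k)" for i by (metis of_int_abs of_int_le_iff of_int_of_nat_eq)
      thus "x \<in> {x. \<forall>i. x $ i \<in> {- int (2 * r k)..int (2 * r k)}}" by (auto simp: abs_le_iff minus_le_iff)
    next
      show "eventually (\<lambda>L. (\<Sum>x\<in>box L. \<Sum>y\<in>{y\<in>box L. pnb L x y}. (cutoff (real (r k)) x - cutoff (real (r k)) (y :: 'd site))\<^sup>2)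
          \<le> 21 ^ ?d * real (r k) ^ ?d / (real (r k))\<^sup>2) sequentially"
        using eventually_ge_at_top[of "4 * r k + 4"] by eventually_elim (rule gradient_sum_le[OF rk])
    qed
    also have "(cmod (\<Sum>x\<in>V k. S0 x))\<^sup>2 = real k ^ ?d * (real k ^ ?d * a)"
      using S0_V[of _ k] by (simp add: cardV norm_mult norm_power power_mult_distrib a_def power2_eq_square)
    also have "21 ^ ?d * real (r k) ^ ?d / (real (r k))\<^sup>2 = K * real k ^ ?d / (real k)\<^sup>2"
    proof -
      have "real (r k) ^ ?d / (real (r k))\<^sup>2 = (2 * real ?d) ^ ?d / (2 * real ?d)\<^sup>2 * (real k ^ ?d / (real k)\<^sup>2)"
        by (simp add: r_def power_mult_distrib)
      also have "(2 * real ?d) ^ ?d / (2 * real ?d)\<^sup>2 = (2 * real ?d) ^ (?d - 2)"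
        using d3 by (subst power_diff) auto
      finally have eq: "real (r k) ^ ?d / (real (r k))\<^sup>2 = (2 * real ?d) ^ (?d - 2) * (real k ^ ?d / (real k)\<^sup>2)" .
      show ?thesis unfolding K_def times_divide_eq_right[symmetric] eq by (simp only: mult.assoc)
    qed
    finally have "real k ^ ?d * (real k ^ ?d * a) \<le> real k ^ ?d *
       (\<beta> * (casimir n / 2 * K) * cmod (\<Sum>x\<in>V k. \<Sum>y\<in>V k. C0 x y) / (real k)\<^sup>2)"
      by (simp add: mult_ac)
    thus ?thesis by (rule mult_left_le_imp_le) (use k in simp)
  qed
  define D where "D = \<beta> * (casimir n / 2 * K)"
  have D: "D \<ge> 0" unfolding D_def K_def casimir_def using \<beta> by (intro mult_nonneg_nonneg) auto
  \<comment> \<open>The lattice sum over the cube of side \<open>2k\<close> is at most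
    \<open>d^d (2k)^2 = M * k^2\<close>.\<close>
  define M where "M = 4 * real ?d ^ ?d"
  have M: "M > 0" by (simp add: M_def)
  \<comment> \<open>Makes the far contribution \<open>D * \<epsilon> * 2^(d-2) * M\<close> at most
    \<open>a/2\<close>; \<open>D + 1\<close> keeps the denominator positive.\<close>
  define \<epsilon> where "\<epsilon> = a / (2 * (D + 1) * M * 2 ^ (?d - 2))"
  have \<epsilon>: "\<epsilon> > 0" using a D M by (simp add: \<epsilon>_def)
  from decay \<epsilon> obtain R where R: "\<And>x y :: 'd site. site_dist x y \<ge> R \<Longrightarrow>
             site_dist x y ^ (?d - 2) * cmod (C0 x y) < \<epsilon>" unfolding C0_def by meson
  \<comment> \<open>Being at least \<open>R\<close>, \<open>q\<close> gives the assumed decay; being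
    at least 1, it allows \<open>1 + t \<le> 2t\<close> at distances
    \<open>t \<ge> q\<close>.\<close>
  define q where "q = nat \<lceil>max R 1\<rceil>"
  have q: "real q \<ge> R" "real q \<ge> 1" unfolding q_def by linarith+
  define N0 where "N0 = real ((2 * q + 1) ^ ?d)"
  \<comment> \<open>Passing to \<open>1 + |x - y|\<close> costs the factor \<open>2^(d-2)\<close>
    and removes the singularity at \<open>x = y\<close>, so the lattice sum may run over the full
    cube.\<close>
  have C0_bound: "cmod (C0 x y) \<le> \<epsilon> * 2 ^ (?d - 2) * (1 / (1 + site_dist x y) ^ (?d - 2))"
    if "site_dist x y \<ge> real q" for x y
  proof -
    have s1: "site_dist x y \<ge> 1" using that q by linarith
    have "cmod (C0 x y) * (1 + site_dist x y) ^ (?d - 2) \<le> cmod (C0 x y) * (2 * site_dist x y) ^ (?d - 2)"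
      using s1 by (intro mult_left_mono power_mono) auto
    also have "\<dots> = 2 ^ (?d - 2) * (site_dist x y ^ (?d - 2) * cmod (C0 x y))" by (simp add: power_mult_distrib)
    also have "\<dots> \<le> 2 ^ (?d - 2) * \<epsilon>" using R[of x y] that q by (intro mult_left_mono) auto
    finally show ?thesis using s1 by (simp add: pos_le_divide_eq mult_ac)
  qed
  \<comment> \<open>Near partners number at most \<open>N0\<close>, independently of
    \<open>k\<close>, and take the Casimir bound. Far partners take the decay and give a small
    multiple of \<open>k^2\<close>.\<close>
  have row: "(\<Sum>y\<in>V k. cmod (C0 x y)) \<le> casimir n * N0 + \<epsilon> * 2 ^ (?d - 2) * (M * (real k)\<^sup>2)"
    if k: "k \<ge> 1" and x: "x \<in> V k" for k x
  proof -
    let ?A = "{y \<in> V k. site_dist x y < real q}" and ?B = "{y \<in> V k. \<not> site_dist x y < real q}"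
    have "(\<Sum>y\<in>V k. cmod (C0 x y)) = (\<Sum>y\<in>?A. cmod (C0 x y)) + (\<Sum>y\<in>?B. cmod (C0 x y))"
      using finV[of k] by (subst sum.union_disjoint[symmetric]) (auto intro!: sum.cong)
    also have "(\<Sum>y\<in>?A. cmod (C0 x y)) \<le> casimir n * N0"
    proof -
      let ?Q = "{y :: 'd site. \<forall>i. y $ i \<in> {x $ i - int q..x $ i + int q}}"
      have "?A \<subseteq> ?Q"
      proof
        fix y assume "y \<in> ?A"
        hence "\<bar>real_of_int (x $ i - y $ i)\<bar> \<le> real q" for i
          using abs_component_le_site_dist[of x i y] by simp
        hence "\<bar>x $ i - y $ i\<bar> \<le> int q" for i by (metis of_int_abs of_int_le_iff of_int_of_nat_eq)
        hence "y $ i \<in> {x $ i - int q..x $ i + int q}" for i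
          unfolding atLeastAtMost_iff by (smt (verit))
        thus "y \<in> ?Q" by blast
      qed
      moreover have "finite ?Q" by (rule finite_vec_set) simp
      ultimately have "card ?A \<le> card ?Q" by (intro card_mono)
      also have "card ?Q = (2 * q + 1) ^ ?d"
      proof -
        have "nat (x $ i + int q - (x $ i - int q) + 1) = 2 * q + 1" for i by simp
        thus ?thesis by (subst card_vec_set) (auto simp: nat_add_distrib)
      qed
      finally have "real (card ?A) \<le> N0" unfolding N0_def by (simp only: of_nat_le_iff)
      have "(\<Sum>y\<in>?A. cmod (C0 x y)) \<le> real (card ?A) * casimir n"
        using sum_bounded_above[of ?A "\<lambda>y. cmod (C0 x y)" "casimir n"] C0_le by simp
      also have "\<dots> \<le> N0 * casimir n"
        using \<open>real (card ?A) \<le> N0\<close> by (intro mult_right_mono) (auto simp: casimir_def)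
      finally show ?thesis by (simp add: mult.commute)
    qed
    also have "(\<Sum>y\<in>?B. cmod (C0 x y)) \<le> \<epsilon> * 2 ^ (?d - 2) * (M * (real k)\<^sup>2)"
    proof -
      let ?Y = "{y :: 'd site. \<forall>i. y $ i \<in> {0..<int (2 * k)}}"
      have "(\<Sum>y\<in>?B. cmod (C0 x y)) \<le> (\<Sum>y\<in>?B. \<epsilon> * 2 ^ (?d - 2) * (1 / (1 + site_dist x y) ^ (?d - 2)))"
        by (intro sum_mono C0_bound) auto
      also have "\<dots> \<le> (\<Sum>y\<in>?Y. \<epsilon> * 2 ^ (?d - 2) * (1 / (1 + site_dist x y) ^ (?d - 2)))"
      proof (rule sum_mono2)
        show "finite ?Y" by (rule finite_vec_set) simp
        show "?B \<subseteq> ?Y" using V_range by blast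
      qed (use \<epsilon> site_dist_nonneg[of x] in \<open>auto intro!: mult_nonneg_nonneg divide_nonneg_nonneg\<close>)
      also have "\<dots> = \<epsilon> * 2 ^ (?d - 2) * (\<Sum>y\<in>?Y. 1 / (1 + site_dist x y) ^ (?d - 2))"
        by (rule sum_distrib_left[symmetric])
      also have "\<dots> \<le> \<epsilon> * 2 ^ (?d - 2) * (real ?d ^ ?d * (real (2 * k))\<^sup>2)"
        using \<epsilon> k by (intro mult_left_mono lattice_sum_le d3 V_range[OF x]) auto
      also have "\<dots> = \<epsilon> * 2 ^ (?d - 2) * (M * (real k)\<^sup>2)" by (simp add: M_def power_mult_distrib)
      finally show ?thesis .
    qed
    finally show ?thesis by simp
  qed
  have final: "a \<le> D * (casimir n * N0 / (real k)\<^sup>2 + \<epsilon> * 2 ^ (?d - 2) * M)" if k: "k \<ge> 1" for k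
  proof -
    have "cmod (\<Sum>x\<in>V k. \<Sum>y\<in>V k. C0 x y) \<le> (\<Sum>x\<in>V k. \<Sum>y\<in>V k. cmod (C0 x y))"
      by (rule order_trans[OF norm_sum sum_mono[OF norm_sum]])
    also have "\<dots> \<le> real k ^ ?d * (casimir n * N0 + \<epsilon> * 2 ^ (?d - 2) * (M * (real k)\<^sup>2))"
      using sum_bounded_above[of "V k" "\<lambda>x. \<Sum>y\<in>V k. cmod (C0 x y)", OF row[OF k]] by (simp add: cardV)
    finally have "D * cmod (\<Sum>x\<in>V k. \<Sum>y\<in>V k. C0 x y) / (real k)\<^sup>2
        \<le> D * (real k ^ ?d * (casimir n * N0 + \<epsilon> * 2 ^ (?d - 2) * (M * (real k)\<^sup>2))) / (real k)\<^sup>2"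
      using D by (intro divide_right_mono mult_left_mono) auto
    also have "\<dots> = real k ^ ?d * (D * (casimir n * N0 / (real k)\<^sup>2 + \<epsilon> * 2 ^ (?d - 2) * M))"
      using k by (simp add: field_simps)
    finally have "real k ^ ?d * a \<le> real k ^ ?d * (D * (casimir n * N0 / (real k)\<^sup>2 + \<epsilon> * 2 ^ (?d - 2) * M))"
      using main[OF k] unfolding D_def[symmetric] by linarith
    thus ?thesis using k by (simp add: mult_le_cancel_left)
  qed
  \<comment> \<open>With \<open>\<epsilon>\<close> and \<open>N0\<close> fixed, the near
    contribution dies as \<open>1/k^2\<close>, and the choice of \<open>\<epsilon>\<close> leaves
    \<open>a \<le> a/2\<close>.\<close>
  have "(\<lambda>k. D * (casimir n * N0 / (real k)\<^sup>2 + \<epsilon> * 2 ^ (?d - 2) * M)) \<longlonglongrightarrow> D * (0 + \<epsilon> * 2 ^ (?d - 2) * M)"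
    by (intro tendsto_intros real_tendsto_divide_at_top[OF tendsto_const] filterlim_pow_at_top filterlim_real_sequentially) simp
  hence "a \<le> D * (0 + \<epsilon> * 2 ^ (?d - 2) * M)"
    by (rule tendsto_lowerbound) (auto intro!: eventually_sequentiallyI[of 1] final)
  also have "\<epsilon> * 2 ^ (?d - 2) * M = a / (2 * (D + 1))"
    using M by (simp add: \<epsilon>_def)
  also have "D * (0 + a / (2 * (D + 1))) = a / 2 * (D / (D + 1))"
    by simp
  also have "\<dots> \<le> a / 2 * 1" using a D by (intro mult_left_mono) auto
  finally show False using a by simp
qed

end
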